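(* Let $u$ be a nonconstant real symmetric inner function and let $\phi_1,\phi_2\in L^2$ be such that $B^u_{\phi_1}$ and $B^u_{\phi_2}$ are bounded and neither of them is a constant multiple of $D$. Then $B^u_{\phi_1}B^u_{\phi_2}\in\mathcal{T}(u)$ if and only if there exist $\alpha\in\widehat{\mathbb{C}}=\mathbb{C}\cup\{\infty\}$, $\psi_1,\psi_2\in K_u$ and $c_1,c_2\in\mathbb{C}$ such that $$\phi_1\overset{\mathrm{B}}{\equiv}\overline{u}\,\overline{\widehat{\psi_1}}+\alpha\,\overline{u}\,S_uC_u\widehat{\psi_1}+\overline{u}c_1\quad\text{and}\quad \phi_2\overset{\mathrm{B}}{\equiv}\overline{u}\psi_2+\alpha\,\overline{u}\,\overline{S_uC_u\psi_2}+\overline{u}c_2,$$ where for $\alpha=\infty$ these two conditions are read as $\phi_1\overset{\mathrm{B}}{\equiv}\overline u\,\widehat{\psi_1}$ and $\phi_2\overset{\mathrm{B}}{\equiv}\overline u\,\overline{\psi_2}$.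
   Context: $L^2=L^2(\mathbb{T})$, $H^2\subset L^2$ is the Hardy space, $P:L^2\to H^2$ the orthogonal projection. For an inner function $u$, $K_u=H^2\ominus uH^2$ with orthogonal projection $P_u:L^2\to K_u$; $C_uf=u\,\overline{zf}$ (on $\mathbb{T}$) is a conjugation on $K_u$; $Uf(z)=\widehat f(z)=\overline{f(\overline z)}$. $u$ is real symmetric if $u=\widehat u$; then $U$ maps $K_u$ onto $K_u$ and $D:=C_uU$ is a linear operator on $K_u$ with $D=D^*$, $D^2=I$. $J:L^2\to L^2$ is $Jf(z)=\overline zf(\overline z)$. $S_uf=P_u(zf)$ on $K_u$. For $\phi\in L^2$, the densely defined operators $A^u_\phi f=P_u(\phi f)$ and $B^u_\phi f=P_uJ(I-P)(\phi f)$ on $K_u$ are the truncated Toeplitz and truncated Hankel operators; $\mathcal{T}(u)$ is the space of all bounded truncated Toeplitz operators on $K_u$. $\varphi\overset{\mathrm{B}}{\equiv}\psi$ means $B^u_\varphi=B^u_\psi$. *)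

theory Defs
  imports "HOL-Analysis.Analysis"
begin

text \<open>
  Elements of \<open>L\<^sup>2\<close> of the unit circle are represented by Borel functions on the complex plane;
  only their values on the circle matter, and only up to null sets. Equality of elements of
  \<open>L\<^sup>2\<close> is therefore \<open>=\<^sub>T\<close> below, and every statement about operators is made modulo
  \<open>=\<^sub>T\<close>. Functions in the Hardy space, in particular inner functions, are
  identified with their boundary functions.
\<close>

definition circle :: "complex measure" where
  "circle = distr (uniform_measure lborel {0..<2 * pi}) borel cis"

definition ae_eq :: "(complex \<Rightarrow> complex) \<Rightarrow> (complex \<Rightarrow> complex) \<Rightarrow> bool" (infix "=\<^sub>T" 50) where
  "f =\<^sub>T g \<longleftrightarrow> (AE z in circle. f z = g z)"

definition L2 :: "(complex \<Rightarrow> complex) set" where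
  "L2 = {f. f \<in> borel_measurable borel \<and> integrable circle (\<lambda>z. (norm (f z))\<^sup>2)}"

definition L2_inner :: "(complex \<Rightarrow> complex) \<Rightarrow> (complex \<Rightarrow> complex) \<Rightarrow> complex" where
  "L2_inner f g = (LINT z|circle. f z * cnj (g z))"

definition L2_norm :: "(complex \<Rightarrow> complex) \<Rightarrow> real" where
  "L2_norm f = sqrt (LINT z|circle. (norm (f z))\<^sup>2)"

definition fourier_coeff :: "(complex \<Rightarrow> complex) \<Rightarrow> int \<Rightarrow> complex" where
  "fourier_coeff f n = L2_inner f (\<lambda>z. z powi n)"

definition H2 :: "(complex \<Rightarrow> complex) set" where
  "H2 = {f \<in> L2. \<forall>n<0. fourier_coeff f n = 0}"

text \<open>The orthogonal projection onto a closed subspace \<open>M\<close> of \<open>L\<^sup>2\<close>; on \<open>L\<^sup>2\<close> the value is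
  determined up to a null set.\<close>

definition orth_proj :: "(complex \<Rightarrow> complex) set \<Rightarrow> (complex \<Rightarrow> complex) \<Rightarrow> complex \<Rightarrow> complex" where
  "orth_proj M f = (SOME g. g \<in> M \<and> (\<forall>h\<in>M. L2_inner (\<lambda>z. f z - g z) h = 0))"

definition inner_function :: "(complex \<Rightarrow> complex) \<Rightarrow> bool" where
  "inner_function u \<longleftrightarrow> u \<in> H2 \<and> (AE z in circle. norm (u z) = 1)"

definition nonconstant :: "(complex \<Rightarrow> complex) \<Rightarrow> bool" where
  "nonconstant u \<longleftrightarrow> \<not> (\<exists>c. u =\<^sub>T (\<lambda>z. c))"

definition K :: "(complex \<Rightarrow> complex) \<Rightarrow> (complex \<Rightarrow> complex) set" where
  "K u = {f \<in> H2. \<forall>h\<in>H2. L2_inner f (\<lambda>z. u z * h z) = 0}"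

definition K_bdd :: "(complex \<Rightarrow> complex) \<Rightarrow> (complex \<Rightarrow> complex) set" where
  "K_bdd u = {f \<in> K u. \<exists>M. AE z in circle. norm (f z) \<le> M}"

text \<open>\<open>hat_op\<close> is the map written \<open>U\<close> and as a hat; \<open>C_op u\<close>, \<open>D_op u\<close>, \<open>S_op u\<close> are
  \<open>C\<^sub>u\<close>, \<open>D = C\<^sub>u U\<close> and the compressed shift \<open>S\<^sub>u\<close>.\<close>

definition hat_op :: "(complex \<Rightarrow> complex) \<Rightarrow> complex \<Rightarrow> complex" where
  "hat_op f = (\<lambda>z. cnj (f (cnj z)))"

definition C_op :: "(complex \<Rightarrow> complex) \<Rightarrow> (complex \<Rightarrow> complex) \<Rightarrow> complex \<Rightarrow> complex" where
  "C_op u f = (\<lambda>z. u z * cnj (z * f z))"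

definition D_op :: "(complex \<Rightarrow> complex) \<Rightarrow> (complex \<Rightarrow> complex) \<Rightarrow> complex \<Rightarrow> complex" where
  "D_op u f = C_op u (hat_op f)"

definition J_op :: "(complex \<Rightarrow> complex) \<Rightarrow> complex \<Rightarrow> complex" where
  "J_op f = (\<lambda>z. cnj z * f (cnj z))"

definition S_op :: "(complex \<Rightarrow> complex) \<Rightarrow> (complex \<Rightarrow> complex) \<Rightarrow> complex \<Rightarrow> complex" where
  "S_op u f = orth_proj (K u) (\<lambda>z. z * f z)"

definition real_symmetric :: "(complex \<Rightarrow> complex) \<Rightarrow> bool" where
  "real_symmetric u \<longleftrightarrow> u =\<^sub>T hat_op u"

text \<open>The densely defined truncated Toeplitz and truncated Hankel operators with symbol
  \<open>\<phi> \<in> L\<^sup>2\<close>. Their domain is the dense subspace \<open>K_bdd u\<close>, on which \<open>\<phi> f \<in> L\<^sup>2\<close>; the formulas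
  are only used there.\<close>

definition A_op :: "(complex \<Rightarrow> complex) \<Rightarrow> (complex \<Rightarrow> complex) \<Rightarrow> (complex \<Rightarrow> complex) \<Rightarrow> complex \<Rightarrow> complex" where
  "A_op u \<phi> f = orth_proj (K u) (\<lambda>z. \<phi> z * f z)"

definition B_op :: "(complex \<Rightarrow> complex) \<Rightarrow> (complex \<Rightarrow> complex) \<Rightarrow> (complex \<Rightarrow> complex) \<Rightarrow> complex \<Rightarrow> complex" where
  "B_op u \<phi> f = orth_proj (K u) (J_op (\<lambda>z. \<phi> z * f z - orth_proj H2 (\<lambda>w. \<phi> w * f w) z))"

definition B_equiv :: "(complex \<Rightarrow> complex) \<Rightarrow> (complex \<Rightarrow> complex) \<Rightarrow> (complex \<Rightarrow> complex) \<Rightarrow> bool" where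
  "B_equiv u \<phi> \<psi> \<longleftrightarrow> (\<forall>f\<in>K_bdd u. B_op u \<phi> f =\<^sub>T B_op u \<psi> f)"

definition bounded_op ::
    "(complex \<Rightarrow> complex) \<Rightarrow> ((complex \<Rightarrow> complex) \<Rightarrow> complex \<Rightarrow> complex) \<Rightarrow> bool" where
  "bounded_op u T \<longleftrightarrow> (\<exists>M. \<forall>f\<in>K_bdd u. L2_norm (T f) \<le> M * L2_norm f)"

text \<open>The extension by continuity to \<open>K u\<close> of an operator that is bounded on \<open>K_bdd u\<close>.\<close>

definition bounded_ext ::
    "(complex \<Rightarrow> complex) \<Rightarrow> ((complex \<Rightarrow> complex) \<Rightarrow> complex \<Rightarrow> complex)
      \<Rightarrow> (complex \<Rightarrow> complex) \<Rightarrow> complex \<Rightarrow> complex" where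
  "bounded_ext u T f = (SOME g. g \<in> K u \<and>
     (\<forall>s. (\<forall>n. s n \<in> K_bdd u) \<longrightarrow> (\<lambda>n. L2_norm (\<lambda>z. s n z - f z)) \<longlonglongrightarrow> 0
        \<longrightarrow> (\<lambda>n. L2_norm (\<lambda>z. T (s n) z - g z)) \<longlonglongrightarrow> 0))"

definition truncated_Toeplitz ::
    "(complex \<Rightarrow> complex) \<Rightarrow> ((complex \<Rightarrow> complex) \<Rightarrow> complex \<Rightarrow> complex) set" where
  "truncated_Toeplitz u = {T. (\<forall>f\<in>K u. T f \<in> K u) \<and>
     (\<exists>\<phi>\<in>L2. bounded_op u (A_op u \<phi>) \<and>
        (\<forall>f\<in>K u. T f =\<^sub>T bounded_ext u (A_op u \<phi>) f))}"

definition multiple_of_D ::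
    "(complex \<Rightarrow> complex) \<Rightarrow> ((complex \<Rightarrow> complex) \<Rightarrow> complex \<Rightarrow> complex) \<Rightarrow> bool" where
  "multiple_of_D u T \<longleftrightarrow> (\<exists>c. \<forall>f\<in>K u. T f =\<^sub>T (\<lambda>z. c * D_op u f z))"

datatype extended_complex = Finite complex | Infinity

end

theory Submission
  imports Defs
begin

text \<open>
  On the circle \<open>D f = u \<cdot> cnj z \<cdot> f (cnj z)\<close>, so that \<open>B\<^sub>\<phi> = D A\<^sub>\<sigma>\<close> with \<open>\<sigma> = u \<phi>\<close>, and
  conjugation by \<open>D\<close> turns the Toeplitz symbol \<open>\<sigma>\<close> into \<open>\<sigma> (cnj z)\<close>. The product of the two
  truncated Hankel operators is therefore the product of two truncated Toeplitz operators, and the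
  claim becomes Sedlock's theorem on such products.

  Write the symbols as \<open>\<psi>\<^sub>i + cnj \<eta>\<^sub>i\<close> with \<open>\<psi>\<^sub>i, \<eta>\<^sub>i\<close> in the model space. By Sarason's theorem a
  bounded operator \<open>X\<close> is truncated Toeplitz iff \<open>\<langle>X f, g\<rangle> = \<langle>X S\<^sup>* f, S\<^sup>* g\<rangle>\<close> whenever \<open>f\<close> and \<open>g\<close>
  vanish at the origin. For a product \<open>X = A\<^sub>1 A\<^sub>2\<close> the difference of the two sides is
  \<open>\<langle>f, \<eta>\<^sub>2\<rangle> \<langle>\<psi>\<^sub>1, g\<rangle> - \<langle>f, W \<psi>\<^sub>2\<rangle> \<langle>W \<eta>\<^sub>1, g\<rangle>\<close>, where \<open>W = S\<^sub>u C\<^sub>u\<close>. Two forms of rank at most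
  one agree on the orthogonal complement of the reproducing kernel \<open>k\<^sub>0\<close> at the origin. If they are
  nonzero, then \<open>\<eta>\<^sub>i\<close> is the same multiple of \<open>W \<psi>\<^sub>i\<close> modulo \<open>k\<^sub>0\<close> for \<open>i = 1, 2\<close>, because
  \<open>W\<^sup>2\<close> is the identity modulo \<open>k\<^sub>0\<close>; if they vanish, then \<open>\<alpha>\<close> is \<open>0\<close> or \<open>\<infinity>\<close>.
\<close>

section \<open>Integration on the circle\<close>

lemma cis_borel [measurable]: "cis \<in> borel_measurable borel"
  by (intro borel_measurable_continuous_onI continuous_intros)

lemma cnj_borel [measurable (raw)]:
  "f \<in> borel_measurable M \<Longrightarrow> (\<lambda>x. cnj (f x)) \<in> borel_measurable M"
  by (rule measurable_compose[OF _ borel_measurable_continuous_onI[OF continuous_on_cnj[OF continuous_on_id]]])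

lemma sets_circle [simp, measurable_cong]: "sets circle = sets borel"
  and space_circle [simp]: "space circle = UNIV"
  by (auto simp: circle_def)

lemma emeasure_lborel_2pi: "emeasure lborel {0..<2 * pi} = ennreal (2 * pi)"
  by simp

lemma emeasure_circle: "emeasure circle UNIV = 1"
  unfolding circle_def
  by (subst emeasure_distr) (simp_all add: emeasure_lborel_2pi divide_ennreal)

lemma finite_measure_circle: "finite_measure circle"
  by (rule finite_measureI) (simp add: emeasure_circle)

interpretation circle: finite_measure circle
  by (rule finite_measure_circle)

lemma measure_circle: "measure circle UNIV = 1"
  by (simp add: measure_def emeasure_circle)

lemma AE_circle_norm: "AE z in circle. norm z = 1"
  unfolding circle_def by (subst AE_distr_iff) auto

lemma circle_eq_density:
  "circle = distr (density lborel (\<lambda>t. ennreal (indicator {0..<2 * pi} t / (2 * pi)))) borel cis"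
proof -
  have "(\<lambda>t. indicator {0..<2 * pi} t / emeasure lborel {0..<2 * pi})
      = (\<lambda>t. ennreal (indicator {0..<2 * pi} t / (2 * pi)))"
    by (auto simp: indicator_def fun_eq_iff emeasure_lborel_2pi divide_ennreal
        simp flip: ennreal_1)
  then show ?thesis
    unfolding circle_def uniform_measure_def by simp
qed

lemma integral_circle:
  fixes f :: "complex \<Rightarrow> 'b :: {banach, second_countable_topology}"
  assumes [measurable]: "f \<in> borel_measurable borel"
  shows "(LINT z|circle. f z) = (LINT t|lborel. (indicator {0..<2 * pi} t / (2 * pi)) *\<^sub>R f (cis t))"
  unfolding circle_eq_density
  by (subst integral_distr, measurable, subst integral_density) auto

lemma nn_integral_circle:
  assumes [measurable]: "f \<in> borel_measurable borel"
  shows "(\<integral>\<^sup>+z. f z \<partial>circle)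
    = (\<integral>\<^sup>+t. ennreal (indicator {0..<2 * pi} t / (2 * pi)) * f (cis t) \<partial>lborel)"
  unfolding circle_eq_density
  by (subst nn_integral_distr, measurable, subst nn_integral_density) auto

lemma distr_circle_cnj: "distr circle borel cnj = circle"
proof (rule measure_eqI)
  show "sets (distr circle borel cnj) = sets circle" by simp
  fix A assume "A \<in> sets (distr circle borel cnj)"
  then have A[measurable]: "A \<in> sets borel" by simp
  let ?w = "\<lambda>t. ennreal (indicator {0..<2 * pi} t / (2 * pi))"
  have "emeasure (distr circle borel cnj) A = (\<integral>\<^sup>+z. indicator A z \<partial>distr circle borel cnj)"
    by simp
  also have "\<dots> = (\<integral>\<^sup>+z. indicator A (cnj z) \<partial>circle)"
    by (subst nn_integral_distr) auto
  also have "\<dots> = (\<integral>\<^sup>+t. ?w t * indicator A (cis (- t)) \<partial>lborel)"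
    by (subst nn_integral_circle) (auto simp: cis_cnj)
  also have "\<dots> = (\<integral>\<^sup>+t. ?w (2 * pi + (-1) * t) * indicator A (cis (- (2 * pi + (-1) * t))) \<partial>lborel)"
    by (subst nn_integral_real_affine[where c = "-1" and t = "2 * pi"]) auto
  also have "\<dots> = (\<integral>\<^sup>+t. ?w t * indicator A (cis t) \<partial>lborel)"
  proof (rule nn_integral_cong_AE)
    have "AE t in lborel. t \<noteq> (0::real)" "AE t in lborel. t \<noteq> 2 * pi"
      by (rule AE_lborel_singleton)+
    then show "AE t in lborel. ?w (2 * pi + (-1) * t) * indicator A (cis (- (2 * pi + (-1) * t)))
        = ?w t * indicator A (cis t)"
    proof eventually_elim
      case (elim t)
      have "cis (- (2 * pi + (-1) * t)) = cis t"
        by (simp add: complex_eq_iff cos_diff sin_diff)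
      then show ?case
        using elim by (auto simp: indicator_def)
    qed
  qed
  also have "\<dots> = (\<integral>\<^sup>+z. indicator A z \<partial>circle)"
    by (subst nn_integral_circle) auto
  finally show "emeasure (distr circle borel cnj) A = emeasure circle A"
    by simp
qed

lemma integral_circle_cnj:
  fixes f :: "complex \<Rightarrow> 'b :: {banach, second_countable_topology}"
  assumes [measurable]: "f \<in> borel_measurable borel"
  shows "(LINT z|circle. f (cnj z)) = (LINT z|circle. f z)"
  by (subst (2) distr_circle_cnj[symmetric], subst integral_distr) auto

lemma integrable_circle_cnj:
  fixes f :: "complex \<Rightarrow> 'b :: {banach, second_countable_topology}"
  assumes [measurable]: "f \<in> borel_measurable borel"
  shows "integrable circle (\<lambda>z. f (cnj z)) \<longleftrightarrow> integrable circle f"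
  by (subst (2) distr_circle_cnj[symmetric], subst integrable_distr_eq) auto

lemma AE_circle_cnj:
  assumes "AE z in circle. P z"
  shows "AE z in circle. P (cnj z)"
proof -
  have "AE z in distr circle borel cnj. P z"
    using assms by (subst distr_circle_cnj)
  then show ?thesis
    by (rule AE_distrD[rotated]) auto
qed

lemma integral_circle_powi:
  "(LINT z|circle. z powi n) = (if n = 0 then 1 else 0)"
proof (cases "n = 0")
  case True
  then show ?thesis by (simp add: measure_circle)
next
  case False
  let ?F = "\<lambda>t. cis (of_int n * t) / (\<i> * of_int n)"
  have meas: "(\<lambda>z::complex. z powi n) \<in> borel_measurable borel"
    unfolding power_int_def by measurable
  have "(LINT z|circle. z powi n)
      = (LINT t|lborel. (indicator {0..<2 * pi} t / (2 * pi)) *\<^sub>R (cis t powi n))"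
    by (rule integral_circle[OF meas])
  also have "\<dots> = (LINT t|lborel. (1 / (2 * pi)) *\<^sub>R (indicator {0..2 * pi} t *\<^sub>R cis (of_int n * t)))"
  proof (rule integral_cong_AE)
    show "(\<lambda>t. (indicator {0..<2 * pi} t / (2 * pi)) *\<^sub>R (cis t powi n)) \<in> borel_measurable lborel"
      using meas by (auto intro!: borel_measurable_scaleR measurable_compose[OF _ meas])
    show "(\<lambda>t. (1 / (2 * pi)) *\<^sub>R (indicator {0..2 * pi} t *\<^sub>R cis (of_int n * t))) \<in> borel_measurable lborel"
      by measurable
    show "AE t in lborel. (indicator {0..<2 * pi} t / (2 * pi)) *\<^sub>R (cis t powi n) =
         (1 / (2 * pi)) *\<^sub>R (indicator {0..2 * pi} t *\<^sub>R cis (of_int n * t))"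
      using AE_lborel_singleton[of "2 * pi"]
      by eventually_elim (auto simp: indicator_def cis_power_int)
  qed
  also have "\<dots> = (1 / (2 * pi)) *\<^sub>R (LINT t|lborel. indicator {0..2 * pi} t *\<^sub>R cis (of_int n * t))"
    by (rule integral_scaleR_right)
  also have "(LINT t|lborel. indicator {0..2 * pi} t *\<^sub>R cis (of_int n * t)) = ?F (2 * pi) - ?F 0"
  proof (rule integral_FTC_Icc)
    fix t :: real
    have "(?F has_vector_derivative ((of_int n * 1) *\<^sub>R (\<i> * cis (of_int n * t))) / (\<i> * of_int n)) (at t within {0..2 * pi})"
      by (rule has_vector_derivative_divide, rule has_vector_derivative_at_within,
          rule vector_diff_chain_at[unfolded o_def, where g' = "\<i> * cis (of_int n * t)"])
         (auto intro!: derivative_eq_intros simp: has_vector_derivative_def)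
    moreover have "((of_int n * 1) *\<^sub>R (\<i> * cis (of_int n * t))) / (\<i> * of_int n) = cis (of_int n * t)"
      using False by (simp add: scaleR_conv_of_real)
    ultimately show "(?F has_vector_derivative cis (of_int n * t)) (at t within {0..2 * pi})"
      by simp
  qed (auto intro!: continuous_intros)
  also have "?F (2 * pi) - ?F 0 = 0"
  proof -
    have "cis (of_int n * (2 * pi)) = cis (2 * pi) powi n"
      by (simp add: cis_power_int mult.commute)
    then show ?thesis by simp
  qed
  finally show ?thesis using False by simp
qed

section \<open>The space of square integrable functions\<close>

lemma L2_borel [measurable_dest]: "f \<in> L2 \<Longrightarrow> f \<in> borel_measurable borel"
  by (simp add: L2_def)

lemma L2_dominated:
  assumes "f \<in> borel_measurable borel" "integrable circle g"
    and "AE z in circle. (norm (f z))\<^sup>2 \<le> g z"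
  shows "f \<in> L2"
proof -
  have [measurable]: "f \<in> borel_measurable borel" by fact
  have "integrable circle (\<lambda>z. (norm (f z))\<^sup>2)"
    by (rule Bochner_Integration.integrable_bound[OF assms(2)])
      (use assms(3) in \<open>auto elim!: eventually_mono\<close>)
  then show ?thesis by (simp add: L2_def assms(1))
qed

lemma L2_integrable: "f \<in> L2 \<Longrightarrow> integrable circle (\<lambda>z. (norm (f z))\<^sup>2)"
  by (simp add: L2_def)

lemma L2_add:
  assumes "f \<in> L2" "g \<in> L2"
  shows "(\<lambda>z. f z + g z) \<in> L2"
proof (rule L2_dominated)
  show "integrable circle (\<lambda>z. 2 * (norm (f z))\<^sup>2 + 2 * (norm (g z))\<^sup>2)"
    using assms by (auto intro!: L2_integrable)
  have "(norm (f z + g z))\<^sup>2 \<le> 2 * (norm (f z))\<^sup>2 + 2 * (norm (g z))\<^sup>2" for z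
  proof -
    have "(norm (f z + g z))\<^sup>2 \<le> (norm (f z) + norm (g z))\<^sup>2"
      by (intro power_mono norm_triangle_ineq) auto
    also have "\<dots> \<le> 2 * (norm (f z))\<^sup>2 + 2 * (norm (g z))\<^sup>2"
      using sum_squares_ge_zero[of "norm (f z) - norm (g z)" 0]
      by (simp add: power2_eq_square algebra_simps)
    finally show ?thesis .
  qed
  then show "AE z in circle. (norm (f z + g z))\<^sup>2 \<le> 2 * (norm (f z))\<^sup>2 + 2 * (norm (g z))\<^sup>2"
    by auto
qed (use assms in measurable)

lemma L2_mult_bounded:
  assumes "f \<in> L2" "b \<in> borel_measurable borel" "AE z in circle. norm (b z) \<le> M"
  shows "(\<lambda>z. f z * b z) \<in> L2"
proof (rule L2_dominated)
  show "integrable circle (\<lambda>z. M\<^sup>2 * (norm (f z))\<^sup>2)"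
    using assms by (auto intro!: L2_integrable)
  show "AE z in circle. (norm (f z * b z))\<^sup>2 \<le> M\<^sup>2 * (norm (f z))\<^sup>2"
    using assms(3)
  proof eventually_elim
    case (elim z)
    have "(norm (b z))\<^sup>2 \<le> M\<^sup>2" using elim by (intro power_mono) auto
    then show ?case
      by (simp add: norm_mult power_mult_distrib mult.commute[of "(norm (f z))\<^sup>2"] mult_right_mono)
  qed
qed (use assms in measurable)

lemma L2_bounded:
  assumes "b \<in> borel_measurable borel" "AE z in circle. norm (b z) \<le> M"
  shows "b \<in> L2"
proof (rule L2_dominated)
  show "integrable circle (\<lambda>z. M\<^sup>2)" by simp
  show "AE z in circle. (norm (b z))\<^sup>2 \<le> M\<^sup>2"
    using assms(2) by eventually_elim (intro power_mono, auto)
qed fact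

lemma L2_const: "(\<lambda>z. c) \<in> L2"
  by (rule L2_bounded[where M = "norm c"]) auto

lemma L2_scale: "f \<in> L2 \<Longrightarrow> (\<lambda>z. c * f z) \<in> L2"
  using L2_mult_bounded[of f "\<lambda>z. c" "norm c"] by (simp add: mult.commute)

lemma L2_uminus: "f \<in> L2 \<Longrightarrow> (\<lambda>z. - f z) \<in> L2"
  using L2_scale[of f "-1"] by simp

lemma L2_diff: "f \<in> L2 \<Longrightarrow> g \<in> L2 \<Longrightarrow> (\<lambda>z. f z - g z) \<in> L2"
  using L2_add[OF _ L2_uminus, of f g] by simp

lemma L2_cnj: "f \<in> L2 \<Longrightarrow> (\<lambda>z. cnj (f z)) \<in> L2"
  by (auto simp: L2_def)

lemma L2_flip:
  assumes "f \<in> L2"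
  shows "(\<lambda>z. f (cnj z)) \<in> L2"
proof -
  have [measurable]: "f \<in> borel_measurable borel" using assms by measurable
  show ?thesis
    using integrable_circle_cnj[of "\<lambda>z. (norm (f z))\<^sup>2"] assms by (auto simp: L2_def)
qed

lemma powi_borel [measurable]: "(\<lambda>z::complex. z powi n) \<in> borel_measurable borel"
  unfolding power_int_def by measurable

lemma L2_powi: "(\<lambda>z. z powi n) \<in> L2"
  by (rule L2_bounded[where M = 1])
    (use AE_circle_norm in \<open>auto elim!: eventually_mono simp: norm_power_int\<close>)

lemma integrable_L2_mult:
  assumes "f \<in> L2" "g \<in> L2"
  shows "integrable circle (\<lambda>z. f z * g z)"
proof -
  have [measurable]: "f \<in> borel_measurable borel" "g \<in> borel_measurable borel"
    using assms by measurable
  have "integrable circle (\<lambda>z. (norm (f z))\<^sup>2 + (norm (g z))\<^sup>2)"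
    using assms by (auto intro!: L2_integrable)
  then show ?thesis
  proof (rule Bochner_Integration.integrable_bound)
    have "norm (f z * g z) \<le> (norm (f z))\<^sup>2 + (norm (g z))\<^sup>2" for z
    proof -
      have "2 * (norm (f z) * norm (g z)) \<le> (norm (f z))\<^sup>2 + (norm (g z))\<^sup>2"
        using sum_squares_ge_zero[of "norm (f z) - norm (g z)" 0]
        by (simp add: power2_eq_square algebra_simps)
      moreover have "0 \<le> norm (f z) * norm (g z)" by simp
      ultimately show ?thesis unfolding norm_mult by linarith
    qed
    then show "AE z in circle. norm (f z * g z) \<le> norm ((norm (f z))\<^sup>2 + (norm (g z))\<^sup>2)"
      by auto
  qed measurable
qed

lemma integrable_L2_inner:
  "f \<in> L2 \<Longrightarrow> g \<in> L2 \<Longrightarrow> integrable circle (\<lambda>z. f z * cnj (g z))"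
  by (intro integrable_L2_mult L2_cnj)

lemma L2_inner_cong:
  assumes "f \<in> L2" "f' \<in> L2" "g \<in> L2" "g' \<in> L2" "f =\<^sub>T f'" "g =\<^sub>T g'"
  shows "L2_inner f g = L2_inner f' g'"
  unfolding L2_inner_def
proof (rule integral_cong_AE)
  show "AE z in circle. f z * cnj (g z) = f' z * cnj (g' z)"
    using assms(5,6) unfolding ae_eq_def by eventually_elim auto
qed (use assms in measurable)

lemma ae_eq_refl [simp]: "f =\<^sub>T f"
  and ae_eq_sym: "f =\<^sub>T g \<Longrightarrow> g =\<^sub>T f"
  by (auto simp: ae_eq_def elim: eventually_mono)

lemma ae_eq_trans: "f =\<^sub>T g \<Longrightarrow> g =\<^sub>T h \<Longrightarrow> f =\<^sub>T h"
  unfolding ae_eq_def by (erule (1) eventually_elim2) auto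

definition l2rel :: "(complex \<Rightarrow> complex) \<Rightarrow> (complex \<Rightarrow> complex) \<Rightarrow> bool" where
  "l2rel f g \<longleftrightarrow> f \<in> L2 \<and> g \<in> L2 \<and> f =\<^sub>T g"

quotient_type l2 = "complex \<Rightarrow> complex" / partial: l2rel
proof (rule part_equivpI)
  show "\<exists>f. l2rel f f"
    using L2_const by (auto simp: l2rel_def)
  show "symp l2rel"
    by (auto simp: l2rel_def symp_def intro: ae_eq_sym)
  show "transp l2rel"
    by (auto simp: l2rel_def transp_def intro: ae_eq_trans)
qed

lemma l2rel_refl_iff [simp]: "l2rel f f \<longleftrightarrow> f \<in> L2"
  by (auto simp: l2rel_def)

instantiation l2 :: real_vector
begin

lift_definition zero_l2 :: l2 is "\<lambda>z. 0"
  by (simp add: l2rel_def L2_const)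

lift_definition plus_l2 :: "l2 \<Rightarrow> l2 \<Rightarrow> l2" is "\<lambda>f g z. f z + g z"
proof -
  fix f f' g g' assume "l2rel f f'" "l2rel g g'"
  moreover from this have "(\<lambda>z. f z + g z) =\<^sub>T (\<lambda>z. f' z + g' z)"
    unfolding l2rel_def ae_eq_def by (auto elim: eventually_elim2)
  ultimately show "l2rel (\<lambda>z. f z + g z) (\<lambda>z. f' z + g' z)"
    by (auto simp: l2rel_def intro: L2_add)
qed

lift_definition uminus_l2 :: "l2 \<Rightarrow> l2" is "\<lambda>f z. - f z"
  by (auto simp: l2rel_def ae_eq_def intro: L2_uminus elim: eventually_mono)

lift_definition minus_l2 :: "l2 \<Rightarrow> l2 \<Rightarrow> l2" is "\<lambda>f g z. f z - g z"
proof -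
  fix f f' g g' assume "l2rel f f'" "l2rel g g'"
  moreover from this have "(\<lambda>z. f z - g z) =\<^sub>T (\<lambda>z. f' z - g' z)"
    unfolding l2rel_def ae_eq_def by (auto elim: eventually_elim2)
  ultimately show "l2rel (\<lambda>z. f z - g z) (\<lambda>z. f' z - g' z)"
    by (auto simp: l2rel_def intro: L2_diff)
qed

lift_definition scaleR_l2 :: "real \<Rightarrow> l2 \<Rightarrow> l2" is "\<lambda>r f z. of_real r * f z"
  by (auto simp: l2rel_def ae_eq_def intro: L2_scale elim: eventually_mono)

instance
proof
  fix x y z :: l2 and a b :: real
  show "x + y + z = x + (y + z)"
    by transfer (auto simp: l2rel_def add.assoc intro: L2_add)
  show "x + y = y + x"
    by transfer (auto simp: l2rel_def add.commute intro: L2_add)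
  show "0 + x = x"
    by transfer (auto simp: l2rel_def)
  show "- x + x = 0"
    by transfer (auto simp: l2rel_def L2_const)
  show "x - y = x + - y"
    by transfer (auto simp: l2rel_def intro: L2_diff)
  show "a *\<^sub>R (x + y) = a *\<^sub>R x + a *\<^sub>R y"
    by transfer (auto simp: l2rel_def distrib_left intro: L2_add L2_scale)
  show "(a + b) *\<^sub>R x = a *\<^sub>R x + b *\<^sub>R x"
    by transfer (auto simp: l2rel_def distrib_right intro: L2_add L2_scale)
  show "a *\<^sub>R b *\<^sub>R x = (a * b) *\<^sub>R x"
    by transfer (auto simp: l2rel_def mult.assoc intro: L2_scale)
  show "1 *\<^sub>R x = x"
    by transfer (auto simp: l2rel_def)
qed

end

lemma L2_inner_commute: "L2_inner g f = cnj (L2_inner f g)"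
proof -
  have "(LINT z|circle. cnj (f z * cnj (g z))) = cnj (L2_inner f g)"
    unfolding L2_inner_def by (rule Bochner_Integration.integral_cnj)
  then show ?thesis unfolding L2_inner_def by (simp add: mult.commute)
qed

lemma Re_L2_inner_self:
  assumes "f \<in> L2"
  shows "Re (L2_inner f f) = (LINT z|circle. (norm (f z))\<^sup>2)"
proof -
  have "L2_inner f f = (LINT z|circle. complex_of_real ((norm (f z))\<^sup>2))"
    unfolding L2_inner_def by (simp add: complex_norm_square del: of_real_power)
  also have "\<dots> = complex_of_real (LINT z|circle. (norm (f z))\<^sup>2)"
    by (rule integral_complex_of_real)
  finally show ?thesis by simp
qed

instantiation l2 :: real_inner
begin

lift_definition inner_l2 :: "l2 \<Rightarrow> l2 \<Rightarrow> real" is "\<lambda>f g. Re (L2_inner f g)"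
  by (auto simp: l2rel_def intro!: arg_cong[where f = Re] L2_inner_cong)

definition norm_l2 :: "l2 \<Rightarrow> real" where "norm_l2 x = sqrt (inner x x)"
definition sgn_l2 :: "l2 \<Rightarrow> l2" where "sgn_l2 x = x /\<^sub>R norm x"
definition dist_l2 :: "l2 \<Rightarrow> l2 \<Rightarrow> real" where "dist_l2 x y = norm (x - y)"
definition uniformity_l2 :: "(l2 \<times> l2) filter"
  where "uniformity_l2 = (INF e\<in>{0 <..}. principal {(x, y). dist x y < e})"
definition open_l2 :: "l2 set \<Rightarrow> bool"
  where "open_l2 U \<longleftrightarrow> (\<forall>x\<in>U. \<forall>\<^sub>F (x', y) in uniformity. x' = x \<longrightarrow> y \<in> U)"

instance
proof
  fix x y z :: l2 and a :: real
  show "inner x y = inner y x"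
    by transfer (metis L2_inner_commute cnj.sel(1))
  show "inner (x + y) z = inner x z + inner y z"
    by transfer (auto simp: L2_inner_def distrib_right integrable_L2_inner simp flip: Re_complex_of_real)
  show "inner (a *\<^sub>R x) y = a * inner x y"
    by transfer (auto simp: L2_inner_def mult.assoc integrable_L2_inner)
  show "0 \<le> inner x x"
    by transfer (auto simp: Re_L2_inner_self)
  show "(inner x x = 0) = (x = 0)"
  proof transfer
    fix f assume "l2rel f f"
    then have f: "f \<in> L2" by simp
    have "(LINT z|circle. (norm (f z))\<^sup>2) = 0 \<longleftrightarrow> (AE z in circle. (norm (f z))\<^sup>2 = 0)"
      by (rule integral_nonneg_eq_0_iff_AE) (use f in \<open>auto intro: L2_integrable\<close>)
    then show "(Re (L2_inner f f) = 0) = l2rel f (\<lambda>z. 0)"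
      using f by (simp add: Re_L2_inner_self l2rel_def L2_const ae_eq_def)
  qed
  show "norm x = sqrt (inner x x)" by (rule norm_l2_def)
  show "sgn x = x /\<^sub>R norm x" by (rule sgn_l2_def)
  show "dist x y = norm (x - y)" by (rule dist_l2_def)
  show "(uniformity :: (l2 \<times> l2) filter) = (INF e\<in>{0 <..}. principal {(x, y). dist x y < e})"
    by (rule uniformity_l2_def)
  show "open U \<longleftrightarrow> (\<forall>x\<in>U. \<forall>\<^sub>F (x', y) in uniformity. x' = x \<longrightarrow> y \<in> U)" for U :: "l2 set"
    by (rule open_l2_def)
qed

end

lemma norm_abs_l2: "f \<in> L2 \<Longrightarrow> norm (abs_l2 f) = L2_norm f"
  by (simp add: norm_eq_sqrt_inner inner_l2.abs_eq Re_L2_inner_self L2_norm_def)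

lemma rep_l2_L2 [simp]: "rep_l2 x \<in> L2"
  using Quotient_rep_reflp[OF Quotient_l2, of x] by simp

lemma abs_rep_l2 [simp]: "abs_l2 (rep_l2 x) = x"
  by (rule Quotient_abs_rep[OF Quotient_l2])

lemma abs_l2_eq_iff: "f \<in> L2 \<Longrightarrow> g \<in> L2 \<Longrightarrow> abs_l2 f = abs_l2 g \<longleftrightarrow> f =\<^sub>T g"
  using Quotient3_rel[OF Quotient3_l2] by (metis l2rel_def l2rel_refl_iff)

lemma L2_abs: "f \<in> L2 \<Longrightarrow> (\<lambda>z. of_real (norm (f z))) \<in> L2"
  by (auto simp: L2_def)

lemma L2_norm_eq_integral: "f \<in> L2 \<Longrightarrow> (LINT z|circle. (norm (f z))\<^sup>2) = (norm (abs_l2 f))\<^sup>2"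
  by (simp add: norm_abs_l2 L2_norm_def)

lemma integral_norm_le_norm:
  assumes "f \<in> L2"
  shows "(LINT z|circle. norm (f z)) \<le> norm (abs_l2 f)"
proof -
  let ?g = "\<lambda>z. complex_of_real (norm (f z))"
  have g: "?g \<in> L2" using assms by (rule L2_abs)
  have "inner (abs_l2 ?g) (abs_l2 (\<lambda>z. 1)) \<le> norm (abs_l2 ?g) * norm (abs_l2 (\<lambda>z. 1))"
    by (rule norm_cauchy_schwarz)
  moreover have "inner (abs_l2 ?g) (abs_l2 (\<lambda>z. 1)) = (LINT z|circle. norm (f z))"
    by (simp add: inner_l2.abs_eq g L2_const L2_inner_def)
  moreover have "norm (abs_l2 ?g) = norm (abs_l2 f)" "norm (abs_l2 (\<lambda>z. 1)) = 1"
    using assms g by (auto simp: norm_abs_l2 L2_const L2_norm_def measure_circle)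
  ultimately show ?thesis by simp
qed

instance l2 :: banach
proof
  fix X :: "nat \<Rightarrow> l2" assume "Cauchy X"
  have "\<exists>N. \<forall>m\<ge>N. \<forall>n\<ge>N. norm (X m - X n) < (1/2) ^ k" for k
    using \<open>Cauchy X\<close> by (auto simp: Cauchy_iff)
  then obtain N where N: "\<And>k m n. m \<ge> N k \<Longrightarrow> n \<ge> N k \<Longrightarrow> norm (X m - X n) < (1/2) ^ k"
    by metis
  define r where "r k = (\<Sum>i\<le>k. N i)" for k
  have rN: "r k \<ge> N k" and rSuc: "r (Suc k) \<ge> N k" for k
    unfolding r_def by (auto intro!: member_le_sum trans_le_add1)
  define f where "f k = rep_l2 (X (r k))" for k
  have fL2: "f k \<in> L2" and absf: "abs_l2 (f k) = X (r k)" for k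
    by (auto simp: f_def)
  note [measurable] = L2_borel[OF fL2]
  have dL2: "(\<lambda>z. f m z - f n z) \<in> L2" for m n by (intro L2_diff fL2)
  have absd: "abs_l2 (\<lambda>z. f m z - f n z) = X (r m) - X (r n)" for m n
    using minus_l2.abs_eq[of "f m" "f n"] by (simp add: fL2 absf)
  have "(LINT z|circle. norm (f (Suc k) z - f k z)) \<le> (1/2) ^ k" for k
    using integral_norm_le_norm[OF dL2, of "Suc k" k] N[OF rSuc rN, of k]
    by (simp add: absd)
  moreover have "integrable circle (\<lambda>z. norm (f m z - f n z))" for m n
  proof -
    have "integrable circle (\<lambda>z. (f m z - f n z) * 1)"
      by (intro integrable_L2_mult dL2 L2_const)
    then show ?thesis by simp
  qed
  ultimately have le: "(\<integral>\<^sup>+z. norm (f (Suc k) z - f k z) \<partial>circle) \<le> ennreal ((1/2) ^ k)" for k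
    by (subst nn_integral_eq_integral) auto
  have "(\<integral>\<^sup>+z. (\<Sum>k. ennreal (norm (f (Suc k) z - f k z))) \<partial>circle)
      = (\<Sum>k. \<integral>\<^sup>+z. norm (f (Suc k) z - f k z) \<partial>circle)"
    by (rule nn_integral_suminf) measurable
  also have "\<dots> \<le> (\<Sum>k. ennreal ((1/2) ^ k))"
    by (intro suminf_le le summableI)
  also have "\<dots> < \<infinity>"
    by (subst suminf_ennreal2) (auto simp: summable_geometric)
  finally have "AE z in circle. (\<Sum>k. ennreal (norm (f (Suc k) z - f k z))) \<noteq> \<infinity>"
    by (intro nn_integral_PInf_AE) auto
  then have conv: "AE z in circle. convergent (\<lambda>k. f k z)"
  proof eventually_elim
    case (elim z)
    then have "summable (\<lambda>k. norm (f (Suc k) z - f k z))"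
      by (intro summable_suminf_not_top) auto
    then have "summable (\<lambda>k. f (Suc k) z - f k z)"
      by (rule summable_norm_cancel)
    then have "convergent (\<lambda>n. \<Sum>k<n. f (Suc k) z - f k z)"
      by (simp add: summable_iff_convergent)
    then have "convergent (\<lambda>n. f n z - f 0 z)"
      by (simp add: sum_lessThan_telescope[of "\<lambda>n. f n z"])
    then have "convergent (\<lambda>n. (f n z - f 0 z) + f 0 z)"
      by (intro convergent_add convergent_const)
    then show ?case by simp
  qed
  define F where "F z = lim (\<lambda>k. f k z)" for z
  have F[measurable]: "F \<in> borel_measurable borel"
    unfolding F_def by measurable
  have fatou: "(\<integral>\<^sup>+z. (norm (F z - f n z))\<^sup>2 \<partial>circle) \<le> ennreal (((1/2) ^ k)\<^sup>2)" if "n \<ge> k" for n k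
  proof -
    have "(\<integral>\<^sup>+z. (norm (F z - f n z))\<^sup>2 \<partial>circle)
        = (\<integral>\<^sup>+z. liminf (\<lambda>m. ennreal ((norm (f m z - f n z))\<^sup>2)) \<partial>circle)"
    proof (rule nn_integral_cong_AE)
      show "AE z in circle. ennreal ((norm (F z - f n z))\<^sup>2) = liminf (\<lambda>m. ennreal ((norm (f m z - f n z))\<^sup>2))"
        using conv
      proof eventually_elim
        case (elim z)
        then have "(\<lambda>m. f m z) \<longlonglongrightarrow> F z"
          unfolding F_def by (rule convergent_LIMSEQ_iff[THEN iffD1])
        then have "(\<lambda>m. ennreal ((norm (f m z - f n z))\<^sup>2)) \<longlonglongrightarrow> ennreal ((norm (F z - f n z))\<^sup>2)"
          by (intro tendsto_intros)
        then show ?case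
          by (intro lim_imp_Liminf[symmetric]) auto
      qed
    qed
    also have "\<dots> \<le> liminf (\<lambda>m. \<integral>\<^sup>+z. (norm (f m z - f n z))\<^sup>2 \<partial>circle)"
      by (rule nn_integral_liminf) measurable
    also have "\<dots> \<le> liminf (\<lambda>m::nat. ennreal (((1/2) ^ k)\<^sup>2))"
    proof (rule Liminf_mono)
      have mono: "r i \<le> r j" if "i \<le> j" for i j
        unfolding r_def using that by (intro sum_mono2) auto
      have "(\<integral>\<^sup>+z. (norm (f m z - f n z))\<^sup>2 \<partial>circle) \<le> ennreal (((1/2) ^ k)\<^sup>2)" if "m \<ge> k" for m
      proof -
        have "(\<integral>\<^sup>+z. (norm (f m z - f n z))\<^sup>2 \<partial>circle) = ennreal (LINT z|circle. (norm (f m z - f n z))\<^sup>2)"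
          by (rule nn_integral_eq_integral) (use L2_integrable[OF dL2] in auto)
        also have "\<dots> = ennreal ((norm (X (r m) - X (r n)))\<^sup>2)"
          using L2_norm_eq_integral[OF dL2] by (simp add: absd)
        also have "\<dots> \<le> ennreal (((1/2) ^ k)\<^sup>2)"
          using N[of k "r m" "r n"] rN[of k] mono[of k m] mono[of k n] that \<open>n \<ge> k\<close>
          by (intro ennreal_leI power_mono) auto
        finally show ?thesis .
      qed
      then show "\<forall>\<^sub>F m in sequentially. (\<integral>\<^sup>+z. (norm (f m z - f n z))\<^sup>2 \<partial>circle) \<le> ennreal (((1/2) ^ k)\<^sup>2)"
        by (auto simp: eventually_sequentially)
    qed
    finally show ?thesis by (simp add: Liminf_const)
  qed
  have FfL2: "(\<lambda>z. F z - f n z) \<in> L2" for n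
  proof -
    have "integrable circle (\<lambda>z. (norm (F z - f n z))\<^sup>2)"
    proof (rule integrableI_nonneg)
      show "(\<integral>\<^sup>+z. (norm (F z - f n z))\<^sup>2 \<partial>circle) < \<infinity>"
        using fatou[of 0 n] by (auto intro: le_less_trans)
    qed auto
    then show ?thesis by (simp add: L2_def)
  qed
  have FL2: "F \<in> L2"
    using L2_add[OF FfL2 fL2, of 0 0] by simp
  have close: "norm (abs_l2 F - X (r n)) \<le> (1/2) ^ n" for n
  proof -
    have eq: "abs_l2 F - X (r n) = abs_l2 (\<lambda>z. F z - f n z)"
      using minus_l2.abs_eq[of F "f n"] by (simp add: FL2 fL2 absf)
    have "ennreal ((norm (abs_l2 F - X (r n)))\<^sup>2) = (\<integral>\<^sup>+z. (norm (F z - f n z))\<^sup>2 \<partial>circle)"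
      unfolding eq L2_norm_eq_integral[OF FfL2, symmetric]
      by (rule nn_integral_eq_integral[symmetric]) (use L2_integrable[OF FfL2] in auto)
    also have "\<dots> \<le> ennreal (((1/2) ^ n)\<^sup>2)"
      by (rule fatou) simp
    finally have "(norm (abs_l2 F - X (r n)))\<^sup>2 \<le> ((1/2) ^ n)\<^sup>2"
      by (subst (asm) ennreal_le_iff) auto
    then show ?thesis
      by (rule power2_le_imp_le) simp
  qed
  have "X \<longlonglongrightarrow> abs_l2 F"
  proof (rule LIMSEQ_I)
    fix e :: real assume "e > 0"
    then obtain k where k: "(1/2) ^ k < e / 2"
      using real_arch_pow_inv[of "e/2" "1/2"] by auto
    have "norm (X n - abs_l2 F) < e" if "n \<ge> N k" for n
    proof -
      have "norm (X n - abs_l2 F) = norm ((X n - X (r k)) - (abs_l2 F - X (r k)))"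
        by simp
      also have "\<dots> \<le> norm (X n - X (r k)) + norm (abs_l2 F - X (r k))"
        by (rule norm_triangle_ineq4)
      also have "\<dots> < e"
        using N[OF that rN] close[of k] k by linarith
      finally show ?thesis .
    qed
    then show "\<exists>n0. \<forall>n\<ge>n0. norm (X n - abs_l2 F) < e" by blast
  qed
  then show "convergent X" by (rule convergentI)
qed

section \<open>Operations on square integrable functions\<close>

lift_definition cip :: "l2 \<Rightarrow> l2 \<Rightarrow> complex" is L2_inner
  by (auto simp: l2rel_def intro!: L2_inner_cong)

lift_definition scaleC :: "complex \<Rightarrow> l2 \<Rightarrow> l2" (infixr "*\<^sub>C" 75) is "\<lambda>c f z. c * f z"
  by (auto simp: l2rel_def ae_eq_def intro: L2_scale elim: eventually_mono)

lift_definition cj :: "l2 \<Rightarrow> l2" is "\<lambda>f z. cnj (f z)"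
  by (auto simp: l2rel_def ae_eq_def intro: L2_cnj elim: eventually_mono)

lift_definition fl :: "l2 \<Rightarrow> l2" is "\<lambda>f z. f (cnj z)"
proof -
  fix f g assume "l2rel f g"
  then have "f \<in> L2" "g \<in> L2" "AE z in circle. f (cnj z) = g (cnj z)"
    using AE_circle_cnj[of "\<lambda>z. f z = g z"] by (auto simp: l2rel_def ae_eq_def)
  then show "l2rel (\<lambda>z. f (cnj z)) (\<lambda>z. g (cnj z))"
    by (auto simp: l2rel_def ae_eq_def intro: L2_flip)
qed

lift_definition zp :: "int \<Rightarrow> l2" is "\<lambda>n z. z powi n"
  by (simp add: L2_powi)

lift_definition bd :: "l2 \<Rightarrow> bool" is "\<lambda>f. \<exists>M. AE z in circle. norm (f z) \<le> M"
proof (intro iffI; elim exE)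
  fix f g :: "complex \<Rightarrow> complex" and M
  assume "l2rel f g"
  then have eq: "AE z in circle. f z = g z" by (auto simp: l2rel_def ae_eq_def)
  show "\<exists>M. AE z in circle. norm (g z) \<le> M" if "AE z in circle. norm (f z) \<le> M"
    using that eq by (intro exI[of _ M]) (auto elim: eventually_elim2)
  show "\<exists>M. AE z in circle. norm (f z) \<le> M" if "AE z in circle. norm (g z) \<le> M"
    using that eq by (intro exI[of _ M]) (auto elim: eventually_elim2)
qed

text \<open>The product is set to \<open>0\<close> when it is not square integrable; it is only used when
  one of the factors is bounded.\<close>

lift_definition mult :: "l2 \<Rightarrow> l2 \<Rightarrow> l2" (infixl "\<odot>" 75) is
  "\<lambda>f g. if (\<lambda>z. f z * g z) \<in> L2 then \<lambda>z. f z * g z else (\<lambda>z. 0)"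
proof -
  fix f f' g g' assume *: "l2rel f f'" "l2rel g g'"
  then have [measurable]: "f \<in> borel_measurable borel" "f' \<in> borel_measurable borel"
     "g \<in> borel_measurable borel" "g' \<in> borel_measurable borel"
    by (auto simp: l2rel_def L2_def)
  from * have eq: "AE z in circle. f z * g z = f' z * g' z"
    unfolding l2rel_def ae_eq_def by (auto elim: eventually_elim2)
  then have "AE z in circle. (norm (f z * g z))\<^sup>2 = (norm (f' z * g' z))\<^sup>2"
    by (rule eventually_mono) simp
  then have "integrable circle (\<lambda>z. (norm (f z * g z))\<^sup>2) \<longleftrightarrow> integrable circle (\<lambda>z. (norm (f' z * g' z))\<^sup>2)"
    by (intro integrable_cong_AE) auto
  then have "(\<lambda>z. f z * g z) \<in> L2 \<longleftrightarrow> (\<lambda>z. f' z * g' z) \<in> L2"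
    by (simp add: L2_def)
  with eq show "l2rel (if (\<lambda>z. f z * g z) \<in> L2 then \<lambda>z. f z * g z else (\<lambda>z. 0))
      (if (\<lambda>z. f' z * g' z) \<in> L2 then \<lambda>z. f' z * g' z else (\<lambda>z. 0))"
    by (auto simp: l2rel_def ae_eq_def L2_const)
qed

lemma norm_eq_cip: "norm x = sqrt (Re (cip x x))"
  unfolding norm_eq_sqrt_inner by transfer simp

lemma cip_commute: "cip y x = cnj (cip x y)"
  by transfer (rule L2_inner_commute)

lemma cip_add_left: "cip (x + y) z = cip x z + cip y z"
  by transfer (simp add: L2_inner_def distrib_right integrable_L2_inner)

lemma cip_scale_left [simp]: "cip (c *\<^sub>C x) y = c * cip x y"
  by transfer (simp add: L2_inner_def mult.assoc)

lemma cip_add_right: "cip x (y + z) = cip x y + cip x z"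
  by (subst (1 2 3) cip_commute) (simp add: cip_add_left)

lemma cip_scale_right [simp]: "cip x (c *\<^sub>C y) = cnj c * cip x y"
  by (subst (1 2) cip_commute) simp

lemma uminus_eq_scaleC: "- x = (-1) *\<^sub>C x"
  by transfer (auto simp: l2rel_def intro: L2_uminus)

lemma cip_minus_left [simp]: "cip (- x) y = - cip x y"
  and cip_minus_right [simp]: "cip x (- y) = - cip x y"
  by (simp_all add: uminus_eq_scaleC)

lemma cip_diff_left: "cip (x - y) z = cip x z - cip y z"
  using cip_add_left[of x "- y" z] by simp

lemma cip_diff_right: "cip x (y - z) = cip x y - cip x z"
  using cip_add_right[of x y "- z"] by simp

lemma cip_zero [simp]: "cip 0 x = 0" "cip x 0 = 0"
  using cip_diff_left[of 0 0 x] cip_diff_right[of x 0 0] by simp_all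

lemma cip_self: "cip x x = complex_of_real ((norm x)\<^sup>2)"
proof -
  have "cnj (cip x x) = cip x x" using cip_commute[of x x] by simp
  then have "cip x x = complex_of_real (Re (cip x x))"
    by (metis Reals_cnj_iff of_real_Re)
  moreover have "0 \<le> Re (cip x x)" using inner_ge_zero[of x] by transfer
  ultimately show ?thesis by (simp add: norm_eq_cip)
qed

lemma cip_eq_0_iff [simp]: "cip x x = 0 \<longleftrightarrow> x = 0"
  by (simp add: cip_self del: of_real_power)

lemmas cip_simps = cip_add_left cip_add_right cip_diff_left cip_diff_right

lemma scaleC_add_right: "c *\<^sub>C (x + y) = c *\<^sub>C x + c *\<^sub>C y"
  by transfer (auto simp: l2rel_def distrib_left intro: L2_add L2_scale)

lemma scaleC_add_left: "(c + d) *\<^sub>C x = c *\<^sub>C x + d *\<^sub>C x"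
  by transfer (auto simp: l2rel_def distrib_right intro: L2_add L2_scale)

lemma scaleC_scaleC [simp]: "c *\<^sub>C d *\<^sub>C x = (c * d) *\<^sub>C x"
  by transfer (auto simp: l2rel_def mult.assoc intro: L2_scale)

lemma scaleC_one [simp]: "1 *\<^sub>C x = x"
  by transfer (auto simp: l2rel_def)

lemma scaleR_eq_scaleC: "r *\<^sub>R x = of_real r *\<^sub>C x"
  by transfer (auto simp: l2rel_def intro: L2_scale)

lemma scaleC_zero_left [simp]: "0 *\<^sub>C x = 0"
  by transfer (auto simp: l2rel_def L2_const)

lemma scaleC_zero_right [simp]: "c *\<^sub>C (0 :: l2) = 0"
  by transfer (auto simp: l2rel_def L2_const)

lemma scaleC_diff_right: "c *\<^sub>C (x - y) = c *\<^sub>C x - c *\<^sub>C y"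
  by transfer (auto simp: l2rel_def right_diff_distrib intro: L2_diff L2_scale)

lemma norm_scaleC [simp]: "norm (c *\<^sub>C x) = norm c * norm x"
proof -
  have "complex_of_real ((norm (c *\<^sub>C x))\<^sup>2) = (c * cnj c) * complex_of_real ((norm x)\<^sup>2)"
    by (simp only: cip_self[symmetric] cip_scale_left cip_scale_right mult_ac)
  also have "\<dots> = complex_of_real ((norm c * norm x)\<^sup>2)"
    by (simp only: complex_norm_square[symmetric] of_real_mult power_mult_distrib)
  finally have "(norm (c *\<^sub>C x))\<^sup>2 = (norm c * norm x)\<^sup>2"
    by (simp only: of_real_eq_iff)
  then show ?thesis
    by (rule power2_eq_imp_eq) auto
qed

lemma cip_bound: "norm (cip x y) \<le> norm x * norm y"
proof -
  obtain c where c: "norm c = 1" "c * cip x y = complex_of_real (norm (cip x y))"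
  proof (cases "cip x y = 0")
    case False
    let ?c = "cnj (cip x y) / complex_of_real (norm (cip x y))"
    have "norm ?c = 1" using False by (simp add: norm_divide)
    moreover have "?c * cip x y = complex_of_real (norm (cip x y))"
    proof -
      have "cnj (cip x y) * cip x y = complex_of_real ((norm (cip x y))\<^sup>2)"
        by (simp only: complex_norm_square mult.commute)
      then show ?thesis using False by (simp add: power2_eq_square)
    qed
    ultimately show ?thesis by (rule that)
  qed (auto intro: that[of 1])
  have "norm (cip x y) = Re (cip (c *\<^sub>C x) y)"
    using c by simp
  also have "\<dots> = inner (c *\<^sub>C x) y"
    by transfer simp
  also have "\<dots> \<le> norm (c *\<^sub>C x) * norm y"
    by (rule norm_cauchy_schwarz)
  finally show ?thesis using c by simp
qed

lemma bounded_linear_cip_left: "bounded_linear (\<lambda>x. cip x y)"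
  by (rule bounded_linear_intro[where K = "norm y"])
    (auto simp: cip_add_left scaleR_eq_scaleC scaleR_conv_of_real cip_bound)

lemma bounded_linear_cip_right: "bounded_linear (\<lambda>y. cip x y)"
  by (rule bounded_linear_intro[where K = "norm x"])
    (auto simp: cip_add_right scaleR_eq_scaleC scaleR_conv_of_real cip_bound mult.commute[of "norm _" "norm x"])

lemmas tendsto_cip_left = bounded_linear.tendsto[OF bounded_linear_cip_left]
lemmas tendsto_cip_right = bounded_linear.tendsto[OF bounded_linear_cip_right]

lemma cj_add [simp]: "cj (x + y) = cj x + cj y"
  by transfer (auto simp: l2rel_def intro: L2_add L2_cnj)

lemma cj_diff [simp]: "cj (x - y) = cj x - cj y"
  by transfer (auto simp: l2rel_def intro: L2_diff L2_cnj)

lemma cj_scale [simp]: "cj (c *\<^sub>C x) = cnj c *\<^sub>C cj x"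
  by transfer (auto simp: l2rel_def intro: L2_scale L2_cnj)

lemma cj_cj [simp]: "cj (cj x) = x"
  by transfer (auto simp: l2rel_def)

lemma cip_cj [simp]: "cip (cj x) (cj y) = cip y x"
  by transfer (simp add: L2_inner_def mult.commute)

lemma cip_cj_left: "cip (cj x) y = cip (cj y) x"
  using cip_cj[of x "cj y"] by simp

lemma cip_cj_right: "cip x (cj y) = cip y (cj x)"
  using cip_cj[of "cj x" y] by simp

lemma fl_add [simp]: "fl (x + y) = fl x + fl y"
  by transfer (auto simp: l2rel_def intro: L2_add L2_flip)

lemma fl_diff [simp]: "fl (x - y) = fl x - fl y"
  by transfer (auto simp: l2rel_def intro: L2_diff L2_flip)

lemma fl_scale [simp]: "fl (c *\<^sub>C x) = c *\<^sub>C fl x"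
  by transfer (auto simp: l2rel_def intro: L2_scale L2_flip)

lemma fl_fl [simp]: "fl (fl x) = x"
  by transfer (auto simp: l2rel_def)

lemma cj_fl: "cj (fl x) = fl (cj x)"
  by transfer (auto simp: l2rel_def intro: L2_cnj L2_flip)

lemma cip_fl [simp]: "cip (fl x) (fl y) = cip x y"
proof transfer
  fix f g assume "l2rel f f" "l2rel g g"
  then have [measurable]: "f \<in> borel_measurable borel" "g \<in> borel_measurable borel"
    by (auto simp: L2_def)
  show "L2_inner (\<lambda>z. f (cnj z)) (\<lambda>z. g (cnj z)) = L2_inner f g"
    unfolding L2_inner_def by (rule integral_circle_cnj[of "\<lambda>z. f z * cnj (g z)"]) measurable
qed

lemma cip_fl_left: "cip (fl x) y = cip x (fl y)"
  using cip_fl[of x "fl y"] by simp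

lemma AE_circle_nonzero: "AE z in circle. z \<noteq> 0"
  using AE_circle_norm by eventually_elim auto

lemma cnj_eq_inverse_circle: "norm z = 1 \<Longrightarrow> cnj z = inverse z"
  using complex_norm_square[of z] by (intro inverse_unique[symmetric]) simp

lemma cj_zp [simp]: "cj (zp n) = zp (- n)"
proof transfer
  fix n :: int
  have "AE z in circle. cnj (z powi n) = z powi (- n)"
    using AE_circle_norm
    by eventually_elim (auto simp: cnj_eq_inverse_circle power_int_minus power_int_inverse)
  then show "l2rel (\<lambda>z. cnj (z powi n)) (\<lambda>z. z powi (- n))"
    unfolding l2rel_def ae_eq_def using L2_powi L2_cnj[OF L2_powi[of n]] by blast
qed

lemma fl_zp [simp]: "fl (zp n) = zp (- n)"
proof transfer
  fix n :: int
  have "AE z in circle. (cnj z) powi n = z powi (- n)"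
    using AE_circle_norm
    by eventually_elim (auto simp: cnj_eq_inverse_circle power_int_minus power_int_inverse)
  moreover have "(\<lambda>z. cnj z powi n) \<in> L2"
    using L2_flip[OF L2_powi[of n]] by simp
  ultimately show "l2rel (\<lambda>z. cnj z powi n) (\<lambda>z. z powi (- n))"
    unfolding l2rel_def ae_eq_def using L2_powi by blast
qed

lemma cip_zp: "cip (zp m) (zp n) = (if m = n then 1 else 0)"
proof -
  have "cip (zp m) (zp n) = (LINT z|circle. z powi m * cnj (z powi n))"
    by (simp add: zp_def cip.abs_eq L2_powi L2_inner_def)
  also have "\<dots> = (LINT z|circle. z powi (m - n))"
  proof (rule integral_cong_AE)
    show "AE z in circle. z powi m * cnj (z powi n) = z powi (m - n)"
      using AE_circle_norm AE_circle_nonzero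
      by eventually_elim
        (auto simp: cnj_eq_inverse_circle power_int_inverse power_int_diff divide_inverse)
  qed measurable
  finally show ?thesis by (simp add: integral_circle_powi)
qed

lemma mult_commute: "x \<odot> y = y \<odot> x"
  by transfer (auto simp: l2rel_def mult.commute L2_const)

lemma mult_abs: "f \<in> L2 \<Longrightarrow> g \<in> L2 \<Longrightarrow> (\<lambda>z. f z * g z) \<in> L2 \<Longrightarrow> abs_l2 f \<odot> abs_l2 g = abs_l2 (\<lambda>z. f z * g z)"
  by (simp add: mult.abs_eq)

lemma bd_transfer_L2:
  assumes "f \<in> L2" "b \<in> L2" "\<exists>M. AE z in circle. norm (b z) \<le> M"
  shows "(\<lambda>z. f z * b z) \<in> L2" "(\<lambda>z. b z * f z) \<in> L2"
  using assms L2_mult_bounded[of f b] by (auto simp: mult.commute L2_borel)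

lemma bd_mult [simp]:
  assumes "bd x" "bd y" shows "bd (x \<odot> y)"
  using assms
proof transfer
  fix f g assume fg: "l2rel f f" "l2rel g g"
    and "\<exists>M. AE z in circle. norm (f z) \<le> M" "\<exists>M. AE z in circle. norm (g z) \<le> M"
  then obtain M N where MN: "AE z in circle. norm (f z) \<le> M" "AE z in circle. norm (g z) \<le> N"
    by auto
  then have L: "(\<lambda>z. f z * g z) \<in> L2" using bd_transfer_L2[of f g] fg by auto
  from MN have "AE z in circle. norm (f z * g z) \<le> \<bar>M\<bar> * \<bar>N\<bar>"
    by eventually_elim (auto simp: norm_mult intro!: mult_mono)
  then show "\<exists>M. AE z in circle. norm ((if (\<lambda>z. f z * g z) \<in> L2 then \<lambda>z. f z * g z else (\<lambda>z. 0)) z) \<le> M"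
    using L by auto
qed

lemma bd_add [simp]:
  assumes "bd x" "bd y" shows "bd (x + y)"
  using assms
proof transfer
  fix f g :: "complex \<Rightarrow> complex"
  assume "\<exists>M. AE z in circle. norm (f z) \<le> M" "\<exists>M. AE z in circle. norm (g z) \<le> M"
  then obtain M N where "AE z in circle. norm (f z) \<le> M" "AE z in circle. norm (g z) \<le> N"
    by auto
  then have "AE z in circle. norm (f z + g z) \<le> M + N"
    by eventually_elim (auto intro: order_trans[OF norm_triangle_ineq])
  then show "\<exists>M. AE z in circle. norm (f z + g z) \<le> M" by auto
qed

lemma bd_scale [simp]: "bd x \<Longrightarrow> bd (c *\<^sub>C x)"
proof transfer
  fix c and f :: "complex \<Rightarrow> complex"
  assume "\<exists>M. AE z in circle. norm (f z) \<le> M"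
  then obtain M where "AE z in circle. norm (f z) \<le> M" by auto
  then have "AE z in circle. norm (c * f z) \<le> norm c * M"
    by eventually_elim (auto simp: norm_mult intro: mult_left_mono)
  then show "\<exists>M. AE z in circle. norm (c * f z) \<le> M" by auto
qed

lemma bd_diff [simp]: "bd x \<Longrightarrow> bd y \<Longrightarrow> bd (x - y)"
  using bd_add[of x "(-1) *\<^sub>C y"] by (metis bd_scale diff_conv_add_uminus uminus_eq_scaleC)

lemma bd_cj [simp]: "bd (cj x) \<longleftrightarrow> bd x"
  by transfer simp

lemma bd_fl_imp: "bd x \<Longrightarrow> bd (fl x)"
  by transfer (auto dest: AE_circle_cnj)

lemma bd_fl [simp]: "bd (fl x) \<longleftrightarrow> bd x"
  using bd_fl_imp[of x] bd_fl_imp[of "fl x"] by auto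

lemma bd_zp [simp]: "bd (zp n)"
proof transfer
  fix n :: int
  show "\<exists>M. AE z in circle. norm ((z::complex) powi n) \<le> M"
    using AE_circle_norm by (intro exI[of _ 1]) (auto elim!: eventually_mono simp: norm_power_int)
qed

lemma bd_zero [simp]: "bd 0"
  using bd_scale[of "zp 0" 0] by simp

lemma mult_add_left: "bd y \<Longrightarrow> (x + x') \<odot> y = x \<odot> y + x' \<odot> y"
proof transfer
  fix x x' y assume *: "l2rel x x" "l2rel x' x'" "l2rel y y" "\<exists>M. AE w in circle. norm (y w) \<le> M"
  have L: "(\<lambda>w. x w * y w) \<in> L2" "(\<lambda>w. x' w * y w) \<in> L2"
    using * by (auto intro: bd_transfer_L2)
  have "(\<lambda>w. (x w + x' w) * y w) \<in> L2"
    using L2_add[OF L] by (simp add: distrib_right)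
  then show "l2rel (if (\<lambda>z. (x z + x' z) * y z) \<in> L2 then \<lambda>z. (x z + x' z) * y z else (\<lambda>z. 0))
      (\<lambda>z. (if (\<lambda>z. x z * y z) \<in> L2 then \<lambda>z. x z * y z else (\<lambda>z. 0)) z
        + (if (\<lambda>z. x' z * y z) \<in> L2 then \<lambda>z. x' z * y z else (\<lambda>z. 0)) z)"
    using L L2_add[OF L] by (simp add: distrib_right)
qed

lemma mult_scale_left: "(c *\<^sub>C x) \<odot> y = c *\<^sub>C (x \<odot> y)"
proof (cases "c = 0")
  case True
  have "(0::l2) \<odot> y = 0" by transfer (auto simp: l2rel_def L2_const)
  then show ?thesis using True by simp
next
  case False
  then show ?thesis
  proof transfer
    fix c :: complex and f g :: "complex \<Rightarrow> complex" assume "c \<noteq> 0"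
    have *: "(\<lambda>z. c * f z * g z) \<in> L2 \<longleftrightarrow> (\<lambda>z. f z * g z) \<in> L2"
    proof
      assume "(\<lambda>z. c * f z * g z) \<in> L2"
      from L2_scale[OF this, of "1/c"] show "(\<lambda>z. f z * g z) \<in> L2"
        using \<open>c \<noteq> 0\<close> by (simp add: mult.assoc)
    next
      assume "(\<lambda>z. f z * g z) \<in> L2"
      from L2_scale[OF this, of c] show "(\<lambda>z. c * f z * g z) \<in> L2"
        by (simp add: mult.assoc)
    qed
    then show "l2rel (if (\<lambda>z. c * f z * g z) \<in> L2 then \<lambda>z. c * f z * g z else (\<lambda>z. 0))
        (\<lambda>z. c * (if (\<lambda>z. f z * g z) \<in> L2 then \<lambda>z. f z * g z else (\<lambda>z. 0)) z)"
      by (cases "(\<lambda>z. f z * g z) \<in> L2") (auto simp: l2rel_def mult.assoc L2_const)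
  qed
qed

lemma mult_diff_left: "bd y \<Longrightarrow> (x - x') \<odot> y = x \<odot> y - x' \<odot> y"
  using mult_add_left[of y x "(-1) *\<^sub>C x'"]
  by (simp add: mult_scale_left uminus_eq_scaleC[of x'] uminus_eq_scaleC[of "x' \<odot> y"] diff_conv_add_uminus del: add_uminus_conv_diff)

lemma mult_add_right: "bd x \<Longrightarrow> x \<odot> (y + y') = x \<odot> y + x \<odot> y'"
  by (metis mult_add_left mult_commute)

lemma mult_diff_right: "bd x \<Longrightarrow> x \<odot> (y - y') = x \<odot> y - x \<odot> y'"
  by (metis mult_diff_left mult_commute)

lemma mult_scale_right: "x \<odot> (c *\<^sub>C y) = c *\<^sub>C (x \<odot> y)"
  by (metis mult_scale_left mult_commute)

lemma mult_assoc: "bd y \<Longrightarrow> bd z \<Longrightarrow> x \<odot> y \<odot> z = x \<odot> (y \<odot> z)"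
proof transfer
  fix x y z assume *: "l2rel x x" "l2rel y y" "l2rel z z"
    "\<exists>M. AE w in circle. norm (y w) \<le> M" "\<exists>M. AE w in circle. norm (z w) \<le> M"
  have 1: "(\<lambda>w. x w * y w) \<in> L2" "(\<lambda>w. y w * z w) \<in> L2" using * by (auto intro: bd_transfer_L2)
  then have "(\<lambda>w. x w * y w * z w) \<in> L2"
    using * bd_transfer_L2(1)[of "\<lambda>w. x w * y w" z] by simp
  then show "l2rel (if (\<lambda>w. (if (\<lambda>z. x z * y z) \<in> L2 then \<lambda>z. x z * y z else (\<lambda>z. 0)) w * z w) \<in> L2
          then \<lambda>w. (if (\<lambda>z. x z * y z) \<in> L2 then \<lambda>z. x z * y z else (\<lambda>z. 0)) w * z w else (\<lambda>z. 0))
         (if (\<lambda>w. x w * (if (\<lambda>w. y w * z w) \<in> L2 then \<lambda>w. y w * z w else (\<lambda>z. 0)) w) \<in> L2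
          then \<lambda>w. x w * (if (\<lambda>w. y w * z w) \<in> L2 then \<lambda>w. y w * z w else (\<lambda>z. 0)) w else (\<lambda>z. 0))"
    using 1 by (simp add: mult.assoc)
qed

lemma mult_left_commute: "bd x \<Longrightarrow> bd y \<Longrightarrow> x \<odot> (y \<odot> z) = y \<odot> (x \<odot> z)"
  by (metis mult_assoc mult_commute)

lemma zp_mult_zp [simp]: "zp m \<odot> zp n = zp (m + n)"
proof -
  have "AE z in circle. (z::complex) powi m * z powi n = z powi (m + n)"
    using AE_circle_nonzero by eventually_elim (simp add: power_int_add)
  moreover have "(\<lambda>z::complex. z powi m * z powi n) \<in> L2"
    using bd_transfer_L2[OF L2_powi L2_powi, of n m] bd_zp[of n] unfolding zp_def by (auto simp: bd.abs_eq L2_powi)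
  ultimately show ?thesis
    by (simp add: zp_def mult_abs L2_powi abs_l2_eq_iff ae_eq_def)
qed

lemma zp_0_mult [simp]: "zp 0 \<odot> x = x"
  by transfer (auto simp: l2rel_def)

lemma mult_zp_0 [simp]: "x \<odot> zp 0 = x"
  by (subst mult_commute) simp

lemma cj_mult [simp]: "cj (x \<odot> y) = cj x \<odot> cj y"
proof transfer
  fix f g :: "complex \<Rightarrow> complex"
  have "(\<lambda>z. cnj (f z) * cnj (g z)) \<in> L2 \<longleftrightarrow> (\<lambda>z. f z * g z) \<in> L2"
    using L2_cnj[of "\<lambda>z. f z * g z"] L2_cnj[of "\<lambda>z. cnj (f z) * cnj (g z)"] by auto
  then show "l2rel (\<lambda>z. cnj ((if (\<lambda>z. f z * g z) \<in> L2 then \<lambda>z. f z * g z else (\<lambda>z. 0)) z))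
        (if (\<lambda>z. cnj (f z) * cnj (g z)) \<in> L2 then \<lambda>z. cnj (f z) * cnj (g z) else (\<lambda>z. 0))"
    by (auto simp: L2_const)
qed

lemma fl_mult [simp]: "fl (x \<odot> y) = fl x \<odot> fl y"
proof transfer
  fix f g :: "complex \<Rightarrow> complex"
  have "(\<lambda>z. (f (cnj z)) * (g (cnj z))) \<in> L2 \<longleftrightarrow> (\<lambda>z. f z * g z) \<in> L2"
    using L2_flip[of "\<lambda>z. f z * g z"] L2_flip[of "\<lambda>z. (f (cnj z)) * (g (cnj z))"] by auto
  then show "l2rel (\<lambda>z. ((if (\<lambda>z. f z * g z) \<in> L2 then \<lambda>z. f z * g z else (\<lambda>z. 0)) (cnj z)))
        (if (\<lambda>z. (f (cnj z)) * (g (cnj z))) \<in> L2 then \<lambda>z. (f (cnj z)) * (g (cnj z)) else (\<lambda>z. 0))"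
    by (auto simp: L2_const)
qed

lemma cip_mult_right_adj: "bd y \<Longrightarrow> cip (x \<odot> y) z = cip x (cj y \<odot> z)"
proof transfer
  fix x y z assume *: "l2rel x x" "l2rel y y" "l2rel z z" "\<exists>M. AE w in circle. norm (y w) \<le> M"
  have "(\<lambda>w. x w * y w) \<in> L2" using * by (auto intro: bd_transfer_L2)
  moreover have "(\<lambda>w. cnj (y w) * z w) \<in> L2"
    using * bd_transfer_L2(2)[of z "\<lambda>w. cnj (y w)"] by (auto intro: L2_cnj)
  ultimately
  show "L2_inner (if (\<lambda>z. x z * y z) \<in> L2 then \<lambda>z. x z * y z else (\<lambda>z. 0)) z =
         L2_inner x (if (\<lambda>za. cnj (y za) * z za) \<in> L2 then \<lambda>za. cnj (y za) * z za else (\<lambda>z. 0))"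
    by (simp add: L2_inner_def mult.assoc)
qed

lemma cip_mult_adj: "bd x \<Longrightarrow> cip (x \<odot> y) z = cip y (cj x \<odot> z)"
  by (metis cip_mult_right_adj mult_commute)

section \<open>Fourier coefficients and the Hardy space\<close>

lemma mult_diff_right_bd: "bd y \<Longrightarrow> bd y' \<Longrightarrow> x \<odot> (y - y') = x \<odot> y - x \<odot> y'"
proof transfer
  fix x y y' assume *: "l2rel x x" "l2rel y y" "l2rel y' y'"
     "\<exists>M. AE w in circle. norm (y w) \<le> M" "\<exists>M. AE w in circle. norm (y' w) \<le> M"
  have L: "(\<lambda>w. x w * y w) \<in> L2" "(\<lambda>w. x w * y' w) \<in> L2"
    using * by (auto intro: bd_transfer_L2)
  have "(\<lambda>w. x w * (y w - y' w)) \<in> L2"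
    using L2_diff[OF L] by (simp add: right_diff_distrib)
  then show "l2rel (if (\<lambda>z. x z * (y z - y' z)) \<in> L2 then \<lambda>z. x z * (y z - y' z) else (\<lambda>z. 0))
      (\<lambda>z. (if (\<lambda>z. x z * y z) \<in> L2 then \<lambda>z. x z * y z else (\<lambda>z. 0)) z
        - (if (\<lambda>z. x z * y' z) \<in> L2 then \<lambda>z. x z * y' z else (\<lambda>z. 0)) z)"
    using L L2_diff[OF L] by (simp add: right_diff_distrib)
qed

lemma mult_add_right_bd: "bd y \<Longrightarrow> bd y' \<Longrightarrow> x \<odot> (y + y') = x \<odot> y + x \<odot> y'"
proof -
  assume "bd y" "bd y'"
  then have "x \<odot> (y - (-1) *\<^sub>C y') = x \<odot> y - (-1) *\<^sub>C (x \<odot> y')"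
    by (simp only: mult_diff_right_bd bd_scale mult_scale_right)
  then show ?thesis by (simp flip: uminus_eq_scaleC)
qed

lemma bounded_on_circle:
  fixes p :: "complex \<Rightarrow> real"
  assumes "continuous_on UNIV p"
  shows "\<exists>M. AE z in circle. norm (complex_of_real (p z)) \<le> M"
proof -
  have "compact (p ` sphere 0 1)"
    by (intro compact_continuous_image continuous_on_subset[OF assms]) auto
  then have "bounded (p ` sphere 0 1)" by (rule compact_imp_bounded)
  then obtain M where "\<forall>x\<in>p ` sphere 0 1. norm x \<le> M"
    unfolding bounded_iff by blast
  then have "norm (complex_of_real (p z)) \<le> M" if "norm z = 1" for z
    using that by simp
  with AE_circle_norm have "AE z in circle. norm (complex_of_real (p z)) \<le> M"
    by (auto elim!: eventually_mono)
  then show ?thesis by blast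
qed

definition cont_l2 :: "(complex \<Rightarrow> real) \<Rightarrow> l2" where
  "cont_l2 p = abs_l2 (\<lambda>z. complex_of_real (p z))"

lemma cont_L2:
  fixes p :: "complex \<Rightarrow> real"
  assumes "continuous_on UNIV p"
  shows "(\<lambda>z. complex_of_real (p z)) \<in> L2"
proof -
  have "(\<lambda>z. complex_of_real (p z)) \<in> borel_measurable borel"
    using borel_measurable_continuous_onI[OF assms] by measurable
  then show ?thesis using bounded_on_circle[OF assms] L2_bounded by blast
qed

lemma bd_cont_l2: "continuous_on UNIV p \<Longrightarrow> bd (cont_l2 p)"
  unfolding cont_l2_def using bounded_on_circle[of p] by (simp add: bd.abs_eq cont_L2)

lemma abs_l2_add: "f \<in> L2 \<Longrightarrow> g \<in> L2 \<Longrightarrow> abs_l2 f + abs_l2 g = abs_l2 (\<lambda>z. f z + g z)"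
  by (simp add: plus_l2.abs_eq)

lemma abs_l2_scale: "f \<in> L2 \<Longrightarrow> c *\<^sub>C abs_l2 f = abs_l2 (\<lambda>z. c * f z)"
  by (simp add: scaleC.abs_eq)

lemma zp_eq_abs_l2: "zp n = abs_l2 (\<lambda>z. z powi n)"
  by (simp add: zp_def)

lemma cont_l2_linear:
  fixes p :: "complex \<Rightarrow> real"
  assumes "bounded_linear p"
  shows "\<exists>a b. cont_l2 p = a *\<^sub>C zp 1 + b *\<^sub>C zp (- 1)"
proof -
  interpret bounded_linear p by fact
  have p: "p z = Re z * p 1 + Im z * p \<i>" for z
  proof -
    have "z = Re z *\<^sub>R 1 + Im z *\<^sub>R \<i>" by (simp add: complex_eq_iff)
    then show ?thesis by (metis add scaleR real_scaleR_def)
  qed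
  let ?a = "(of_real (p 1) - \<i> * of_real (p \<i>)) / 2"
  let ?b = "(of_real (p 1) + \<i> * of_real (p \<i>)) / 2"
  have "AE z in circle. complex_of_real (p z) = ?a * z powi 1 + ?b * z powi (-1)"
    using AE_circle_norm
  proof eventually_elim
    case (elim z)
    have "complex_of_real (p z) = ?a * z + ?b * cnj z"
      unfolding p[of z] by (simp add: complex_eq_iff field_simps)
    then show ?case using cnj_eq_inverse_circle[OF elim] by (simp add: power_int_minus)
  qed
  then have "(\<lambda>z. complex_of_real (p z)) =\<^sub>T (\<lambda>z. ?a * z powi 1 + ?b * z powi (-1))"
    by (simp add: ae_eq_def)
  moreover have "(\<lambda>z. ?a * z powi 1 + ?b * z powi (-1)) \<in> L2"
    by (intro L2_add L2_scale L2_powi)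
  ultimately have "cont_l2 p = abs_l2 (\<lambda>z. ?a * z powi 1 + ?b * z powi (-1))"
    unfolding cont_l2_def
    by (intro abs_l2_eq_iff[THEN iffD2] cont_L2 linear_continuous_on assms)
  also have "\<dots> = ?a *\<^sub>C zp 1 + ?b *\<^sub>C zp (-1)"
    unfolding zp_eq_abs_l2 using L2_powi[of 1] L2_powi[of "-1"]
    by (simp only: abs_l2_scale abs_l2_add L2_scale)
  finally have "cont_l2 p = ?a *\<^sub>C zp 1 + ?b *\<^sub>C zp (-1)" .
  then show ?thesis by blast
qed

lemma continuous_real_polynomial_function:
  "real_polynomial_function p \<Longrightarrow> continuous_on S p"
  by (simp add: real_polynomial_function_eq continuous_on_polymonial_function)

lemma fourier_zero_mult_poly:
  fixes p :: "complex \<Rightarrow> real"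
  assumes "real_polynomial_function p" "\<And>n. cip x (zp n) = 0"
  shows "cip (x \<odot> cont_l2 p) (zp n) = 0"
  using assms
proof (induction arbitrary: x n rule: real_polynomial_function.induct)
  case (linear p)
  then obtain a b where "cont_l2 p = a *\<^sub>C zp 1 + b *\<^sub>C zp (- 1)"
    using cont_l2_linear by blast
  then show ?case
    using linear by (simp add: cip_mult_right_adj mult_add_left mult_scale_left cip_simps)
next
  case (const c)
  have "cont_l2 (\<lambda>x. c) = of_real c *\<^sub>C zp 0"
    unfolding cont_l2_def zp_eq_abs_l2 by (simp add: abs_l2_scale L2_const)
  then show ?case
    using const by (simp add: cip_mult_right_adj mult_scale_left)
next
  case (add p q)
  have c: "continuous_on UNIV p" "continuous_on UNIV q"
    using add continuous_real_polynomial_function by auto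
  then have "cont_l2 (\<lambda>z. p z + q z) = cont_l2 p + cont_l2 q"
    unfolding cont_l2_def by (simp add: abs_l2_add cont_L2)
  then show ?case
    using add c by (simp add: mult_add_right_bd bd_cont_l2 cip_add_left)
next
  case (mult p q)
  have c: "continuous_on UNIV p" "continuous_on UNIV q"
    using mult continuous_real_polynomial_function by auto
  have "continuous_on UNIV (\<lambda>z. p z * q z)" by (intro continuous_on_mult c)
  from cont_L2[OF this] have "cont_l2 (\<lambda>z. p z * q z) = cont_l2 p \<odot> cont_l2 q"
    unfolding cont_l2_def by (subst mult_abs) (simp_all add: cont_L2 c)
  then have "x \<odot> cont_l2 (\<lambda>z. p z * q z) = x \<odot> cont_l2 p \<odot> cont_l2 q"
    by (simp add: mult_assoc bd_cont_l2 c)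
  then show ?case using mult by simp
qed

lemma fourier_zero_cont:
  fixes g :: "complex \<Rightarrow> real"
  assumes g: "continuous_on UNIV g" and x: "\<And>n. cip x (zp n) = 0"
  shows "cip x (cont_l2 g) = 0"
proof -
  have *: "norm (cip x (cont_l2 g)) \<le> norm x * d" if "d > 0" for d
  proof -
    have "continuous_on (sphere 0 1) g" by (rule continuous_on_subset[OF g]) auto
    then obtain p where p: "real_polynomial_function p" and
        d: "\<And>z. z \<in> sphere 0 1 \<Longrightarrow> \<bar>g z - p z\<bar> < d"
      using Stone_Weierstrass_real_polynomial_function[of "sphere 0 1" g d] \<open>d > 0\<close> by auto
    have c: "continuous_on UNIV p"
      using p by (rule continuous_real_polynomial_function)
    have cp: "cj (cont_l2 p) = cont_l2 p"
      unfolding cont_l2_def by (simp add: cj.abs_eq cont_L2 c)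
    have "cip x (cont_l2 p) = cip (x \<odot> cont_l2 p) (zp 0)"
      by (simp add: cip_mult_right_adj bd_cont_l2 c cp)
    then have "cip x (cont_l2 p) = 0"
      using fourier_zero_mult_poly[OF p x] by simp
    then have "cip x (cont_l2 g) = cip x (cont_l2 g - cont_l2 p)"
      by (simp add: cip_simps)
    also have "norm \<dots> \<le> norm x * norm (cont_l2 g - cont_l2 p)" by (rule cip_bound)
    also have "\<dots> \<le> norm x * d"
    proof (rule mult_left_mono)
      have L: "(\<lambda>z. complex_of_real (g z) - complex_of_real (p z)) \<in> L2"
        by (intro L2_diff cont_L2 g c)
      have eq: "cont_l2 g - cont_l2 p = abs_l2 (\<lambda>z. complex_of_real (g z) - complex_of_real (p z))"
        unfolding cont_l2_def by (simp add: minus_l2.abs_eq cont_L2 g c)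
      have "(norm (cont_l2 g - cont_l2 p))\<^sup>2 = (LINT z|circle. (norm (complex_of_real (g z) - complex_of_real (p z)))\<^sup>2)"
        unfolding eq using L2_norm_eq_integral[OF L] by simp
      also have "\<dots> \<le> (LINT z|circle. d\<^sup>2)"
      proof (rule integral_mono_AE)
        show "AE z in circle. (norm (complex_of_real (g z) - complex_of_real (p z)))\<^sup>2 \<le> d\<^sup>2"
          using AE_circle_norm
        proof eventually_elim
          case (elim z)
          then have "\<bar>g z - p z\<bar> \<le> d" using d[of z] by auto
          then have "\<bar>g z - p z\<bar>\<^sup>2 \<le> d\<^sup>2" by (intro power_mono) auto
          then show ?case by (simp flip: of_real_diff)
        qed
      qed (use L2_integrable[OF L] in auto)
      also have "\<dots> = d\<^sup>2" by (simp add: measure_circle)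
      finally show "norm (cont_l2 g - cont_l2 p) \<le> d"
        by (rule power2_le_imp_le) (use \<open>d > 0\<close> in simp)
    qed simp
    finally show ?thesis .
  qed
  show ?thesis
  proof (cases "x = 0")
    case False
    have "norm (cip x (cont_l2 g)) \<le> 0 + \<epsilon>" if "\<epsilon> > 0" for \<epsilon>
      using *[of "\<epsilon> / norm x"] that False by simp
    then have "norm (cip x (cont_l2 g)) \<le> 0"
      by (rule field_le_epsilon)
    then show ?thesis by simp
  qed simp
qed

lemma fourier_zero_closed:
  assumes f: "f \<in> L2" and x: "\<And>n. cip (abs_l2 f) (zp n) = 0" and A: "closed A"
  shows "(LINT z|circle. f z * indicator A z) = 0"
proof (cases "A = {}")
  case False
  define g where "g n z = max 0 (1 - real n * infdist z A)" for n z
  have cont: "continuous_on UNIV (g n)" for n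
    unfolding g_def by (intro continuous_intros)
  have mc: "borel_measurable circle = (borel_measurable borel :: (complex \<Rightarrow> complex) set)"
    by (rule measurable_cong_sets) auto
  have fm: "f \<in> borel_measurable borel" by (rule L2_borel[OF f])
  have lim: "(\<lambda>n. g n z) \<longlonglongrightarrow> indicator A z" for z
  proof (cases "z \<in> A")
    case True
    then show ?thesis by (simp add: g_def)
  next
    case z: False
    then have pos: "infdist z A > 0"
      using A False by (simp add: infdist_pos_not_in_closed)
    obtain N where N: "real N * infdist z A > 1"
      using pos by (metis reals_Archimedean3)
    have "g n z = 0" if "n \<ge> N" for n
    proof -
      have "real N * infdist z A \<le> real n * infdist z A"
        using that pos by (intro mult_right_mono) auto
      then show ?thesis using N by (simp add: g_def)
    qed
    then have "eventually (\<lambda>n. g n z = indicator A z) sequentially"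
      using z by (auto simp: eventually_sequentially intro!: exI[of _ N])
    then show ?thesis by (rule tendsto_eventually)
  qed
  have "(\<lambda>n. LINT z|circle. f z * complex_of_real (g n z)) \<longlonglongrightarrow> (LINT z|circle. f z * indicator A z)"
  proof (rule integral_dominated_convergence)
    show "integrable circle (\<lambda>z. norm (f z))"
      using integrable_L2_mult[OF f L2_const[of 1]] by simp
    show "AE z in circle. (\<lambda>n. f z * complex_of_real (g n z)) \<longlonglongrightarrow> f z * indicator A z"
    proof (rule AE_I2)
      fix z
      have "(\<lambda>n. complex_of_real (g n z)) \<longlonglongrightarrow> complex_of_real (indicator A z)"
        by (intro tendsto_of_real lim)
      then show "(\<lambda>n. f z * complex_of_real (g n z)) \<longlonglongrightarrow> f z * indicator A z"
        by (intro tendsto_mult) (auto simp: indicator_def)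
    qed
    show "AE z in circle. norm (f z * complex_of_real (g n z)) \<le> norm (f z)" for n
    proof (rule AE_I2)
      fix z
      have "\<bar>g n z\<bar> \<le> 1" by (auto simp: g_def infdist_nonneg)
      then show "norm (f z * complex_of_real (g n z)) \<le> norm (f z)"
        by (simp add: norm_mult mult_left_le)
    qed
    show "(\<lambda>z. f z * complex_of_real (g n z)) \<in> borel_measurable circle" for n
      unfolding mc by (intro borel_measurable_times fm L2_borel cont_L2 cont)
    show "(\<lambda>z. f z * indicator A z) \<in> borel_measurable circle"
      unfolding mc by (intro borel_measurable_times fm borel_measurable_indicator borel_closed A)
  qed
  moreover have "(LINT z|circle. f z * complex_of_real (g n z)) = 0" for n
  proof -
    have "cip (abs_l2 f) (cont_l2 (g n)) = (LINT z|circle. f z * complex_of_real (g n z))"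
      unfolding cont_l2_def by (simp add: cip.abs_eq f cont_L2 cont L2_inner_def)
    then show ?thesis using fourier_zero_cont[OF cont x] by simp
  qed
  ultimately have "(\<lambda>n::nat. 0) \<longlonglongrightarrow> (LINT z|circle. f z * indicator A z)"
    by simp
  from LIMSEQ_unique[OF this tendsto_const] show ?thesis .
qed simp

lemma fourier_zero_borel:
  assumes f: "f \<in> L2" and x: "\<And>n. cip (abs_l2 f) (zp n) = 0" and A: "A \<in> sets borel"
  shows "(LINT z:A|circle. f z) = 0"
proof -
  have int: "integrable circle f"
    using integrable_L2_mult[OF f L2_const[of 1]] by simp
  have base: "(LINT z:A|circle. f z) = 0" if "closed A" for A
  proof -
    have "indicator A z *\<^sub>R f z = f z * indicator A z" for z
      by (simp add: indicator_def)
    then show ?thesis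
      using fourier_zero_closed[OF f x that] by (simp add: set_lebesgue_integral_def)
  qed
  have si: "set_integrable circle B f" if "B \<in> sets borel" for B
    unfolding set_integrable_def by (rule integrable_mult_indicator[OF _ int]) (simp add: that)
  have borel: "sets borel = sigma_sets UNIV (Collect (closed :: complex set \<Rightarrow> bool))"
    by (simp add: borel_eq_closed)
  have "Int_stable (Collect (closed :: complex set \<Rightarrow> bool))"
    by (auto simp: Int_stable_def)
  moreover have "Collect (closed :: complex set \<Rightarrow> bool) \<subseteq> Pow UNIV" by simp
  moreover have "A \<in> sigma_sets UNIV (Collect closed)" using A borel by simp
  ultimately show ?thesis
  proof (induct rule: sigma_sets_induct_disjoint)
    fix A assume "A \<in> sigma_sets UNIV (Collect (closed :: complex set \<Rightarrow> bool))"
      and 0: "(LINT z:A|circle. f z) = 0"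
    then have [measurable]: "A \<in> sets borel" by (simp add: borel)
    have eq: "(LINT z:(A \<union> (UNIV - A))|circle. f z) = (LINT z:A|circle. f z) + (LINT z:(UNIV - A)|circle. f z)"
      by (rule set_integral_Un) (simp_all add: si)
    have un: "A \<union> (UNIV - A) = UNIV" by blast
    show "(LINT z:(UNIV - A)|circle. f z) = 0"
      using eq unfolding un 0 base[OF closed_UNIV] add_0_left by (rule sym)
  next
    fix A :: "nat \<Rightarrow> complex set"
    assume A: "disjoint_family A" "range A \<subseteq> sigma_sets UNIV (Collect closed)"
      and 0: "\<And>i. (LINT z:A i|circle. f z) = 0"
    have "(LINT z:(\<Union>i. A i)|circle. f z) = (\<Sum>i. (LINT z:(A i)|circle. f z))"
    proof (rule lebesgue_integral_countable_add)
      show m: "A i \<in> sets circle" for i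
        using A(2) unfolding sets_circle borel by (rule subsetD) simp
      show "A i \<inter> A j = {}" if "i \<noteq> j" for i j
        using A(1) that by (auto simp: disjoint_family_on_def)
      show "set_integrable circle (\<Union>i. A i) f"
        by (rule si, rule sets.countable_UN) (use m in auto)
    qed
    then show "(LINT z:(\<Union>i. A i)|circle. f z) = 0" by (simp add: 0)
  next
    fix A :: "complex set" assume "A \<in> Collect closed"
    then show "(LINT z:A|circle. f z) = 0" using base by auto
  qed (auto simp: set_lebesgue_integral_def)
qed

lemma fourier_eq_0:
  assumes x: "\<And>n. cip x (zp n) = 0"
  shows "x = 0"
proof -
  define f where "f = rep_l2 x"
  have f: "f \<in> L2" and xf: "x = abs_l2 f" by (auto simp: f_def)
  have int: "integrable circle f"
    using integrable_L2_mult[OF f L2_const[of 1]] by simp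
  have z: "(LINT z:A|circle. f z) = 0" if "A \<in> sets circle" for A
    using fourier_zero_borel[OF f x[unfolded xf]] that by simp
  have si: "integrable circle (\<lambda>z. indicator A z *\<^sub>R f z)" if "A \<in> sets circle" for A
    by (rule integrable_mult_indicator[OF that int])
  have "AE z in circle. Re (f z) = 0"
  proof (rule density_unique_real)
    show "(LINT z:A|circle. Re (f z)) = (LINT z:A|circle. 0)" if "A \<in> sets circle" for A
    proof -
      have "(LINT z:A|circle. Re (f z)) = (LINT z|circle. Re (indicator A z *\<^sub>R f z))"
        by (simp add: set_lebesgue_integral_def)
      also have "\<dots> = Re (LINT z|circle. indicator A z *\<^sub>R f z)"
        by (rule integral_Re[OF si[OF that]])
      also have "\<dots> = (LINT z:A|circle. 0)"
        using z[OF that] by (simp add: set_lebesgue_integral_def)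
      finally show ?thesis .
    qed
  qed (use int in auto)
  moreover have "AE z in circle. Im (f z) = 0"
  proof (rule density_unique_real)
    show "(LINT z:A|circle. Im (f z)) = (LINT z:A|circle. 0)" if "A \<in> sets circle" for A
    proof -
      have "(LINT z:A|circle. Im (f z)) = (LINT z|circle. Im (indicator A z *\<^sub>R f z))"
        by (simp add: set_lebesgue_integral_def)
      also have "\<dots> = Im (LINT z|circle. indicator A z *\<^sub>R f z)"
        by (rule integral_Im[OF si[OF that]])
      also have "\<dots> = (LINT z:A|circle. 0)"
        using z[OF that] by (simp add: set_lebesgue_integral_def)
      finally show ?thesis .
    qed
  qed (use int in auto)
  ultimately have "AE z in circle. f z = 0"
    by eventually_elim (simp add: complex_eq_iff)
  then have "f =\<^sub>T (\<lambda>z. 0)" by (simp add: ae_eq_def)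
  then have "abs_l2 f = abs_l2 (\<lambda>z. 0)"
    using abs_l2_eq_iff[OF f L2_const] by blast
  then show ?thesis by (simp add: xf zero_l2_def)
qed

lemma l2_eqI: "(\<And>n. cip x (zp n) = cip y (zp n)) \<Longrightarrow> x = y"
  using fourier_eq_0[of "x - y"] by (simp add: cip_simps)

definition psum :: "nat \<Rightarrow> l2 \<Rightarrow> l2" where
  "psum N x = (\<Sum>n<N. cip x (zp (int n)) *\<^sub>C zp (int n))"

lemma cip_sum_left: "cip (\<Sum>i\<in>I. f i) y = (\<Sum>i\<in>I. cip (f i) y)"
  by (induction I rule: infinite_finite_induct) (auto simp: cip_add_left)

lemma cip_sum_right: "cip y (\<Sum>i\<in>I. f i) = (\<Sum>i\<in>I. cip y (f i))"
  by (induction I rule: infinite_finite_induct) (auto simp: cip_add_right)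

lemma psum_0 [simp]: "psum 0 x = 0"
  by (simp add: psum_def)

lemma psum_Suc: "psum (Suc N) x = psum N x + cip x (zp (int N)) *\<^sub>C zp (int N)"
  by (simp add: psum_def)

lemma bd_psum [simp]: "bd (psum N x)"
  by (induction N) (simp_all add: psum_Suc)

lemma cip_psum_zp: "cip (psum N x) (zp m) = (if 0 \<le> m \<and> m < int N then cip x (zp m) else 0)"
  by (induction N) (auto simp: psum_Suc cip_add_left cip_zp)

lemma cip_psum_left: "cip (psum N x) y = cip x (psum N y)"
  unfolding psum_def by (simp add: cip_sum_left cip_sum_right cip_commute[of y] mult.commute)

lemma psum_psum: "N \<le> M \<Longrightarrow> psum N (psum M x) = psum N x"
  by (rule l2_eqI) (simp add: cip_psum_zp)

lemma norm_psum_diff: "(norm (x - psum N x))\<^sup>2 = (norm x)\<^sup>2 - (norm (psum N x))\<^sup>2"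
proof -
  have "cip (psum N x) (psum N x) = cip x (psum N x)"
    by (simp add: cip_psum_left psum_psum)
  moreover have "cip (psum N x) x = cip x (psum N x)" by (rule cip_psum_left)
  ultimately have "cip (x - psum N x) (x - psum N x) = cip x x - cip (psum N x) (psum N x)"
    by (simp add: cip_simps)
  then show ?thesis
    unfolding cip_self by (metis of_real_diff of_real_eq_iff)
qed

lemma convergent_psum: "convergent (\<lambda>N. psum N x)"
proof -
  let ?a = "\<lambda>N. (norm (psum N x))\<^sup>2"
  have le: "?a N \<le> (norm x)\<^sup>2" for N
    using norm_psum_diff[of x N] by (metis diff_ge_0_iff_ge zero_le_power2)
  have diff: "(norm (psum M x - psum N x))\<^sup>2 = ?a M - ?a N" if "N \<le> M" for M N
    using norm_psum_diff[of "psum M x" N] that by (simp add: psum_psum)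
  have mono: "incseq ?a"
    by (rule incseq_SucI) (metis diff diff_ge_0_iff_ge le_SucI order_refl zero_le_power2)
  have "Bseq ?a"
    by (rule BseqI'[where K = "(norm x)\<^sup>2"]) (use le in auto)
  then have "convergent ?a" using mono by (intro Bseq_monoseq_convergent) (auto simp: monoseq_iff)
  then have C: "Cauchy ?a" by (rule convergent_Cauchy)
  have "Cauchy (\<lambda>N. psum N x)"
  proof (rule CauchyI')
    fix d :: real assume "d > 0"
    then obtain M where M: "\<And>m n. m \<ge> M \<Longrightarrow> n \<ge> M \<Longrightarrow> norm (?a m - ?a n) < d\<^sup>2"
      using C unfolding Cauchy_iff by (metis zero_less_power)
    have "norm (psum m x - psum n x) < d" if "m \<ge> M" "n > m" for m n
    proof -
      have "(norm (psum n x - psum m x))\<^sup>2 < d\<^sup>2"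
        using M[of n m] that diff[of m n] by auto
      then show ?thesis
        using \<open>d > 0\<close> by (metis norm_minus_commute norm_ge_zero power2_less_imp_less less_imp_le)
    qed
    then show "\<exists>M. \<forall>m\<ge>M. \<forall>n>m. dist (psum m x) (psum n x) < d"
      by (auto simp: dist_norm)
  qed
  then show ?thesis by (rule Cauchy_convergent)
qed

definition Hproj :: "l2 \<Rightarrow> l2" where
  "Hproj x = lim (\<lambda>N. psum N x)"

definition Hardy :: "l2 set" where
  "Hardy = {x. \<forall>n<0. cip x (zp n) = 0}"

lemma psum_tendsto: "(\<lambda>N. psum N x) \<longlonglongrightarrow> Hproj x"
  unfolding Hproj_def using convergent_psum by (simp add: convergent_LIMSEQ_iff)

lemma cip_Hproj_zp: "cip (Hproj x) (zp n) = (if n \<ge> 0 then cip x (zp n) else 0)"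
proof -
  have "(\<lambda>N. cip (psum N x) (zp n)) \<longlonglongrightarrow> cip (Hproj x) (zp n)"
    by (intro tendsto_cip_left psum_tendsto)
  moreover have "(\<lambda>N. cip (psum N x) (zp n)) \<longlonglongrightarrow> (if n \<ge> 0 then cip x (zp n) else 0)"
    by (rule tendsto_eventually) (auto simp: cip_psum_zp eventually_sequentially intro!: exI[of _ "Suc (nat n)"])
  ultimately show ?thesis by (rule LIMSEQ_unique)
qed

lemma Hproj_in_Hardy [simp]: "Hproj x \<in> Hardy"
  by (simp add: Hardy_def cip_Hproj_zp)

lemma Hproj_Hardy: "x \<in> Hardy \<longleftrightarrow> Hproj x = x"
proof
  assume "x \<in> Hardy"
  then show "Hproj x = x" by (intro l2_eqI) (simp add: cip_Hproj_zp Hardy_def)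
next
  show "Hproj x = x \<Longrightarrow> x \<in> Hardy" using Hproj_in_Hardy[of x] by simp
qed

lemma Hproj_add: "Hproj (x + y) = Hproj x + Hproj y"
  by (rule l2_eqI) (simp add: cip_Hproj_zp cip_simps)

lemma Hproj_diff: "Hproj (x - y) = Hproj x - Hproj y"
  by (rule l2_eqI) (simp add: cip_Hproj_zp cip_simps)

lemma Hproj_scale: "Hproj (c *\<^sub>C x) = c *\<^sub>C Hproj x"
  by (rule l2_eqI) (simp add: cip_Hproj_zp)

lemma cip_Hproj: "cip (Hproj x) y = cip x (Hproj y)"
proof -
  have "(\<lambda>N. cip (psum N x) y) \<longlonglongrightarrow> cip (Hproj x) y"
    by (intro tendsto_cip_left psum_tendsto)
  moreover have "(\<lambda>N. cip (psum N x) y) \<longlonglongrightarrow> cip x (Hproj y)"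
    unfolding cip_psum_left by (intro tendsto_cip_right psum_tendsto)
  ultimately show ?thesis by (rule LIMSEQ_unique)
qed

lemma Hardy_perp:
  assumes "h \<in> Hardy" "\<And>n. n \<ge> 0 \<Longrightarrow> cip y (zp n) = 0"
  shows "cip h y = 0" "cip y h = 0"
proof -
  have "Hproj y = 0"
    by (rule l2_eqI) (simp add: cip_Hproj_zp assms)
  then show "cip h y = 0"
    using assms(1) cip_Hproj[of h y] by (simp add: Hproj_Hardy)
  then show "cip y h = 0" using cip_commute[of y h] by simp
qed

lemma Hardy_add [simp]: "x \<in> Hardy \<Longrightarrow> y \<in> Hardy \<Longrightarrow> x + y \<in> Hardy"
  and Hardy_diff [simp]: "x \<in> Hardy \<Longrightarrow> y \<in> Hardy \<Longrightarrow> x - y \<in> Hardy"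
  and Hardy_scale [simp]: "x \<in> Hardy \<Longrightarrow> c *\<^sub>C x \<in> Hardy"
  and Hardy_zero [simp]: "0 \<in> Hardy"
  and Hardy_zp [simp]: "n \<ge> 0 \<Longrightarrow> zp n \<in> Hardy"
  by (auto simp: Hardy_def cip_simps cip_zp)

lemma Hardy_mult:
  assumes "h \<in> Hardy" "f \<in> Hardy" "bd f"
  shows "h \<odot> f \<in> Hardy"
  unfolding Hardy_def
proof (intro CollectI allI impI)
  fix n :: int assume "n < 0"
  have "cip (cj f \<odot> zp n) (zp m) = 0" if "m \<ge> 0" for m
  proof -
    have "cip (cj f \<odot> zp n) (zp m) = cip (zp n) (f \<odot> zp m)"
      using assms by (simp add: cip_mult_adj)
    also have "\<dots> = cnj (cip (f \<odot> zp m) (zp n))" by (rule cip_commute)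
    also have "cip (f \<odot> zp m) (zp n) = cip f (zp (n - m))"
      by (simp add: cip_mult_right_adj)
    also have "\<dots> = 0" using assms(2) \<open>n < 0\<close> \<open>m \<ge> 0\<close> by (simp add: Hardy_def)
    finally show ?thesis by simp
  qed
  then show "cip (h \<odot> f) (zp n) = 0"
    using Hardy_perp(1)[OF assms(1)] assms by (simp add: cip_mult_right_adj)
qed

text \<open>Evaluation at the origin is multiplicative: this is the only way products of two
  unbounded Hardy functions enter.\<close>

lemma cip_cj_Hardy:
  assumes "x \<in> Hardy" "y \<in> Hardy"
  shows "cip x (cj y) = cip x (zp 0) * cip y (zp 0)"
proof -
  let ?y = "y - cip y (zp 0) *\<^sub>C zp 0"
  have "cip (cj ?y) (zp n) = 0" if "n \<ge> 0" for n
    using assms(2) that cip_cj[of ?y "zp (- n)"] cip_commute[of "zp (-n)" ?y]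
    by (cases "n = 0") (auto simp: Hardy_def cip_simps cip_zp)
  from Hardy_perp(1)[OF assms(1) this] show ?thesis
    by (simp add: cip_simps)
qed

section \<open>The model space of an inner function\<close>

lemma mult_zero [simp]: "x \<odot> 0 = 0" "0 \<odot> x = 0"
  using mult_scale_right[of x 0 0] mult_scale_left[of 0 0 x] by simp_all

lemma uminus_scaleC [simp]: "- (c *\<^sub>C x) = (- c) *\<^sub>C x"
  by (simp add: uminus_eq_scaleC[of "c *\<^sub>C x"])

lemma scaleC_diff_left: "(c - d) *\<^sub>C x = c *\<^sub>C x - d *\<^sub>C x"
  using scaleC_add_left[of "c - d" d x] by simp

lemma cip_mult_adj_unbounded:
  assumes "bd y" "bd z"
  shows "cip (x \<odot> y) z = cip y (cj x \<odot> z)"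
proof -
  have "cip (x \<odot> y) z = cip x (cj y \<odot> z)" using assms by (simp add: cip_mult_right_adj)
  also have "\<dots> = cip x (z \<odot> cj y)" by (simp add: mult_commute)
  also have "\<dots> = cip (x \<odot> cj z) (cj y)" using assms by (simp add: cip_mult_right_adj)
  also have "\<dots> = cip y (cj (x \<odot> cj z))" using cip_cj[of "cj (x \<odot> cj z)" y] by simp
  finally show ?thesis by simp
qed

lemma zp_zp_mult [simp]: "zp m \<odot> (zp n \<odot> x) = zp (m + n) \<odot> x"
  by (metis bd_zp mult_assoc mult_commute zp_mult_zp)

lemma cip_zp_mult [simp]: "cip (zp n \<odot> x) (zp n \<odot> y) = cip x y"
  by (simp add: cip_mult_adj)

lemma cip_zp_mult_left: "cip (zp n \<odot> x) y = cip x (zp (- n) \<odot> y)"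
  by (simp add: cip_mult_adj)

lemma norm_zp_mult [simp]: "norm (zp n \<odot> x) = norm x"
  by (simp add: norm_eq_cip)

lemma zp_mult_commute: "bd b \<Longrightarrow> b \<odot> (zp n \<odot> x) = zp n \<odot> (b \<odot> x)"
  by (simp add: mult_left_commute)

lemma mult_zp_assoc: "bd f \<Longrightarrow> x \<odot> (zp n \<odot> f) = zp n \<odot> (x \<odot> f)"
  by (metis bd_zp mult_assoc mult_commute)

lemma tendsto_zp_mult: "(s \<longlongrightarrow> x) F \<Longrightarrow> ((\<lambda>n. zp k \<odot> s n) \<longlongrightarrow> zp k \<odot> x) F"
proof -
  assume *: "(s \<longlongrightarrow> x) F"
  have "norm (zp k \<odot> s n - zp k \<odot> x) = norm (s n - x)" for n
    using norm_zp_mult[of k "s n - x"] by (simp add: mult_diff_right)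
  with * show ?thesis by (simp add: tendsto_iff dist_norm)
qed

lemma tendsto_scaleC:
  assumes "(s \<longlongrightarrow> x) F" "(c \<longlongrightarrow> d) F"
  shows "((\<lambda>n. c n *\<^sub>C s n) \<longlongrightarrow> d *\<^sub>C x) F"
proof -
  have "bounded_bilinear (*\<^sub>C)"
    by (standard; (intro exI[of _ 1])?)
      (auto simp: scaleC_add_left scaleC_add_right scaleR_eq_scaleC scaleR_conv_of_real mult.commute)
  from bounded_bilinear.tendsto[OF this assms(2,1)] show ?thesis .
qed

lemma tendsto_cip_both:
  assumes "(s \<longlongrightarrow> x) F" "(t \<longlongrightarrow> y) F"
  shows "((\<lambda>n. cip (s n) (t n)) \<longlongrightarrow> cip x y) F"
proof -
  have "bounded_bilinear cip"
    by (standard; (intro exI[of _ 1])?)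
      (auto simp: cip_simps scaleR_eq_scaleC scaleR_conv_of_real cip_bound)
  from bounded_bilinear.tendsto[OF this assms] show ?thesis .
qed

definition bshift :: "l2 \<Rightarrow> l2" where
  "bshift x = zp (- 1) \<odot> (x - cip x (zp 0) *\<^sub>C zp 0)"

lemma bshift_add: "bshift (x + y) = bshift x + bshift y"
  and bshift_diff: "bshift (x - y) = bshift x - bshift y"
  and bshift_scale: "bshift (c *\<^sub>C x) = c *\<^sub>C bshift x"
  by (simp_all add: bshift_def cip_simps scaleC_add_left scaleC_diff_left mult_add_right mult_diff_right
      mult_scale_right scaleC_diff_right algebra_simps)

lemma bshift_Hardy [simp]: "x \<in> Hardy \<Longrightarrow> bshift x \<in> Hardy"
  by (auto simp: Hardy_def bshift_def cip_zp_mult_left cip_simps cip_zp)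

lemma bd_bshift [simp]: "bd x \<Longrightarrow> bd (bshift x)"
  by (simp add: bshift_def)

lemma zp_bshift: "zp 1 \<odot> bshift x = x - cip x (zp 0) *\<^sub>C zp 0"
  by (simp add: bshift_def)

lemma zp_bshift_0: "cip x (zp 0) = 0 \<Longrightarrow> zp 1 \<odot> bshift x = x"
  by (simp add: zp_bshift)

lemma tendsto_bshift: "(s \<longlongrightarrow> x) F \<Longrightarrow> ((\<lambda>n. bshift (s n)) \<longlongrightarrow> bshift x) F"
  unfolding bshift_def
  by (intro tendsto_zp_mult tendsto_diff tendsto_scaleC tendsto_const tendsto_cip_left)

lemma bshift_funpow: "zp (int n) \<odot> (bshift ^^ n) x = x - psum n x"
proof (induction n)
  case (Suc n)
  let ?y = "(bshift ^^ n) x"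
  have "cip ?y (zp 0) = cip (zp (int n) \<odot> ?y) (zp (int n) \<odot> zp 0)"
    by (rule cip_zp_mult[symmetric])
  also have "\<dots> = cip x (zp (int n))"
    unfolding Suc by (simp add: cip_simps cip_psum_zp)
  finally have *: "cip ?y (zp 0) = cip x (zp (int n))" .
  have "zp (int (Suc n)) \<odot> (bshift ^^ Suc n) x = zp (int n) \<odot> (zp 1 \<odot> bshift ?y)"
    by (simp add: add.commute)
  also have "\<dots> = zp (int n) \<odot> ?y - cip ?y (zp 0) *\<^sub>C zp (int n)"
    unfolding zp_bshift by (simp add: mult_diff_right mult_scale_right)
  also have "\<dots> = x - psum (Suc n) x"
    unfolding Suc * psum_Suc by simp
  finally show ?case .
qed simp

lemma bd_bshift_funpow [simp]: "bd x \<Longrightarrow> bd ((bshift ^^ n) x)"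
  by (induction n) auto

lemma bshift_funpow_Hardy [simp]: "x \<in> Hardy \<Longrightarrow> (bshift ^^ n) x \<in> Hardy"
  by (induction n) auto

lemma norm_bshift_funpow: "norm ((bshift ^^ n) x) = norm (x - psum n x)"
  by (metis bshift_funpow norm_zp_mult)

lemma psum_remainder_tendsto: "x \<in> Hardy \<Longrightarrow> (\<lambda>n. x - psum n x) \<longlonglongrightarrow> 0"
  using tendsto_diff[OF tendsto_const psum_tendsto[of x], of x] by (simp add: Hproj_Hardy)

locale model_space =
  fixes u :: l2
  assumes u_Hardy [simp]: "u \<in> Hardy" and bd_u [simp]: "bd u" and u_cj_u: "u \<odot> cj u = zp 0"
    and u_nonconst: "\<And>c. u \<noteq> c *\<^sub>C zp 0"
begin

lemma u_cancel [simp]: "cj u \<odot> (u \<odot> x) = x" "u \<odot> (cj u \<odot> x) = x"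
proof -
  have "cj u \<odot> (u \<odot> x) = (u \<odot> cj u) \<odot> x" "u \<odot> (cj u \<odot> x) = (u \<odot> cj u) \<odot> x"
    by (metis bd_cj bd_u mult_assoc mult_commute)+
  then show "cj u \<odot> (u \<odot> x) = x" "u \<odot> (cj u \<odot> x) = x" by (simp_all add: u_cj_u)
qed

lemma cip_u_mult [simp]: "cip (u \<odot> x) (u \<odot> y) = cip x y"
  by (simp add: cip_mult_adj)

abbreviation "u0 \<equiv> cip u (zp 0)"

lemma cip_u_u [simp]: "cip u u = 1"
  using cip_u_mult[of "zp 0" "zp 0"] by (simp add: cip_zp)

definition Ksp :: "l2 set" where
  "Ksp = {x \<in> Hardy. \<forall>h\<in>Hardy. cip x (u \<odot> h) = 0}"

definition Kb :: "l2 set" where "Kb = {x \<in> Ksp. bd x}"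

definition Kproj :: "l2 \<Rightarrow> l2" where
  "Kproj x = Hproj x - u \<odot> Hproj (cj u \<odot> x)"

lemma Ksp_Hardy: "x \<in> Ksp \<Longrightarrow> x \<in> Hardy"
  by (simp add: Ksp_def)

lemma Ksp_add [simp]: "x \<in> Ksp \<Longrightarrow> y \<in> Ksp \<Longrightarrow> x + y \<in> Ksp"
  and Ksp_diff [simp]: "x \<in> Ksp \<Longrightarrow> y \<in> Ksp \<Longrightarrow> x - y \<in> Ksp"
  and Ksp_scale [simp]: "x \<in> Ksp \<Longrightarrow> c *\<^sub>C x \<in> Ksp"
  and Ksp_zero [simp]: "0 \<in> Ksp"
  by (auto simp: Ksp_def cip_simps)

lemma Kb_D: "x \<in> Kb \<Longrightarrow> x \<in> Ksp" "x \<in> Kb \<Longrightarrow> bd x"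
  by (auto simp: Kb_def)

lemma Kb_add [simp]: "x \<in> Kb \<Longrightarrow> y \<in> Kb \<Longrightarrow> x + y \<in> Kb"
  and Kb_diff [simp]: "x \<in> Kb \<Longrightarrow> y \<in> Kb \<Longrightarrow> x - y \<in> Kb"
  and Kb_scale [simp]: "x \<in> Kb \<Longrightarrow> c *\<^sub>C x \<in> Kb"
  by (auto simp: Kb_def)

lemma Ksp_u: "x \<in> Ksp \<Longrightarrow> h \<in> Hardy \<Longrightarrow> cip x (u \<odot> h) = 0"
  "x \<in> Ksp \<Longrightarrow> h \<in> Hardy \<Longrightarrow> cip (u \<odot> h) x = 0"
  using cip_commute[of "u \<odot> h" x] by (auto simp: Ksp_def)

lemma Ksp_u' [simp]: "x \<in> Ksp \<Longrightarrow> cip x u = 0" "x \<in> Ksp \<Longrightarrow> cip u x = 0"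
  using Ksp_u[of x "zp 0"] by auto

lemma Kproj_in [simp]: "Kproj x \<in> Ksp"
  unfolding Ksp_def
proof (intro CollectI conjI ballI)
  have "u \<odot> Hproj (cj u \<odot> x) \<in> Hardy"
    using Hardy_mult[of "Hproj (cj u \<odot> x)" u] by (simp add: mult_commute)
  then show "Kproj x \<in> Hardy" by (simp add: Kproj_def)
  fix h assume h: "h \<in> Hardy"
  have uh: "u \<odot> h \<in> Hardy"
    using Hardy_mult[of h u] h by (simp add: mult_commute)
  have "cip (Hproj x) (u \<odot> h) = cip x (u \<odot> h)"
    using uh by (simp add: cip_Hproj Hproj_Hardy)
  moreover have "cip (u \<odot> Hproj (cj u \<odot> x)) (u \<odot> h) = cip x (u \<odot> h)"
    using h by (simp add: cip_Hproj Hproj_Hardy) (simp add: cip_mult_adj)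
  ultimately show "cip (Kproj x) (u \<odot> h) = 0"
    by (simp add: Kproj_def cip_simps)
qed

lemma Hproj_cj_u_Ksp: "x \<in> Ksp \<Longrightarrow> Hproj (cj u \<odot> x) = 0"
  by (rule l2_eqI) (auto simp: cip_Hproj_zp cip_mult_adj Ksp_u)

lemma Kproj_id [simp]: "x \<in> Ksp \<Longrightarrow> Kproj x = x"
  using Ksp_Hardy[of x] by (simp add: Kproj_def Hproj_cj_u_Ksp Hproj_Hardy)

lemma cip_Kproj: "cip (Kproj x) y = cip x (Kproj y)"
  by (simp add: Kproj_def cip_simps cip_Hproj) (simp add: cip_mult_adj cip_Hproj)

lemma cip_Kproj_K: "k \<in> Ksp \<Longrightarrow> cip (Kproj x) k = cip x k"
  by (simp add: cip_Kproj)

lemma Kproj_add: "Kproj (x + y) = Kproj x + Kproj y"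
  and Kproj_diff: "Kproj (x - y) = Kproj x - Kproj y"
  and Kproj_scale: "Kproj (c *\<^sub>C x) = c *\<^sub>C Kproj x"
  by (simp_all add: Kproj_def mult_add_right mult_diff_right mult_scale_right
    Hproj_add Hproj_diff Hproj_scale scaleC_diff_right)

lemma Ksp_eqI:
  assumes "x \<in> Ksp" "y \<in> Ksp" "\<And>k. k \<in> Ksp \<Longrightarrow> cip x k = cip y k"
  shows "x = y"
  using assms(3)[of "x - y"] assms(1,2) cip_eq_0_iff[of "x - y"] by (simp add: cip_diff_left)

lemma Kproj_eqI:
  assumes "y \<in> Ksp" "\<And>k. k \<in> Ksp \<Longrightarrow> cip x k = cip y k"
  shows "Kproj x = y"
  by (rule Ksp_eqI) (use assms in \<open>auto simp: cip_Kproj_K\<close>)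

lemma norm_Kproj: "norm (Kproj x) \<le> norm x"
proof -
  have "cip (Kproj x) (Kproj x) = cip x (Kproj x)" by (simp add: cip_Kproj)
  then have "(norm (Kproj x))\<^sup>2 = norm (cip x (Kproj x))"
    using cip_self[of "Kproj x"] by (metis abs_power2 norm_of_real real_norm_def)
  also have "\<dots> \<le> norm x * norm (Kproj x)" by (rule cip_bound)
  finally show ?thesis
    by (cases "norm (Kproj x) = 0") (auto simp: power2_eq_square)
qed

lemma tendsto_Kproj: "(s \<longlongrightarrow> x) F \<Longrightarrow> ((\<lambda>n. Kproj (s n)) \<longlongrightarrow> Kproj x) F"
proof -
  have "bounded_linear Kproj"
    by (rule bounded_linear_intro[where K = 1])
      (auto simp: Kproj_add Kproj_scale scaleR_eq_scaleC norm_Kproj)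
  then show "(s \<longlongrightarrow> x) F \<Longrightarrow> ((\<lambda>n. Kproj (s n)) \<longlongrightarrow> Kproj x) F"
    by (rule bounded_linear.tendsto)
qed

lemma Ksp_closed: "(\<And>n::nat. s n \<in> Ksp) \<Longrightarrow> s \<longlonglongrightarrow> x \<Longrightarrow> x \<in> Ksp"
proof -
  assume "\<And>n. s n \<in> Ksp" "s \<longlonglongrightarrow> x"
  then have "s \<longlonglongrightarrow> Kproj x" using tendsto_Kproj[of s x sequentially] by simp
  then have "Kproj x = x" using \<open>s \<longlonglongrightarrow> x\<close> by (rule LIMSEQ_unique)
  then show ?thesis by (metis Kproj_in)
qed

text \<open>\<^term>\<open>Kproj (zp n)\<close> is bounded because \<^term>\<open>cj u \<odot> zp n\<close> has only finitely many Fourier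
  coefficients of nonnegative index.\<close>

lemma bd_Kproj_zp: "n \<ge> 0 \<Longrightarrow> bd (Kproj (zp n))"
proof -
  assume n: "n \<ge> 0"
  have "cip (cj u \<odot> zp n) (zp m) = 0" if "m > n" for m
  proof -
    have "cip (cj u \<odot> zp n) (zp m) = cnj (cip (u \<odot> zp m) (zp n))"
      using cip_commute[of "zp n" "u \<odot> zp m"] by (simp add: cip_mult_adj)
    also have "cip (u \<odot> zp m) (zp n) = cip u (zp (n - m))"
      by (simp add: cip_mult_right_adj)
    also have "\<dots> = 0" using u_Hardy that by (simp add: Hardy_def)
    finally show ?thesis by simp
  qed
  then have "Hproj (cj u \<odot> zp n) = psum (Suc (nat n)) (cj u \<odot> zp n)"
    using n by (intro l2_eqI) (auto simp: cip_Hproj_zp cip_psum_zp)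
  moreover have "Hproj (zp n) = zp n" using n Hproj_Hardy[of "zp n"] by simp
  ultimately show ?thesis by (simp add: Kproj_def)
qed

lemma Kproj_psum_Kb: "Kproj (psum N x) \<in> Kb"
proof -
  have "bd (Kproj (psum N x))"
  proof (induction N)
    case 0
    show ?case using Kproj_scale[of 0 0] by simp
  qed (simp add: psum_Suc Kproj_add Kproj_scale bd_Kproj_zp)
  then show ?thesis by (simp add: Kb_def)
qed

lemma Kb_dense:
  assumes "x \<in> Ksp"
  obtains s where "\<And>n::nat. s n \<in> Kb" "s \<longlonglongrightarrow> x"
proof (rule that)
  show "Kproj (psum n x) \<in> Kb" for n by (rule Kproj_psum_Kb)
  have "(\<lambda>n. Kproj (psum n x)) \<longlonglongrightarrow> Kproj (Hproj x)"
    by (intro tendsto_Kproj psum_tendsto)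
  then show "(\<lambda>n. Kproj (psum n x)) \<longlonglongrightarrow> x"
    using assms Ksp_Hardy[OF assms] by (simp add: Hproj_Hardy)
qed

lemma Kb_dense_eq:
  fixes F G :: "l2 \<Rightarrow> 'b::t2_space"
  assumes "x \<in> Ksp" and eq: "\<And>x. x \<in> Kb \<Longrightarrow> F x = G x"
    and F: "\<And>s. (\<And>n::nat. s n \<in> Ksp) \<Longrightarrow> s \<longlonglongrightarrow> x \<Longrightarrow> (\<lambda>n. F (s n)) \<longlonglongrightarrow> F x"
    and G: "\<And>s. (\<And>n::nat. s n \<in> Ksp) \<Longrightarrow> s \<longlonglongrightarrow> x \<Longrightarrow> (\<lambda>n. G (s n)) \<longlonglongrightarrow> G x"
  shows "F x = G x"
proof -
  obtain s where s: "\<And>n::nat. s n \<in> Kb" "s \<longlonglongrightarrow> x" using Kb_dense[OF assms(1)] by metis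
  then have "(\<lambda>n. F (s n)) \<longlonglongrightarrow> F x" "(\<lambda>n. G (s n)) \<longlonglongrightarrow> G x"
    by (auto intro: F G Kb_D)
  moreover have "(\<lambda>n. F (s n)) = (\<lambda>n. G (s n))" using eq s by auto
  ultimately show ?thesis by (metis LIMSEQ_unique)
qed

lemma Kb_dense_eqI:
  assumes "x \<in> Ksp" "y \<in> Ksp" "\<And>k. k \<in> Kb \<Longrightarrow> cip x k = cip y k"
  shows "x = y"
  by (rule Ksp_eqI[OF assms(1,2)], rule Kb_dense_eq)
    (auto intro!: tendsto_cip_right assms(3))

text \<open>\<^term>\<open>k0\<close> is the reproducing kernel at the origin and \<^term>\<open>kt\<close> its image under \<open>C\<^sub>u\<close>.\<close>

definition k0 :: l2 where "k0 = zp 0 - cnj u0 *\<^sub>C u"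
definition kt :: l2 where "kt = zp (- 1) \<odot> (u - u0 *\<^sub>C zp 0)"
definition shift :: "l2 \<Rightarrow> l2" where "shift x = Kproj (zp 1 \<odot> x)"
definition conj_op :: "l2 \<Rightarrow> l2" where "conj_op x = u \<odot> (zp (- 1) \<odot> cj x)"

lemma shift_in [simp]: "shift x \<in> Ksp" by (simp add: shift_def)

lemma shift_add: "shift (x + y) = shift x + shift y"
  and shift_scale: "shift (c *\<^sub>C x) = c *\<^sub>C shift x"
  by (simp_all add: shift_def mult_add_right mult_diff_right mult_scale_right Kproj_add Kproj_diff Kproj_scale)

lemma bshift_in [simp]:
  assumes "x \<in> Ksp" shows "bshift x \<in> Ksp"
  unfolding Ksp_def
proof (intro CollectI conjI ballI)
  show "bshift x \<in> Hardy" using assms by (simp add: Ksp_Hardy)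
  fix h assume h: "h \<in> Hardy"
  have "zp 1 \<odot> h \<in> Hardy" using Hardy_mult[OF h, of "zp 1"] by (simp add: mult_commute)
  moreover have "cip (zp 0) (u \<odot> (zp 1 \<odot> h)) = 0"
  proof -
    have "zp 1 \<odot> (u \<odot> h) = u \<odot> (zp 1 \<odot> h)" by (simp add: zp_mult_commute)
    moreover have "u \<odot> h \<in> Hardy" using Hardy_mult[OF h, of u] by (simp add: mult_commute)
    then have "cip (u \<odot> h) (zp (- 1)) = 0" by (simp add: Hardy_def)
    then have "cip (zp 1 \<odot> (u \<odot> h)) (zp 0) = 0" by (simp add: cip_zp_mult_left)
    ultimately show ?thesis using cip_commute[of "zp 0" "u \<odot> (zp 1 \<odot> h)"] by simp
  qed
  ultimately show "cip (bshift x) (u \<odot> h) = 0"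
    using assms by (simp add: bshift_def cip_zp_mult_left cip_simps Ksp_u flip: zp_mult_commute)
qed

lemma bshift_Kb [simp]: "x \<in> Kb \<Longrightarrow> bshift x \<in> Kb"
  by (simp add: Kb_def)

lemma bshift_funpow_Kb [simp]: "x \<in> Kb \<Longrightarrow> (bshift ^^ n) x \<in> Kb"
  by (induction n) auto

lemma cip_Ksp_neg [simp]: "x \<in> Ksp \<Longrightarrow> cip x (zp (- 1)) = 0"
  using Ksp_Hardy[of x] by (simp add: Hardy_def)

lemma cip_zp_neg_Ksp [simp]: "x \<in> Ksp \<Longrightarrow> cip (zp (- 1)) x = 0"
  using cip_commute[of "zp (-1)" x] by simp

lemma cip_shift_left:
  assumes "x \<in> Ksp" "y \<in> Ksp" shows "cip (shift x) y = cip x (bshift y)"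
proof -
  have "cip (shift x) y = cip x (zp (- 1) \<odot> y)"
    using assms by (simp add: shift_def cip_Kproj_K cip_zp_mult_left)
  also have "\<dots> = cip x (bshift y)"
    using assms by (simp add: bshift_def mult_diff_right mult_scale_right cip_simps)
  finally show ?thesis .
qed

lemma cip_shift_right:
  assumes "x \<in> Ksp" "y \<in> Ksp" shows "cip y (shift x) = cip (bshift y) x"
  using cip_shift_left[OF assms] cip_commute[of y "shift x"] cip_commute[of "bshift y" x] by simp

lemma k0_in [simp]: "k0 \<in> Ksp"
  unfolding Ksp_def
proof (intro CollectI conjI ballI)
  show "k0 \<in> Hardy" by (simp add: k0_def)
  fix h assume h: "h \<in> Hardy"
  have "cip (u \<odot> h) (zp 0) = cip h (cj u)"
    by (simp add: cip_mult_adj)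
  also have "\<dots> = u0 * cip h (zp 0)"
    using cip_cj_Hardy[OF h u_Hardy] by simp
  finally have "cip (zp 0) (u \<odot> h) = cnj u0 * cip (zp 0) h"
    using cip_commute[of "zp 0" "u \<odot> h"] cip_commute[of "zp 0" h] by simp
  moreover have "cip u (u \<odot> h) = cip (zp 0) h"
    using cip_u_mult[of "zp 0" h] by simp
  ultimately show "cip k0 (u \<odot> h) = 0"
    by (simp add: k0_def cip_simps)
qed

lemma bd_k0 [simp]: "bd k0" by (simp add: k0_def)

lemma k0_Kb [simp]: "k0 \<in> Kb" by (simp add: Kb_def)

lemma cip_k0: "x \<in> Ksp \<Longrightarrow> cip x k0 = cip x (zp 0)"
  by (simp add: k0_def cip_simps)

lemma cip_k0_left: "x \<in> Ksp \<Longrightarrow> cip k0 x = cnj (cip x (zp 0))"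
  using cip_k0[of x] cip_commute[of k0 x] by simp

lemma k0_0: "cip k0 (zp 0) = 1 - cnj u0 * u0"
  by (simp add: k0_def cip_simps cip_zp)

lemma k0_0_nonzero: "cip k0 (zp 0) \<noteq> 0"
proof
  assume "cip k0 (zp 0) = 0"
  then have "cip k0 k0 = 0" by (simp add: cip_k0)
  then have *: "zp 0 = cnj u0 *\<^sub>C u" by (simp add: k0_def)
  then have "cnj u0 \<noteq> 0" using cip_eq_0_iff[of "zp 0"] by (auto simp: cip_zp)
  then have "u = (1 / cnj u0) *\<^sub>C zp 0" by (subst *) simp
  then show False using u_nonconst by blast
qed

lemma conj_op_invol [simp]: "conj_op (conj_op x) = x"
  by (simp add: conj_op_def zp_mult_commute)

lemma cip_conj_op: "cip (conj_op x) (conj_op y) = cip y x"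
  by (simp add: conj_op_def)

lemma conj_op_add: "conj_op (x + y) = conj_op x + conj_op y"
  and conj_op_diff: "conj_op (x - y) = conj_op x - conj_op y"
  and conj_op_scale: "conj_op (c *\<^sub>C x) = cnj c *\<^sub>C conj_op x"
  by (simp_all add: conj_op_def mult_add_right mult_diff_right mult_scale_right)

lemma Hardy_cj_neg: "h \<in> Hardy \<Longrightarrow> n \<ge> 0 \<Longrightarrow> cip (zp (-1) \<odot> cj h) (zp n) = 0"
proof -
  assume h: "h \<in> Hardy" "n \<ge> 0"
  have "cip (zp (-1) \<odot> cj h) (zp n) = cip (cj h) (cj (zp (- n - 1)))"
    by (simp add: cip_zp_mult_left)
  also have "\<dots> = cip (zp (- n - 1)) h" by (rule cip_cj)
  also have "\<dots> = 0" using h cip_commute[of "zp (- n - 1)" h] by (simp add: Hardy_def)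
  finally show ?thesis .
qed

lemma conj_op_in [simp]:
  assumes "x \<in> Ksp" shows "conj_op x \<in> Ksp"
  unfolding Ksp_def
proof (intro CollectI conjI ballI)
  show "conj_op x \<in> Hardy"
    unfolding Hardy_def
  proof (intro CollectI allI impI)
    fix n :: int assume n: "n < 0"
    have "cip (conj_op x) (zp n) = cip (cj x) (cj (u \<odot> zp (- n - 1)))"
      by (simp add: conj_op_def cip_mult_adj zp_mult_commute)
    also have "\<dots> = cip (u \<odot> zp (- n - 1)) x" by (rule cip_cj)
    finally show "cip (conj_op x) (zp n) = 0" using assms n by (simp add: Ksp_u)
  qed
  fix h assume h: "h \<in> Hardy"
  have "cip (conj_op x) (u \<odot> h) = cip (zp (- 1) \<odot> cj x) h"
    by (simp add: conj_op_def)
  also have "\<dots> = 0" by (rule Hardy_perp(2)[OF h]) (rule Hardy_cj_neg[OF Ksp_Hardy[OF assms]])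
  finally show "cip (conj_op x) (u \<odot> h) = 0" .
qed

lemma bd_conj_op [simp]: "bd x \<Longrightarrow> bd (conj_op x)" by (simp add: conj_op_def)

lemma conj_op_Kb [simp]: "x \<in> Kb \<Longrightarrow> conj_op x \<in> Kb" by (simp add: Kb_def)

lemma norm_conj_op [simp]: "norm (conj_op x) = norm x"
  by (simp add: norm_eq_cip cip_conj_op)

lemma tendsto_conj_op: "(s \<longlongrightarrow> x) F \<Longrightarrow> ((\<lambda>n. conj_op (s n)) \<longlongrightarrow> conj_op x) F"
  using norm_conj_op[of "_ - x"] by (simp add: tendsto_iff dist_norm flip: conj_op_diff)

lemma conj_op_k0: "conj_op k0 = kt"
  by (simp add: conj_op_def k0_def kt_def zp_mult_commute mult_diff_right mult_scale_right)
     (simp add: u_cj_u mult_commute[of u "zp (- 1)"])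

lemma kt_in [simp]: "kt \<in> Ksp" using conj_op_in[OF k0_in] by (simp add: conj_op_k0)

lemma kt_Kb [simp]: "kt \<in> Kb" using conj_op_Kb[OF k0_Kb] by (simp add: conj_op_k0)

lemma kt_alt: "kt = zp (- 1) \<odot> u - u0 *\<^sub>C zp (- 1)"
  by (simp add: kt_def mult_diff_right mult_scale_right)

lemma shift_eq:
  assumes "y \<in> Ksp" shows "shift y = zp 1 \<odot> y - cip y kt *\<^sub>C u"
proof -
  have y: "zp 1 \<odot> y \<in> Hardy"
    using Hardy_mult[OF Ksp_Hardy[OF assms], of "zp 1"] by (simp add: mult_commute)
  have "Hproj (cj u \<odot> (zp 1 \<odot> y)) = cip y kt *\<^sub>C zp 0"
  proof (rule l2_eqI)
    fix n
    have e: "cip (cj u \<odot> (zp 1 \<odot> y)) (zp n) = cip y (u \<odot> zp (n - 1))"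
      by (simp add: cip_mult_adj zp_mult_commute)
    have "cip y (u \<odot> zp (- 1)) = cip y kt"
      using assms by (simp add: kt_alt cip_simps mult_commute)
    then show "cip (Hproj (cj u \<odot> (zp 1 \<odot> y))) (zp n) = cip (cip y kt *\<^sub>C zp 0) (zp n)"
      using assms unfolding cip_Hproj_zp e by (auto simp: cip_zp Ksp_u)
  qed
  then show ?thesis
    using y by (simp add: shift_def Kproj_def Hproj_Hardy mult_scale_right)
qed

lemma bshift_shift:
  assumes "y \<in> Ksp" shows "bshift (shift y) = y - cip y kt *\<^sub>C kt"
  using assms
  by (simp add: bshift_def shift_eq cip_simps cip_zp_mult_left kt_alt mult_diff_right mult_scale_right
       scaleC_diff_right)

lemma bshift_k0: "bshift k0 = - cnj u0 *\<^sub>C kt"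
proof -
  have "k0 - cip k0 (zp 0) *\<^sub>C zp 0 = - cnj u0 *\<^sub>C (u - u0 *\<^sub>C zp 0)"
    by (rule l2_eqI) (simp add: k0_0 cip_simps cip_zp k0_def algebra_simps)
  then show ?thesis by (simp add: bshift_def kt_def mult_scale_right)
qed

lemma shift_0: "y \<in> Ksp \<Longrightarrow> cip (shift y) (zp 0) = - u0 * cip y kt"
  by (simp add: shift_eq cip_simps cip_zp_mult_left)

lemma cip_kt_bshift: "x \<in> Ksp \<Longrightarrow> cip (bshift x) kt = - cnj u0 * cip x (zp 0)"
  by (simp add: bshift_def kt_def cip_simps cip_zp) (simp add: cip_commute[of "zp 0" u])

lemma shift_bshift:
  assumes "x \<in> Ksp" shows "shift (bshift x) = x - cip x (zp 0) *\<^sub>C k0"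
  using assms by (intro l2_eqI)
    (simp add: shift_eq cip_kt_bshift zp_bshift cip_simps k0_def algebra_simps)

definition W :: "l2 \<Rightarrow> l2" where "W x = shift (conj_op x)"

lemma W_in [simp]: "W x \<in> Ksp" by (simp add: W_def)

lemma W_add: "W (x + y) = W x + W y"
  and W_scale: "W (c *\<^sub>C x) = cnj c *\<^sub>C W x"
  by (simp_all add: W_def conj_op_add conj_op_scale shift_add shift_scale)

lemma W_zero [simp]: "W 0 = 0"
  using W_scale[of 0 0] by simp

lemma conj_shift_conj:
  assumes "x \<in> Ksp" shows "conj_op (W x) = bshift x"
proof -
  have "cip (conj_op x) kt = cnj (cip x (zp 0))"
    using assms cip_conj_op[of x k0] by (simp add: conj_op_k0 cip_k0_left)
  moreover have "conj_op u = zp (- 1)"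
    by (simp add: conj_op_def zp_mult_commute u_cj_u)
  moreover have "conj_op (zp 1 \<odot> conj_op x) = zp (- 1) \<odot> x"
    by (simp add: conj_op_def zp_mult_commute)
  ultimately show ?thesis
    using assms by (simp add: W_def shift_eq conj_op_diff conj_op_scale bshift_def mult_diff_right mult_scale_right)
qed

lemma W_W: "x \<in> Ksp \<Longrightarrow> W (W x) = x - cip x (zp 0) *\<^sub>C k0"
  using conj_shift_conj[of x] shift_bshift[of x] by (simp add: W_def[of "W x"])

lemma W_k0: "W k0 = - u0 *\<^sub>C k0"
proof -
  have "cip kt kt = 1 - cnj u0 * u0"
    using cip_conj_op[of k0 k0] by (simp add: conj_op_k0 cip_k0 k0_0)
  then show ?thesis
    by (intro l2_eqI) (simp add: W_def conj_op_k0 shift_eq, simp add: kt_def cip_simps k0_def algebra_simps)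
qed

lemma perp_k0:
  assumes "x \<in> Ksp" "\<And>f. f \<in> Ksp \<Longrightarrow> cip f (zp 0) = 0 \<Longrightarrow> cip f x = 0"
  obtains c where "x = c *\<^sub>C k0"
proof -
  let ?c = "cip x (zp 0) / cip k0 (zp 0)"
  let ?y = "x - ?c *\<^sub>C k0"
  have y: "?y \<in> Ksp" "cip ?y (zp 0) = 0" using assms(1) k0_0_nonzero by (auto simp: cip_simps)
  then have "cip ?y ?y = 0" using assms(2)[of ?y] by (simp add: cip_diff_right[of ?y] cip_k0)
  then show ?thesis using that by simp
qed

end

section \<open>Truncated Toeplitz operators\<close>

context model_space
begin

definition bop :: "(l2 \<Rightarrow> l2) \<Rightarrow> bool" where
  "bop T \<longleftrightarrow> (\<forall>x\<in>Ksp. T x \<in> Ksp) \<and> (\<forall>x\<in>Ksp. \<forall>y\<in>Ksp. T (x + y) = T x + T y) \<and>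
     (\<forall>c. \<forall>x\<in>Ksp. T (c *\<^sub>C x) = c *\<^sub>C T x) \<and> (\<exists>M. \<forall>x\<in>Ksp. norm (T x) \<le> M * norm x)"

definition toep :: "l2 \<Rightarrow> (l2 \<Rightarrow> l2) \<Rightarrow> bool" where
  "toep \<rho> T \<longleftrightarrow> bop T \<and> (\<forall>f\<in>Kb. \<forall>g\<in>Kb. cip (T f) g = cip (\<rho> \<odot> f) g)"

definition sym_eq :: "l2 \<Rightarrow> l2 \<Rightarrow> bool" (infix "\<simeq>" 50) where
  "\<rho> \<simeq> \<rho>' \<longleftrightarrow> (\<forall>f\<in>Kb. \<forall>g\<in>Kb. cip (\<rho> \<odot> f) g = cip (\<rho>' \<odot> f) g)"

lemma bop_in: "bop T \<Longrightarrow> x \<in> Ksp \<Longrightarrow> T x \<in> Ksp"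
  and bop_add: "bop T \<Longrightarrow> x \<in> Ksp \<Longrightarrow> y \<in> Ksp \<Longrightarrow> T (x + y) = T x + T y"
  and bop_scale: "bop T \<Longrightarrow> x \<in> Ksp \<Longrightarrow> T (c *\<^sub>C x) = c *\<^sub>C T x"
  by (auto simp: bop_def)

lemma bop_diff: "bop T \<Longrightarrow> x \<in> Ksp \<Longrightarrow> y \<in> Ksp \<Longrightarrow> T (x - y) = T x - T y"
  using bop_add[of T "x - y" y] by (simp add: eq_diff_eq)

lemma bop_bound:
  assumes "bop T" obtains M where "M \<ge> 0" "\<And>x. x \<in> Ksp \<Longrightarrow> norm (T x) \<le> M * norm x"
proof -
  obtain M where M: "\<And>x. x \<in> Ksp \<Longrightarrow> norm (T x) \<le> M * norm x"
    using assms unfolding bop_def by blast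
  have "norm (T x) \<le> \<bar>M\<bar> * norm x" if "x \<in> Ksp" for x
    using M[OF that] by (meson abs_ge_self mult_right_mono norm_ge_zero order_trans)
  then show ?thesis using that[of "\<bar>M\<bar>"] by auto
qed

lemma bop_tendsto:
  assumes "bop T" "\<And>n::nat. s n \<in> Ksp" "x \<in> Ksp" "s \<longlonglongrightarrow> x"
  shows "(\<lambda>n. T (s n)) \<longlonglongrightarrow> T x"
proof -
  obtain M where M: "M \<ge> 0" "\<And>x. x \<in> Ksp \<Longrightarrow> norm (T x) \<le> M * norm x"
    using bop_bound[OF assms(1)] by blast
  have "(\<lambda>n. T (s n) - T x) \<longlonglongrightarrow> 0"
  proof (rule Lim_null_comparison)
    show "\<forall>\<^sub>F n in sequentially. norm (T (s n) - T x) \<le> M * norm (s n - x)"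
      using M(2)[of "s _ - x"] assms by (simp add: bop_diff)
    have "(\<lambda>n. M * norm (s n - x)) \<longlonglongrightarrow> M * norm (x - x)"
      by (intro tendsto_intros assms)
    then show "(\<lambda>n. M * norm (s n - x)) \<longlonglongrightarrow> 0" by simp
  qed
  then show ?thesis by (simp add: LIM_zero_iff)
qed

lemma bop_compose:
  assumes "bop S" "bop T" shows "bop (S \<circ> T)"
proof -
  obtain M where M: "M \<ge> 0" "\<And>x. x \<in> Ksp \<Longrightarrow> norm (S x) \<le> M * norm x"
    using bop_bound[OF assms(1)] by blast
  obtain N where N: "N \<ge> 0" "\<And>x. x \<in> Ksp \<Longrightarrow> norm (T x) \<le> N * norm x"
    using bop_bound[OF assms(2)] by blast
  have "norm (S (T x)) \<le> (M * N) * norm x" if "x \<in> Ksp" for x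
  proof -
    have "norm (S (T x)) \<le> M * norm (T x)" by (rule M(2)[OF bop_in[OF assms(2) that]])
    also have "\<dots> \<le> M * (N * norm x)" using that M N by (intro mult_left_mono) auto
    finally show ?thesis by (simp add: mult.assoc)
  qed
  then have "\<exists>M. \<forall>x\<in>Ksp. norm ((S \<circ> T) x) \<le> M * norm x" by auto
  moreover have "(S \<circ> T) x \<in> Ksp" if "x \<in> Ksp" for x
    using bop_in[OF assms(1)] bop_in[OF assms(2)] that by simp
  moreover have "(S \<circ> T) (x + y) = (S \<circ> T) x + (S \<circ> T) y" if "x \<in> Ksp" "y \<in> Ksp" for x y
    using bop_add[OF assms(1)] bop_add[OF assms(2)] bop_in[OF assms(2)] that by simp
  moreover have "(S \<circ> T) (c *\<^sub>C x) = c *\<^sub>C (S \<circ> T) x" if "x \<in> Ksp" for c x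
    using bop_scale[OF assms(1)] bop_scale[OF assms(2)] bop_in[OF assms(2)] that by simp
  ultimately show ?thesis unfolding bop_def by blast
qed

lemma toep_bop: "toep \<rho> T \<Longrightarrow> bop T"
  by (simp add: toep_def)

lemma toepD:
  assumes "toep \<rho> T" "f \<in> Kb" "g \<in> Ksp"
  shows "cip (T f) g = cip (\<rho> \<odot> f) g"
  by (rule Kb_dense_eq[OF assms(3)])
    (use assms in \<open>auto intro!: tendsto_cip_right simp: toep_def\<close>)

lemma toep_sym_eq: "toep \<rho> T \<Longrightarrow> \<rho> \<simeq> \<rho>' \<Longrightarrow> toep \<rho>' T"
  by (auto simp: toep_def sym_eq_def)

lemma toep_unique:
  assumes "toep \<rho> T" "toep \<rho> T'" "x \<in> Ksp"
  shows "T x = T' x"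
proof (rule Kb_dense_eqI)
  have b: "bop T" "bop T'" using assms by (auto simp: toep_def)
  then show "T x \<in> Ksp" "T' x \<in> Ksp" using assms by (simp_all add: bop_in)
  fix k assume k: "k \<in> Kb"
  show "cip (T x) k = cip (T' x) k"
  proof (rule Kb_dense_eq[OF assms(3)])
    show "cip (T x) k = cip (T' x) k" if "x \<in> Kb" for x
      using assms(1,2) k that by (simp add: toep_def)
  qed (rule tendsto_cip_left, rule bop_tendsto; use b assms(3) in blast)+
qed

lemma sym_eq_refl [simp]: "\<rho> \<simeq> \<rho>"
  and sym_eq_sym: "\<rho> \<simeq> \<rho>' \<Longrightarrow> \<rho>' \<simeq> \<rho>"
  and sym_eq_trans [trans]: "\<rho> \<simeq> \<rho>' \<Longrightarrow> \<rho>' \<simeq> \<rho>'' \<Longrightarrow> \<rho> \<simeq> \<rho>''"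
  by (auto simp: sym_eq_def)

lemma sym_eq_add: "\<rho> \<simeq> \<rho>' \<Longrightarrow> \<sigma> \<simeq> \<sigma>' \<Longrightarrow> \<rho> + \<sigma> \<simeq> \<rho>' + \<sigma>'"
  by (simp add: sym_eq_def mult_add_left Kb_D cip_simps)

lemma sym_eq_scale: "\<rho> \<simeq> \<rho>' \<Longrightarrow> c *\<^sub>C \<rho> \<simeq> c *\<^sub>C \<rho>'"
  by (simp add: sym_eq_def mult_scale_left)

lemma cip_cj_mult: "bd f \<Longrightarrow> bd g \<Longrightarrow> cip (cj \<rho> \<odot> f) g = cnj (cip (\<rho> \<odot> g) f)"
  using cip_mult_adj_unbounded[of f g "cj \<rho>"] cip_commute[of f "\<rho> \<odot> g"] by simp

lemma sym_eq_cj: "\<rho> \<simeq> \<rho>' \<Longrightarrow> cj \<rho> \<simeq> cj \<rho>'"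
  by (simp add: sym_eq_def cip_cj_mult Kb_D)

lemma sym_eq_u_Hardy:
  assumes "h \<in> Hardy" shows "u \<odot> h \<simeq> 0"
  unfolding sym_eq_def
proof (intro ballI)
  fix f g assume fg: "f \<in> Kb" "g \<in> Kb"
  have "u \<odot> h \<odot> f = u \<odot> (h \<odot> f)"
    using fg by (metis Kb_D(2) bd_u mult_assoc mult_commute)
  moreover have "h \<odot> f \<in> Hardy" using assms fg by (auto intro: Hardy_mult Kb_D Ksp_Hardy)
  ultimately show "cip (u \<odot> h \<odot> f) g = cip (0 \<odot> f) g"
    using fg by (simp add: Ksp_u Kb_D)
qed

lemma sym_eq_k0: "k0 \<simeq> zp 0" "cj k0 \<simeq> zp 0"
proof -
  have "k0 = zp 0 + (- cnj u0) *\<^sub>C (u \<odot> zp 0)"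
    by (simp add: k0_def flip: uminus_scaleC)
  also have "\<dots> \<simeq> zp 0 + (- cnj u0) *\<^sub>C 0"
    by (intro sym_eq_add sym_eq_scale sym_eq_u_Hardy) auto
  finally show *: "k0 \<simeq> zp 0" by simp
  show "cj k0 \<simeq> zp 0" using sym_eq_cj[OF *] by simp
qed

lemma symbol_decomposition:
  obtains \<psi> \<eta> where "\<psi> \<in> Ksp" "\<eta> \<in> Ksp" "\<rho> \<simeq> \<psi> + cj \<eta>"
proof -
  define y where "y = cj (\<rho> - Hproj \<rho>)"
  have y: "y \<in> Hardy"
    unfolding Hardy_def y_def
  proof (intro CollectI allI impI)
    fix n :: int assume "n < 0"
    have "cip (cj (\<rho> - Hproj \<rho>)) (cj (zp (- n))) = cip (zp (- n)) (\<rho> - Hproj \<rho>)"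
      by (rule cip_cj)
    also have "\<dots> = cnj (cip (\<rho> - Hproj \<rho>) (zp (- n)))" by (rule cip_commute)
    finally show "cip (cj (\<rho> - Hproj \<rho>)) (zp n) = 0"
      using \<open>n < 0\<close> by (simp add: cip_simps cip_Hproj_zp)
  qed
  have P: "h \<simeq> Kproj h" if "h \<in> Hardy" for h
  proof -
    have "h = Kproj h + u \<odot> Hproj (cj u \<odot> h)"
      using that by (simp add: Kproj_def Hproj_Hardy)
    also have "\<dots> \<simeq> Kproj h + 0"
      by (intro sym_eq_add sym_eq_u_Hardy) auto
    finally show ?thesis by simp
  qed
  have "\<rho> = Hproj \<rho> + cj y" by (simp add: y_def)
  also have "\<dots> \<simeq> Kproj (Hproj \<rho>) + cj (Kproj y)"
    by (intro sym_eq_add sym_eq_cj P y) auto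
  finally show ?thesis by (intro that[of "Kproj (Hproj \<rho>)" "Kproj y"]) auto
qed

lemma cip_cj_Hardy_left: "x \<in> Hardy \<Longrightarrow> y \<in> Hardy \<Longrightarrow> cip (cj x) y = cnj (cip x (zp 0) * cip y (zp 0))"
  using cip_cj_Hardy[of x y] cip_commute[of "cj x" y] cip_cj_right[of y x] by simp

lemma symbol_form:
  assumes "\<psi> \<in> Hardy" "\<eta> \<in> Hardy" and f: "f \<in> Hardy" "bd f" and g: "g \<in> Hardy" "bd g"
  shows "cip ((\<psi> + cj \<eta>) \<odot> f) g - cip ((\<psi> + cj \<eta>) \<odot> bshift f) (bshift g)
    = cip f (zp 0) * cip \<psi> g + cnj (cip g (zp 0)) * cip f \<eta>"
proof -
  define \<rho> where "\<rho> = \<psi> + cj \<eta>"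
  let ?F = "f - cip f (zp 0) *\<^sub>C zp 0" and ?G = "g - cip g (zp 0) *\<^sub>C zp 0"
  have "cip (\<rho> \<odot> bshift f) (bshift g) = cip (\<rho> \<odot> ?F) ?G"
    using f by (simp add: bshift_def mult_zp_assoc)
  also have "\<rho> \<odot> ?F = \<rho> \<odot> f - cip f (zp 0) *\<^sub>C \<rho>"
    using f by (simp add: mult_diff_right_bd mult_scale_right)
  finally have 1: "cip (\<rho> \<odot> bshift f) (bshift g) = cip (\<rho> \<odot> f) g - cip f (zp 0) * cip \<rho> g
      - cnj (cip g (zp 0)) * cip (\<rho> \<odot> f) (zp 0) + cip f (zp 0) * cnj (cip g (zp 0)) * cip \<rho> (zp 0)"
    by (simp add: cip_simps algebra_simps)
  have 2: "cip \<rho> g = cip \<psi> g + cnj (cip \<eta> (zp 0) * cip g (zp 0))"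
    using assms by (simp add: \<rho>_def cip_simps cip_cj_Hardy_left)
  have 3: "cip (\<rho> \<odot> f) (zp 0) = cip \<psi> (zp 0) * cip f (zp 0) + cip f \<eta>"
    using f assms(1) by (simp add: \<rho>_def mult_add_left cip_simps cip_mult_right_adj cip_cj_Hardy)
  have 4: "cip \<rho> (zp 0) = cip \<psi> (zp 0) + cnj (cip \<eta> (zp 0))"
    using cip_cj_left[of \<eta> "zp 0"] cip_commute[of "zp 0" \<eta>] by (simp add: \<rho>_def cip_simps)
  show ?thesis
    unfolding \<rho>_def[symmetric] 1 2 3 4 by (simp add: algebra_simps)
qed

lemma toep_form:
  assumes T: "toep (\<psi> + cj \<eta>) T" and "\<psi> \<in> Hardy" "\<eta> \<in> Hardy" and f: "f \<in> Ksp" and g: "g \<in> Ksp"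
  shows "cip (T f) g - cip (T (bshift f)) (bshift g)
    = cip f (zp 0) * cip \<psi> g + cnj (cip g (zp 0)) * cip f \<eta>"
proof (rule Kb_dense_eq[OF f])
  have b: "bop T" using T by (rule toep_bop)
  fix f assume f: "f \<in> Kb"
  show "cip (T f) g - cip (T (bshift f)) (bshift g)
    = cip f (zp 0) * cip \<psi> g + cnj (cip g (zp 0)) * cip f \<eta>"
  proof (rule Kb_dense_eq[OF g])
    fix g assume g: "g \<in> Kb"
    show "cip (T f) g - cip (T (bshift f)) (bshift g)
      = cip f (zp 0) * cip \<psi> g + cnj (cip g (zp 0)) * cip f \<eta>"
      using symbol_form[OF assms(2,3), of f g] f g T by (simp add: toepD Kb_D Ksp_Hardy)
  next
    fix s assume s: "\<And>n::nat. s n \<in> Ksp" "s \<longlonglongrightarrow> g"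
    show "(\<lambda>n. cip (T f) (s n) - cip (T (bshift f)) (bshift (s n)))
        \<longlonglongrightarrow> cip (T f) g - cip (T (bshift f)) (bshift g)"
      by (intro tendsto_diff tendsto_cip_right tendsto_bshift s(2))
    show "(\<lambda>n. cip f (zp 0) * cip \<psi> (s n) + cnj (cip (s n) (zp 0)) * cip f \<eta>)
        \<longlonglongrightarrow> cip f (zp 0) * cip \<psi> g + cnj (cip g (zp 0)) * cip f \<eta>"
      by (intro tendsto_add tendsto_mult tendsto_const tendsto_cnj tendsto_cip_both s(2))
  qed
next
  have b: "bop T" using T by (rule toep_bop)
  fix s assume s: "\<And>n::nat. s n \<in> Ksp" "s \<longlonglongrightarrow> f"
  then show "(\<lambda>n. cip (T (s n)) g - cip (T (bshift (s n))) (bshift g))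
      \<longlonglongrightarrow> cip (T f) g - cip (T (bshift f)) (bshift g)"
    using f by (intro tendsto_diff tendsto_cip_left bop_tendsto[OF b] tendsto_bshift) auto
  show "(\<lambda>n. cip (s n) (zp 0) * cip \<psi> g + cnj (cip g (zp 0)) * cip (s n) \<eta>)
      \<longlonglongrightarrow> cip f (zp 0) * cip \<psi> g + cnj (cip g (zp 0)) * cip f \<eta>"
    using s by (intro tendsto_intros tendsto_cip_left)
qed

lemma mult_zp_u: "x \<odot> (zp (- 1) \<odot> u) = u \<odot> bshift x + cip x (zp 0) *\<^sub>C (zp (- 1) \<odot> u)"
proof -
  let ?v = "zp (- 1) \<odot> u"
  have "x = zp 1 \<odot> bshift x + cip x (zp 0) *\<^sub>C zp 0" by (simp add: zp_bshift)
  then have "x \<odot> ?v = (zp 1 \<odot> bshift x + cip x (zp 0) *\<^sub>C zp 0) \<odot> ?v" by simp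
  also have "\<dots> = zp 1 \<odot> bshift x \<odot> ?v + cip x (zp 0) *\<^sub>C ?v"
    by (simp add: mult_add_left mult_scale_left)
  also have "zp 1 \<odot> bshift x \<odot> ?v = ?v \<odot> zp 1 \<odot> bshift x"
    by (metis bd_mult bd_u bd_zp mult_assoc mult_commute)
  also have "?v \<odot> zp 1 = u" using zp_zp_mult[of 1 "- 1" u] by (simp add: mult_commute)
  finally show ?thesis .
qed

lemma toep_kt_left:
  assumes T: "toep (\<psi> + cj \<eta>) T" and \<psi>: "\<psi> \<in> Hardy" and \<eta>: "\<eta> \<in> Hardy" and x: "x \<in> Ksp"
  shows "cip (T x) kt + cnj u0 * cip (zp 1 \<odot> x) \<eta> = cip x (conj_op \<psi>) + cnj (cip \<eta> (zp 0)) * cip x kt"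
proof (rule Kb_dense_eq[OF x])
  have b: "bop T" using T by (rule toep_bop)
  fix s assume s: "\<And>n::nat. s n \<in> Ksp" "s \<longlonglongrightarrow> x"
  then show "(\<lambda>n. cip (T (s n)) kt + cnj u0 * cip (zp 1 \<odot> s n) \<eta>)
      \<longlonglongrightarrow> cip (T x) kt + cnj u0 * cip (zp 1 \<odot> x) \<eta>"
    using x by (intro tendsto_intros tendsto_cip_left bop_tendsto[OF b] tendsto_zp_mult) auto
  show "(\<lambda>n. cip (s n) (conj_op \<psi>) + cnj (cip \<eta> (zp 0)) * cip (s n) kt)
      \<longlonglongrightarrow> cip x (conj_op \<psi>) + cnj (cip \<eta> (zp 0)) * cip x kt"
    using s by (intro tendsto_intros tendsto_cip_left)
next
  fix x assume x: "x \<in> Kb"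
  then have xK: "x \<in> Ksp" and bx: "bd x" by (auto dest: Kb_D)
  let ?v = "zp (- 1) \<odot> u"
  have "cip (T x) kt = cip ((\<psi> + cj \<eta>) \<odot> x) kt" using T x by (simp add: toepD)
  also have "\<dots> = cip (\<psi> \<odot> x) ?v - cnj u0 * cip (\<psi> \<odot> x) (zp (- 1))
     + cip (cj \<eta> \<odot> x) ?v - cnj u0 * cip (cj \<eta> \<odot> x) (zp (- 1))"
    using bx by (simp add: kt_alt mult_add_left cip_simps algebra_simps)
  also have "cip (\<psi> \<odot> x) (zp (- 1)) = 0"
    using Hardy_mult[OF \<psi> Ksp_Hardy[OF xK] bx] by (simp add: Hardy_def)
  also have "cip (\<psi> \<odot> x) ?v = cip x (conj_op \<psi>)"
    using bx by (simp add: cip_mult_adj_unbounded conj_op_def)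
      (metis bd_u bd_zp mult_assoc mult_commute)
  also have "cip (cj \<eta> \<odot> x) (zp (- 1)) = cip (zp 1 \<odot> x) \<eta>"
    using bx by (simp add: cip_mult_adj_unbounded cip_zp_mult_left mult_commute[of \<eta>])
  also have "cip (cj \<eta> \<odot> x) ?v = cnj (cip \<eta> (zp 0)) * cip x kt"
  proof -
    have "cip x (\<eta> \<odot> ?v) = cnj (cip \<eta> (zp 0)) * cip x ?v"
      using xK \<eta> by (simp add: mult_zp_u cip_simps Ksp_u)
    moreover have "cip x ?v = cip x kt" using xK by (simp add: kt_alt cip_simps)
    ultimately show ?thesis using bx by (simp add: cip_mult_adj_unbounded)
  qed
  finally show "cip (T x) kt + cnj u0 * cip (zp 1 \<odot> x) \<eta> = cip x (conj_op \<psi>) + cnj (cip \<eta> (zp 0)) * cip x kt"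
    by simp
qed

lemma cip_toep_conj:
  assumes T: "toep \<rho> T" and f: "f \<in> Ksp" and g: "g \<in> Ksp"
  shows "cip (T f) g = cip f (conj_op (T (conj_op g)))"
proof (rule Kb_dense_eq[OF f])
  have b: "bop T" using T by (rule toep_bop)
  fix f assume f: "f \<in> Kb"
  show "cip (T f) g = cip f (conj_op (T (conj_op g)))"
  proof (rule Kb_dense_eq[OF g])
    fix g assume g: "g \<in> Kb"
    have v: "bd (u \<odot> zp (- 1))" by simp
    have bf: "bd f" "bd g" using f g by (auto dest: Kb_D)
    have c: "conj_op x = cj x \<odot> (u \<odot> zp (- 1))" if "bd x" for x
      using that unfolding conj_op_def by (metis bd_u bd_zp bd_cj mult_assoc mult_commute)
    have vv: "(cj x \<odot> (u \<odot> zp (- 1))) \<odot> cj (u \<odot> zp (- 1)) = cj x" for x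
    proof -
      have "(u \<odot> zp (- 1)) \<odot> cj (u \<odot> zp (- 1)) = zp 0"
        by (simp add: mult_commute[of u] zp_mult_commute u_cj_u flip: mult_assoc)
          (metis add.commute add.right_inverse bd_cj bd_u bd_zp mult_assoc mult_commute u_cj_u zp_mult_zp zp_zp_mult mult_zp_0)
      then show ?thesis by (subst mult_assoc) auto
    qed
    have "cip f (conj_op (T (conj_op g))) = cip (T (conj_op g)) (conj_op f)"
      using cip_conj_op[of "conj_op f" "T (conj_op g)"] by simp
    also have "\<dots> = cip (\<rho> \<odot> conj_op g) (conj_op f)"
      using T f g by (simp add: toepD Kb_D)
    also have "\<rho> \<odot> conj_op g = (\<rho> \<odot> cj g) \<odot> (u \<odot> zp (- 1))"
      using bf v by (simp add: c mult_assoc)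
    also have "cip \<dots> (conj_op f) = cip (\<rho> \<odot> cj g) (cj f)"
      using bf v vv[of f] c[of f] by (simp add: cip_mult_right_adj mult_commute[of "cj (u \<odot> zp (- 1))"] del: cj_mult)
    also have "\<dots> = cip (cj g) (cj (\<rho> \<odot> f))"
      using bf by (simp add: cip_mult_adj_unbounded)
    also have "\<dots> = cip (\<rho> \<odot> f) g" by (rule cip_cj)
    also have "\<dots> = cip (T f) g" using T f g by (simp add: toepD Kb_D)
    finally show "cip (T f) g = cip f (conj_op (T (conj_op g)))" ..
  next
    fix s assume s: "\<And>n::nat. s n \<in> Ksp" "s \<longlonglongrightarrow> g"
    then show "(\<lambda>n. cip (T f) (s n)) \<longlonglongrightarrow> cip (T f) g"
      by (intro tendsto_cip_right)
    show "(\<lambda>n. cip f (conj_op (T (conj_op (s n))))) \<longlonglongrightarrow> cip f (conj_op (T (conj_op g)))"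
      using s g by (intro tendsto_cip_right tendsto_conj_op bop_tendsto[OF b]) auto
  qed
next
  have b: "bop T" using T by (rule toep_bop)
  fix s assume s: "\<And>n::nat. s n \<in> Ksp" "s \<longlonglongrightarrow> f"
  then show "(\<lambda>n. cip (T (s n)) g) \<longlonglongrightarrow> cip (T f) g"
    using f by (intro tendsto_cip_left bop_tendsto[OF b]) auto
  show "(\<lambda>n. cip (s n) (conj_op (T (conj_op g)))) \<longlonglongrightarrow> cip f (conj_op (T (conj_op g)))"
    using s by (intro tendsto_cip_left)
qed

lemma toep_kt_right:
  assumes T: "toep (\<psi> + cj \<eta>) T" and \<psi>: "\<psi> \<in> Hardy" and \<eta>: "\<eta> \<in> Hardy" and y: "y \<in> Ksp"
  shows "cip (T kt) y + u0 * cip \<psi> (zp 1 \<odot> y) = cip (conj_op \<eta>) y + cip \<psi> (zp 0) * cip kt y"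
proof -
  have by': "y \<in> Hardy" using y by (rule Ksp_Hardy)
  let ?v = "zp (- 1) \<odot> u"
  have "cip (T kt) y = cip ((\<psi> + cj \<eta>) \<odot> kt) y" using T y by (simp add: toepD)
  also have "(\<psi> + cj \<eta>) \<odot> kt = \<psi> \<odot> ?v - u0 *\<^sub>C (\<psi> \<odot> zp (- 1)) + cj \<eta> \<odot> ?v - u0 *\<^sub>C (cj \<eta> \<odot> zp (- 1))"
    by (simp add: kt_alt mult_add_left mult_diff_left mult_diff_right_bd mult_scale_right scaleC_add_right)
  also have "cip \<dots> y = cip (\<psi> \<odot> ?v) y - u0 * cip (\<psi> \<odot> zp (- 1)) y + cip (cj \<eta> \<odot> ?v) y - u0 * cip (cj \<eta> \<odot> zp (- 1)) y"
    by (simp add: cip_simps)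
  also have "cip (\<psi> \<odot> zp (- 1)) y = cip \<psi> (zp 1 \<odot> y)"
    by (simp add: cip_mult_right_adj)
  also have "cip (cj \<eta> \<odot> zp (- 1)) y = 0"
    by (simp add: mult_commute[of "cj \<eta>"]) (rule Hardy_perp(2)[OF by' Hardy_cj_neg[OF \<eta>]])
  also have "cj \<eta> \<odot> ?v = conj_op \<eta>"
    unfolding conj_op_def by (metis bd_u bd_zp mult_assoc mult_commute)
  also have "cip (\<psi> \<odot> ?v) y = cip \<psi> (zp 0) * cip kt y"
  proof -
    have "cip (\<psi> \<odot> ?v) y = cip \<psi> (zp 0) * cip ?v y"
      using y \<psi> by (simp add: mult_zp_u cip_simps Ksp_u)
    moreover have "cip ?v y = cip kt y" using y by (simp add: kt_alt cip_simps)
    ultimately show ?thesis by simp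
  qed
  finally show ?thesis by simp
qed

lemma product_form:
  assumes T1: "toep (\<psi>1 + cj \<eta>1) T1" and T2: "toep (\<psi>2 + cj \<eta>2) T2"
    and K: "\<psi>1 \<in> Ksp" "\<eta>1 \<in> Ksp" "\<psi>2 \<in> Ksp" "\<eta>2 \<in> Ksp"
    and f: "f \<in> Ksp" "cip f (zp 0) = 0" and g: "g \<in> Ksp" "cip g (zp 0) = 0"
  shows "cip (T1 (T2 f)) g - cip (T1 (T2 (bshift f))) (bshift g)
    = cip f \<eta>2 * cip \<psi>1 g - cip f (W \<psi>2) * cip (W \<eta>1) g"
proof -
  have H: "\<psi>1 \<in> Hardy" "\<eta>1 \<in> Hardy" "\<psi>2 \<in> Hardy" "\<eta>2 \<in> Hardy"
    using K by (auto intro: Ksp_Hardy)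
  have b1: "bop T1" and b2: "bop T2" using T1 T2 by (auto intro: toep_bop)
  let ?f = "bshift f" and ?g = "bshift g"
  have fg: "?f \<in> Ksp" "?g \<in> Ksp" "zp 1 \<odot> ?f = f" "zp 1 \<odot> ?g = g"
    using f g by (auto simp: zp_bshift_0)
  have T2f: "T2 ?f \<in> Ksp" "T2 f \<in> Ksp" using b2 fg f by (auto intro: bop_in)
  define p where "p = cip (T2 ?f) kt + cnj u0 * cip f \<eta>2"
  have A: "T2 f = shift (T2 ?f) + cip f \<eta>2 *\<^sub>C k0"
  proof (rule Ksp_eqI)
    fix k assume k: "k \<in> Ksp"
    show "cip (T2 f) k = cip (shift (T2 ?f) + cip f \<eta>2 *\<^sub>C k0) k"
      using toep_form[OF T2 H(3,4) f(1) k] f k T2f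
      by (simp add: cip_simps cip_shift_left cip_k0_left algebra_simps)
  qed (use T2f in auto)
  have B: "bshift (T2 f) = T2 ?f - p *\<^sub>C kt"
    unfolding A using T2f
    by (simp add: bshift_add bshift_scale bshift_shift bshift_k0 p_def scaleC_add_left)
      (simp add: mult.commute)
  have C: "cip (T2 f) (zp 0) = - u0 * p + cip f \<eta>2"
    unfolding A using T2f by (simp add: cip_simps shift_0 k0_0 p_def algebra_simps)
  have D: "T1 (bshift (T2 f)) = T1 (T2 ?f) - p *\<^sub>C T1 kt"
    unfolding B using b1 T2f by (simp add: bop_diff bop_scale)
  have "cip kt ?g = 0" using cip_kt_bshift[OF g(1)] g(2) cip_commute[of kt ?g] by simp
  then have q: "cip (T1 kt) ?g = cip (conj_op \<eta>1) ?g - u0 * cip \<psi>1 g"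
    using toep_kt_right[OF T1 H(1,2) fg(2)] fg by (simp add: algebra_simps)
  have "cip ?f kt = 0" using cip_kt_bshift[OF f(1)] f(2) by simp
  then have p: "p = cip ?f (conj_op \<psi>2)"
    using toep_kt_left[OF T2 H(3,4) fg(1)] fg by (simp add: p_def)
  have "cip ?f (conj_op \<psi>2) = cip f (W \<psi>2)" "cip (conj_op \<eta>1) ?g = cip (W \<eta>1) g"
    using f g K by (simp_all add: W_def cip_shift_left cip_shift_right)
  then show ?thesis
    using toep_form[OF T1 H(1,2) T2f(2) g(1)] g(2)
    unfolding D C by (simp add: cip_simps q p algebra_simps)
qed

text \<open>The sufficient half of Sarason's theorem. The symbol \<open>\<rho>\<close> is read off from the rank two operator
  \<open>X - S X S\<^sup>*\<close>; the form of \<open>X - A\<^sub>\<rho>\<close> is then invariant under \<open>S\<^sup>*\<close>, and it vanishes because its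
  iterates tend to \<open>0\<close> even though \<open>\<rho>\<close> may be unbounded.\<close>

lemma toep_of_shift_invariant:
  assumes X: "bop X" and X': "\<And>x. x \<in> Ksp \<Longrightarrow> X' x \<in> Ksp"
    and adj: "\<And>x y. x \<in> Ksp \<Longrightarrow> y \<in> Ksp \<Longrightarrow> cip (X x) y = cip x (X' y)"
    and inv: "\<And>f g. f \<in> Ksp \<Longrightarrow> g \<in> Ksp \<Longrightarrow> cip f (zp 0) = 0 \<Longrightarrow> cip g (zp 0) = 0
       \<Longrightarrow> cip (X f) g = cip (X (bshift f)) (bshift g)"
  shows "\<exists>\<rho>. toep \<rho> X"
proof -
  define R where "R f g = cip (X f) g - cip (X (bshift f)) (bshift g)" for f g
  define \<kappa> where "\<kappa> = cip k0 (zp 0)"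
  have \<kappa>: "\<kappa> \<noteq> 0" "cnj \<kappa> = \<kappa>"
    using k0_0_nonzero by (simp_all add: \<kappa>_def) (simp add: k0_0)
  have XK: "X x \<in> Ksp" if "x \<in> Ksp" for x using X that by (rule bop_in)
  define \<psi> where "\<psi> = (1 / \<kappa>) *\<^sub>C (X k0 - shift (X (bshift k0)))"
  define \<eta> where "\<eta> = (1 / \<kappa>) *\<^sub>C (X' k0 - shift (X' (bshift k0))) - cnj (R k0 k0 / \<kappa>\<^sup>2) *\<^sub>C k0"
  have \<psi>: "\<psi> \<in> Ksp" and \<eta>: "\<eta> \<in> Ksp" by (simp_all add: \<psi>_def \<eta>_def XK X')
  have R\<psi>: "cip \<psi> g = R k0 g / \<kappa>" if "g \<in> Ksp" for g
    using that by (simp add: \<psi>_def R_def cip_simps cip_shift_left XK diff_divide_distrib)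
  have R\<eta>: "cip f \<eta> = R f k0 / \<kappa> - cip f (zp 0) * R k0 k0 / \<kappa>\<^sup>2" if "f \<in> Ksp" for f
  proof -
    have "cip f (X' k0 - shift (X' (bshift k0))) = R f k0"
      using that by (simp add: R_def cip_simps cip_shift_right X' adj)
    then show ?thesis using that \<kappa> by (simp add: \<eta>_def cip_diff_right[of f "(1 / \<kappa>) *\<^sub>C _"] cip_k0)
  qed
  have RR: "R f g = cip f (zp 0) * cip \<psi> g + cnj (cip g (zp 0)) * cip f \<eta>"
    if f: "f \<in> Ksp" and g: "g \<in> Ksp" for f g
  proof -
    define s where "s = cip f (zp 0) / \<kappa>"
    define t where "t = cip g (zp 0) / \<kappa>"
    have "R (f - s *\<^sub>C k0) (g - t *\<^sub>C k0) = 0"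
      unfolding R_def using f g \<kappa>
      by (subst inv) (auto simp: cip_simps s_def t_def \<kappa>_def[symmetric])
    moreover have "R (f - s *\<^sub>C k0) (g - t *\<^sub>C k0) = R f g - s * R k0 g - cnj t * R f k0 + s * cnj t * R k0 k0"
      using f g X by (simp add: R_def bshift_diff bshift_scale bop_diff bop_scale cip_simps algebra_simps)
    ultimately have "R f g = s * R k0 g + cnj t * R f k0 - s * cnj t * R k0 k0"
      by (simp add: algebra_simps)
    also have "\<dots> = cip f (zp 0) * cip \<psi> g + cnj (cip g (zp 0)) * cip f \<eta>"
      using f g \<kappa> by (simp add: R\<psi> R\<eta> s_def t_def field_simps power2_eq_square)
    finally show ?thesis .
  qed
  define \<rho> where "\<rho> = \<psi> + cj \<eta>"
  have "cip (X f) g = cip (\<rho> \<odot> f) g" if f: "f \<in> Kb" and g: "g \<in> Kb" for f g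
  proof -
    have fK: "f \<in> Ksp" "f \<in> Hardy" "bd f" and gK: "g \<in> Ksp" "g \<in> Hardy" "bd g"
      using f g by (auto dest: Kb_D intro: Ksp_Hardy)
    define E where "E f g = cip (X f) g - cip (\<rho> \<odot> f) g" for f g
    have step: "E f g = E (bshift f) (bshift g)" if "f \<in> Kb" "g \<in> Kb" for f g
      using RR[of f g] symbol_form[of \<psi> \<eta> f g] that \<psi> \<eta>
      unfolding E_def R_def \<rho>_def[symmetric] by (simp add: Kb_D Ksp_Hardy algebra_simps)
    have E: "E f g = E ((bshift ^^ n) f) ((bshift ^^ n) g)" for n
      by (induction n) (use f g step in auto)
    define F where "F n = f - psum n f" for n
    define G where "G n = g - psum n g" for n
    have F0: "F \<longlonglongrightarrow> 0" and G0: "G \<longlonglongrightarrow> 0"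
      unfolding F_def G_def using psum_remainder_tendsto fK gK by auto
    have bF: "bd (F n)" "bd (G n)" for n using fK gK by (simp_all add: F_def G_def)
    have zF: "F n = zp (int n) \<odot> (bshift ^^ n) f" "G n = zp (int n) \<odot> (bshift ^^ n) g" for n
      by (simp_all add: F_def G_def bshift_funpow)
    have lim1: "(\<lambda>n. cip (X ((bshift ^^ n) f)) ((bshift ^^ n) g)) \<longlonglongrightarrow> 0"
    proof -
      obtain M where M: "M \<ge> 0" "\<And>x. x \<in> Ksp \<Longrightarrow> norm (X x) \<le> M * norm x"
        using bop_bound[OF X] by blast
      show ?thesis
      proof (rule Lim_null_comparison)
        have "norm (cip (X ((bshift ^^ n) f)) ((bshift ^^ n) g)) \<le> M * norm (F n) * norm (G n)" for n
        proof -
          have "norm (cip (X ((bshift ^^ n) f)) ((bshift ^^ n) g))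
              \<le> norm (X ((bshift ^^ n) f)) * norm ((bshift ^^ n) g)" by (rule cip_bound)
          also have "\<dots> \<le> (M * norm ((bshift ^^ n) f)) * norm ((bshift ^^ n) g)"
            using f by (intro mult_right_mono M Kb_D bshift_funpow_Kb) auto
          finally show ?thesis by (simp add: norm_bshift_funpow F_def G_def)
        qed
        then show "\<forall>\<^sub>F n in sequentially. norm (cip (X ((bshift ^^ n) f)) ((bshift ^^ n) g)) \<le> M * norm (F n) * norm (G n)"
          by simp
        have "(\<lambda>n. M * norm (F n) * norm (G n)) \<longlonglongrightarrow> M * norm (0::l2) * norm (0::l2)"
          by (intro tendsto_intros F0 G0)
        then show "(\<lambda>n. M * norm (F n) * norm (G n)) \<longlonglongrightarrow> 0" by simp
      qed
    qed
    have low: "cip (h \<odot> (zp (int n) \<odot> k)) (psum n y) = 0"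
      if "h \<in> Hardy" "k \<in> Hardy" "bd k" for h k n y
    proof -
      have "h \<odot> k \<in> Hardy" using that by (rule Hardy_mult)
      then have "cip (h \<odot> (zp (int n) \<odot> k)) (zp (int m)) = 0" if "m < n" for m
        using that \<open>bd k\<close> by (simp add: mult_zp_assoc cip_zp_mult_left Hardy_def)
      then show ?thesis by (simp add: psum_def cip_sum_right)
    qed
    have lim2: "(\<lambda>n. cip (\<psi> \<odot> F n) (G n)) \<longlonglongrightarrow> 0"
    proof -
      have "cip (\<psi> \<odot> F n) (G n) = cip (F n) (cj \<psi> \<odot> g)" for n
      proof -
        have "cip (\<psi> \<odot> F n) (psum n g) = 0"
          unfolding zF using \<psi> fK by (intro low) (auto intro: Ksp_Hardy)
        then have "cip (\<psi> \<odot> F n) (G n) = cip (\<psi> \<odot> F n) g"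
          by (simp add: G_def cip_simps)
        then show ?thesis using bF gK by (simp add: cip_mult_adj_unbounded)
      qed
      moreover have "(\<lambda>n. cip (F n) (cj \<psi> \<odot> g)) \<longlonglongrightarrow> cip 0 (cj \<psi> \<odot> g)"
        by (intro tendsto_cip_left F0)
      ultimately show ?thesis by simp
    qed
    have lim3: "(\<lambda>n. cip (cj \<eta> \<odot> F n) (G n)) \<longlonglongrightarrow> 0"
    proof -
      have "cip (cj \<eta> \<odot> F n) (G n) = cip (cj \<eta> \<odot> f) (G n)" for n
      proof -
        have "cip (\<eta> \<odot> G n) (psum n f) = 0"
          unfolding zF using \<eta> gK by (intro low) (auto intro: Ksp_Hardy)
        then have "cip (\<eta> \<odot> G n) (F n) = cip (\<eta> \<odot> G n) f"
          by (simp add: F_def cip_simps)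
        then show ?thesis using bF fK by (simp add: cip_cj_mult)
      qed
      moreover have "(\<lambda>n. cip (cj \<eta> \<odot> f) (G n)) \<longlonglongrightarrow> cip (cj \<eta> \<odot> f) 0"
        by (intro tendsto_cip_right G0)
      ultimately show ?thesis by simp
    qed
    have "cip (\<rho> \<odot> (bshift ^^ n) f) ((bshift ^^ n) g) = cip (\<psi> \<odot> F n) (G n) + cip (cj \<eta> \<odot> F n) (G n)" for n
    proof -
      have "cip (\<rho> \<odot> F n) (G n) = cip (\<rho> \<odot> (bshift ^^ n) f) ((bshift ^^ n) g)"
        unfolding zF using fK by (simp add: mult_zp_assoc)
      then show ?thesis using bF[of n] by (simp add: \<rho>_def mult_add_left cip_simps)
    qed
    then have "(\<lambda>n. E ((bshift ^^ n) f) ((bshift ^^ n) g)) \<longlonglongrightarrow> 0 - (0 + 0)"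
      unfolding E_def by (simp only:) (intro tendsto_intros lim1 lim2 lim3)
    then have "(\<lambda>n::nat. E f g) \<longlonglongrightarrow> 0" by (simp flip: E)
    then have "E f g = 0" by (rule LIMSEQ_unique[OF tendsto_const])
    then show ?thesis by (simp add: E_def)
  qed
  then have "toep \<rho> X" using X by (simp add: toep_def)
  then show ?thesis ..
qed

lemma toep_comp_iff:
  assumes T1: "toep (\<psi>1 + cj \<eta>1) T1" and T2: "toep (\<psi>2 + cj \<eta>2) T2"
    and K: "\<psi>1 \<in> Ksp" "\<eta>1 \<in> Ksp" "\<psi>2 \<in> Ksp" "\<eta>2 \<in> Ksp"
  shows "(\<exists>\<rho>. toep \<rho> (T1 \<circ> T2)) \<longleftrightarrow>
    (\<forall>f\<in>Ksp. \<forall>g\<in>Ksp. cip f (zp 0) = 0 \<longrightarrow> cip g (zp 0) = 0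
       \<longrightarrow> cip f \<eta>2 * cip \<psi>1 g = cip f (W \<psi>2) * cip (W \<eta>1) g)" (is "?L \<longleftrightarrow> ?R")
proof
  assume ?L
  then obtain \<rho> where \<rho>: "toep \<rho> (T1 \<circ> T2)" by blast
  obtain \<psi> \<eta> where *: "\<psi> \<in> Ksp" "\<eta> \<in> Ksp" "\<rho> \<simeq> \<psi> + cj \<eta>" by (rule symbol_decomposition)
  have t: "toep (\<psi> + cj \<eta>) (T1 \<circ> T2)" using \<rho> *(3) by (rule toep_sym_eq)
  show ?R
  proof (intro ballI impI)
    fix f g assume fg: "f \<in> Ksp" "g \<in> Ksp" "cip f (zp 0) = 0" "cip g (zp 0) = 0"
    show "cip f \<eta>2 * cip \<psi>1 g = cip f (W \<psi>2) * cip (W \<eta>1) g"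
      using toep_form[OF t _ _ fg(1,2)] product_form[OF T1 T2 K fg(1,3) fg(2,4)] * fg
      by (simp add: Ksp_Hardy)
  qed
next
  assume R: ?R
  have b1: "bop T1" and b2: "bop T2" using T1 T2 by (auto intro: toep_bop)
  let ?X' = "\<lambda>y. conj_op (T2 (T1 (conj_op y)))"
  show ?L
  proof (rule toep_of_shift_invariant[where X' = ?X'])
    show "bop (T1 \<circ> T2)" using b1 b2 by (rule bop_compose)
    show "?X' x \<in> Ksp" if "x \<in> Ksp" for x using that b1 b2 by (simp add: bop_in)
    show "cip ((T1 \<circ> T2) x) y = cip x (?X' y)" if "x \<in> Ksp" "y \<in> Ksp" for x y
    proof -
      have "cip (T1 (T2 x)) y = cip (T2 x) (conj_op (T1 (conj_op y)))"
        using that b2 by (intro cip_toep_conj[OF T1]) (auto intro: bop_in)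
      also have "\<dots> = cip x (conj_op (T2 (conj_op (conj_op (T1 (conj_op y))))))"
        using that b1 by (intro cip_toep_conj[OF T2]) (simp_all add: bop_in)
      finally show ?thesis by simp
    qed
    fix f g assume fg: "f \<in> Ksp" "g \<in> Ksp" "cip f (zp 0) = 0" "cip g (zp 0) = 0"
    show "cip ((T1 \<circ> T2) f) g = cip ((T1 \<circ> T2) (bshift f)) (bshift g)"
      using product_form[OF T1 T2 K fg(1,3) fg(2,4)] R fg by simp
  qed
qed

lemma toep_scalar:
  assumes T: "toep ((c *\<^sub>C k0) + cj (d *\<^sub>C k0)) T" and x: "x \<in> Ksp"
  shows "T x = (c + cnj d) *\<^sub>C x"
proof -
  have "(c *\<^sub>C k0) + cj (d *\<^sub>C k0) \<simeq> c *\<^sub>C zp 0 + cnj d *\<^sub>C zp 0"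
    unfolding cj_scale by (intro sym_eq_add sym_eq_scale sym_eq_k0)
  from toep_sym_eq[OF T this] have t: "toep ((c + cnj d) *\<^sub>C zp 0) T"
    by (simp add: scaleC_add_left)
  have "\<exists>M. \<forall>x\<in>Ksp. norm ((c + cnj d) *\<^sub>C x) \<le> M * norm x"
    by (rule exI[of _ "norm (c + cnj d)"]) (simp del: complex_cnj_add)
  then have "toep ((c + cnj d) *\<^sub>C zp 0) (\<lambda>x. (c + cnj d) *\<^sub>C x)"
    unfolding toep_def bop_def by (simp add: scaleC_add_right mult_scale_left mult.commute del: norm_scaleC)
  from toep_unique[OF t this x] show ?thesis .
qed

theorem toep_product:
  assumes T1: "toep \<rho>1 T1" and T2: "toep \<rho>2 T2"
    and ns1: "\<not> (\<exists>c. \<forall>x\<in>Ksp. T1 x = c *\<^sub>C x)" and ns2: "\<not> (\<exists>c. \<forall>x\<in>Ksp. T2 x = c *\<^sub>C x)"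
  shows "(\<exists>\<rho>. toep \<rho> (T1 \<circ> T2)) \<longleftrightarrow>
    (\<exists>a. \<exists>\<psi>1\<in>Ksp. \<exists>\<psi>2\<in>Ksp. \<exists>c1 c2. \<rho>1 \<simeq> \<psi>1 + a *\<^sub>C cj (W \<psi>1) + c1 *\<^sub>C zp 0 \<and>
        \<rho>2 \<simeq> \<psi>2 + a *\<^sub>C cj (W \<psi>2) + c2 *\<^sub>C zp 0) \<or>
    (\<exists>\<psi>1\<in>Ksp. \<exists>\<psi>2\<in>Ksp. \<rho>1 \<simeq> cj \<psi>1 \<and> \<rho>2 \<simeq> cj \<psi>2)" (is "?L \<longleftrightarrow> ?R1 \<or> ?R2")
proof
  assume L: ?L
  obtain \<psi>1 \<eta>1 where 1: "\<psi>1 \<in> Ksp" "\<eta>1 \<in> Ksp" "\<rho>1 \<simeq> \<psi>1 + cj \<eta>1" by (rule symbol_decomposition)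
  obtain \<psi>2 \<eta>2 where 2: "\<psi>2 \<in> Ksp" "\<eta>2 \<in> Ksp" "\<rho>2 \<simeq> \<psi>2 + cj \<eta>2" by (rule symbol_decomposition)
  have t1: "toep (\<psi>1 + cj \<eta>1) T1" using T1 1(3) by (rule toep_sym_eq)
  have t2: "toep (\<psi>2 + cj \<eta>2) T2" using T2 2(3) by (rule toep_sym_eq)
  define K0 where "K0 = {f \<in> Ksp. cip f (zp 0) = 0}"
  have prod: "cip f \<eta>2 * cip \<psi>1 g = cip f (W \<psi>2) * cip (W \<eta>1) g" if "f \<in> K0" "g \<in> K0" for f g
    using toep_comp_iff[OF t1 t2 1(1,2) 2(1,2)] L that by (auto simp: K0_def)
  have perp: "\<exists>c. x = c *\<^sub>C k0" if "x \<in> Ksp" "\<And>f. f \<in> K0 \<Longrightarrow> cip f x = 0" for x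
    using perp_k0[of x] that by (auto simp: K0_def)
  have perp': "\<exists>c. x = c *\<^sub>C k0" if "x \<in> Ksp" "\<And>f. f \<in> K0 \<Longrightarrow> cip x f = 0" for x
    using perp[OF that(1)] that(2) cip_commute[of _ x] by simp
  have W_mult: "\<exists>c. x = c *\<^sub>C k0" if W: "W x = c *\<^sub>C k0" and x: "x \<in> Ksp" for x c
  proof -
    have WW: "W (W x) = (cnj c * - u0) *\<^sub>C k0" unfolding W by (simp add: W_scale W_k0)
    have "x = W (W x) + cip x (zp 0) *\<^sub>C k0" by (simp add: W_W[OF x])
    also have "\<dots> = (cnj c * - u0 + cip x (zp 0)) *\<^sub>C k0"
      by (simp only: WW scaleC_add_left)
    finally show ?thesis by blast
  qed
  have n2: "\<not> ((\<forall>f\<in>K0. cip f \<eta>2 = 0) \<and> (\<forall>f\<in>K0. cip f (W \<psi>2) = 0))"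
  proof
    assume *: "(\<forall>f\<in>K0. cip f \<eta>2 = 0) \<and> (\<forall>f\<in>K0. cip f (W \<psi>2) = 0)"
    obtain d where d: "\<eta>2 = d *\<^sub>C k0" using perp[OF 2(2)] * by blast
    obtain c' where "W \<psi>2 = c' *\<^sub>C k0" using perp[OF W_in] * by blast
    then obtain c where "\<psi>2 = c *\<^sub>C k0" using W_mult 2(1) by blast
    then show False using toep_scalar[of c d T2] t2 ns2 d by blast
  qed
  have n1: "\<not> ((\<forall>g\<in>K0. cip \<psi>1 g = 0) \<and> (\<forall>g\<in>K0. cip (W \<eta>1) g = 0))"
  proof
    assume *: "(\<forall>g\<in>K0. cip \<psi>1 g = 0) \<and> (\<forall>g\<in>K0. cip (W \<eta>1) g = 0)"
    obtain d where d: "\<psi>1 = d *\<^sub>C k0" using perp'[OF 1(1)] * by blast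
    obtain c' where "W \<eta>1 = c' *\<^sub>C k0" using perp'[OF W_in] * by blast
    then obtain c where "\<eta>1 = c *\<^sub>C k0" using W_mult 1(2) by blast
    then show False using toep_scalar[of d c T1] t1 ns1 d by blast
  qed
  show "?R1 \<or> ?R2"
  proof (cases "\<forall>f\<in>K0. cip f (W \<psi>2) = 0")
    case True
    then obtain f where f: "f \<in> K0" "cip f \<eta>2 \<noteq> 0" using n2 by blast
    have "cip \<psi>1 g = 0" if "g \<in> K0" for g
      using prod[OF f(1) that] True f by auto
    then obtain d1 where d1: "\<psi>1 = d1 *\<^sub>C k0" using perp'[OF 1(1)] by blast
    obtain c' where "W \<psi>2 = c' *\<^sub>C k0" using perp[OF W_in] True by blast
    then obtain d2 where d2: "\<psi>2 = d2 *\<^sub>C k0" using W_mult 2(1) by blast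
    have *: "d *\<^sub>C k0 + cj \<eta> \<simeq> cj (\<eta> + cnj d *\<^sub>C k0)" for d \<eta>
    proof -
      have "d *\<^sub>C k0 \<simeq> d *\<^sub>C cj k0"
        by (intro sym_eq_scale) (rule sym_eq_trans[OF sym_eq_k0(1) sym_eq_sym[OF sym_eq_k0(2)]])
      then have "d *\<^sub>C k0 + cj \<eta> \<simeq> d *\<^sub>C cj k0 + cj \<eta>" by (intro sym_eq_add) auto
      then show ?thesis by (simp add: add.commute)
    qed
    have "\<rho>1 \<simeq> cj (\<eta>1 + cnj d1 *\<^sub>C k0)" using sym_eq_trans[OF 1(3)[unfolded d1] *] .
    moreover have "\<rho>2 \<simeq> cj (\<eta>2 + cnj d2 *\<^sub>C k0)" using sym_eq_trans[OF 2(3)[unfolded d2] *] .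
    moreover have "\<eta>1 + cnj d1 *\<^sub>C k0 \<in> Ksp" "\<eta>2 + cnj d2 *\<^sub>C k0 \<in> Ksp" using 1 2 by auto
    ultimately show ?thesis by blast
  next
    case False
    then obtain f0 where f0: "f0 \<in> K0" "cip f0 (W \<psi>2) \<noteq> 0" by blast
    define a where "a = cip f0 \<eta>2 / cip f0 (W \<psi>2)"
    have \<delta>: "cip (W \<eta>1) g = a * cip \<psi>1 g" if "g \<in> K0" for g
      using prod[OF f0(1) that] f0(2) by (simp add: a_def field_simps)
    then obtain g0 where g0: "g0 \<in> K0" "cip \<psi>1 g0 \<noteq> 0"
      using n1 by (metis mult_zero_right)
    have \<alpha>: "cip f \<eta>2 = a * cip f (W \<psi>2)" if "f \<in> K0" for f
      using prod[OF that g0(1)] \<delta>[OF g0(1)] g0(2) by (simp add: field_simps)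
    have "cip f (\<eta>2 - cnj a *\<^sub>C W \<psi>2) = 0" if "f \<in> K0" for f
      using \<alpha>[OF that] by (simp add: cip_simps)
    then obtain d2 where "\<eta>2 - cnj a *\<^sub>C W \<psi>2 = d2 *\<^sub>C k0"
      using perp[of "\<eta>2 - cnj a *\<^sub>C W \<psi>2"] 2 by auto
    then have \<eta>2: "\<eta>2 = cnj a *\<^sub>C W \<psi>2 + d2 *\<^sub>C k0" by (simp add: algebra_simps)
    have "cip (W \<eta>1 - a *\<^sub>C \<psi>1) g = 0" if "g \<in> K0" for g
      using \<delta>[OF that] by (simp add: cip_simps)
    then obtain d where "W \<eta>1 - a *\<^sub>C \<psi>1 = d *\<^sub>C k0"
      using perp'[of "W \<eta>1 - a *\<^sub>C \<psi>1"] 1 by auto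
    then have "W \<eta>1 = a *\<^sub>C \<psi>1 + d *\<^sub>C k0" by (simp add: algebra_simps)
    then have WW: "W (W \<eta>1) = cnj a *\<^sub>C W \<psi>1 + (cnj d * - u0) *\<^sub>C k0"
      by (simp add: W_add W_scale W_k0)
    have "\<eta>1 = W (W \<eta>1) + cip \<eta>1 (zp 0) *\<^sub>C k0" by (simp add: W_W[OF 1(2)])
    then have "\<eta>1 = cnj a *\<^sub>C W \<psi>1 + (cnj d * - u0 + cip \<eta>1 (zp 0)) *\<^sub>C k0"
      by (simp only: WW scaleC_add_left add.assoc)
    then obtain d1 where \<eta>1: "\<eta>1 = cnj a *\<^sub>C W \<psi>1 + d1 *\<^sub>C k0" by blast
    have *: "\<psi> + cj (cnj a *\<^sub>C x + d *\<^sub>C k0) \<simeq> \<psi> + a *\<^sub>C cj x + cnj d *\<^sub>C zp 0" for \<psi> x d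
    proof -
      have "(\<psi> + a *\<^sub>C cj x) + cnj d *\<^sub>C cj k0 \<simeq> (\<psi> + a *\<^sub>C cj x) + cnj d *\<^sub>C zp 0"
        by (intro sym_eq_add sym_eq_scale sym_eq_k0 sym_eq_refl)
      then show ?thesis by (simp add: add.assoc)
    qed
    have "\<rho>1 \<simeq> \<psi>1 + a *\<^sub>C cj (W \<psi>1) + cnj d1 *\<^sub>C zp 0"
      by (rule sym_eq_trans[OF 1(3)[unfolded \<eta>1] *])
    moreover have "\<rho>2 \<simeq> \<psi>2 + a *\<^sub>C cj (W \<psi>2) + cnj d2 *\<^sub>C zp 0"
      by (rule sym_eq_trans[OF 2(3)[unfolded \<eta>2] *])
    ultimately show ?thesis using 1(1) 2(1) by blast
  qed
next
  assume "?R1 \<or> ?R2"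
  then show ?L
  proof
    assume ?R1
    then obtain a \<psi>1 \<psi>2 c1 c2 where K: "\<psi>1 \<in> Ksp" "\<psi>2 \<in> Ksp"
      and r: "\<rho>1 \<simeq> \<psi>1 + a *\<^sub>C cj (W \<psi>1) + c1 *\<^sub>C zp 0" "\<rho>2 \<simeq> \<psi>2 + a *\<^sub>C cj (W \<psi>2) + c2 *\<^sub>C zp 0"
      by blast
    define \<eta>1 where "\<eta>1 = cnj a *\<^sub>C W \<psi>1 + cnj c1 *\<^sub>C k0"
    define \<eta>2 where "\<eta>2 = cnj a *\<^sub>C W \<psi>2 + cnj c2 *\<^sub>C k0"
    have *: "\<psi> + a *\<^sub>C cj x + c *\<^sub>C zp 0 \<simeq> \<psi> + cj (cnj a *\<^sub>C x + cnj c *\<^sub>C k0)" for \<psi> x c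
    proof -
      have "(\<psi> + a *\<^sub>C cj x) + c *\<^sub>C zp 0 \<simeq> (\<psi> + a *\<^sub>C cj x) + c *\<^sub>C cj k0"
        by (intro sym_eq_add sym_eq_scale sym_eq_sym[OF sym_eq_k0(2)] sym_eq_refl)
      then show ?thesis by (simp add: add.assoc)
    qed
    have t1: "toep (\<psi>1 + cj \<eta>1) T1"
      unfolding \<eta>1_def by (rule toep_sym_eq[OF T1 sym_eq_trans[OF r(1) *]])
    have t2: "toep (\<psi>2 + cj \<eta>2) T2"
      unfolding \<eta>2_def by (rule toep_sym_eq[OF T2 sym_eq_trans[OF r(2) *]])
    have \<eta>: "\<eta>1 \<in> Ksp" "\<eta>2 \<in> Ksp" by (simp_all add: \<eta>1_def \<eta>2_def)
    have W1: "W \<eta>1 = a *\<^sub>C \<psi>1 - (a * cip \<psi>1 (zp 0) + c1 * u0) *\<^sub>C k0"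
      unfolding \<eta>1_def using K by (simp add: W_add W_scale W_W W_k0 scaleC_diff_right scaleC_add_left algebra_simps)
        (simp flip: uminus_scaleC)
    show ?L
      unfolding toep_comp_iff[OF t1 t2 K(1) \<eta>(1) K(2) \<eta>(2)]
    proof (intro ballI impI)
      fix f g assume fg: "f \<in> Ksp" "g \<in> Ksp" "cip f (zp 0) = 0" "cip g (zp 0) = 0"
      have "cip f \<eta>2 = a * cip f (W \<psi>2)" using fg by (simp add: \<eta>2_def cip_simps cip_k0)
      moreover have "cip (W \<eta>1) g = a * cip \<psi>1 g" using fg by (simp add: W1 cip_simps cip_k0_left)
      ultimately show "cip f \<eta>2 * cip \<psi>1 g = cip f (W \<psi>2) * cip (W \<eta>1) g" by simp
    qed
  next
    assume ?R2
    then obtain \<eta>1 \<eta>2 where K: "\<eta>1 \<in> Ksp" "\<eta>2 \<in> Ksp" and r: "\<rho>1 \<simeq> cj \<eta>1" "\<rho>2 \<simeq> cj \<eta>2" by blast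
    have t1: "toep (0 + cj \<eta>1) T1" and t2: "toep (0 + cj \<eta>2) T2"
      using T1 T2 r by (auto intro: toep_sym_eq)
    show ?L
      unfolding toep_comp_iff[OF t1 t2 Ksp_zero K(1) Ksp_zero K(2)] by simp
  qed
qed

end

context model_space
begin

lemma bop_extension:
  assumes K: "\<And>x. x \<in> Kb \<Longrightarrow> G x \<in> Ksp"
    and add: "\<And>x y. x \<in> Kb \<Longrightarrow> y \<in> Kb \<Longrightarrow> G (x + y) = G x + G y"
    and scale: "\<And>c x. x \<in> Kb \<Longrightarrow> G (c *\<^sub>C x) = c *\<^sub>C G x"
    and bound: "\<And>x. x \<in> Kb \<Longrightarrow> norm (G x) \<le> M * norm x"
  obtains T where "bop T" "\<And>x. x \<in> Kb \<Longrightarrow> T x = G x"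
proof -
  have diff: "G (x - y) = G x - G y" if "x \<in> Kb" "y \<in> Kb" for x y
    using add[of "x - y" y] that by (simp add: eq_diff_eq)
  have M: "norm (G x) \<le> \<bar>M\<bar> * norm x" if "x \<in> Kb" for x
    using bound[OF that] by (meson abs_ge_self mult_right_mono norm_ge_zero order_trans)
  have "\<bar>M\<bar>-lipschitz_on Kb G"
    by (rule lipschitz_onI) (use M[of "_ - _"] in \<open>simp_all add: dist_norm flip: diff\<close>)
  then have "uniformly_continuous_on Kb G"
    by (rule lipschitz_on_uniformly_continuous)
  then obtain T where T: "uniformly_continuous_on (closure Kb) T" "\<And>x. x \<in> Kb \<Longrightarrow> G x = T x"
    using uniformly_continuous_on_extension_on_closure by metis
  have cl: "x \<in> closure Kb" if "x \<in> Ksp" for x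
    using Kb_dense[OF that] by (metis closure_sequential)
  have lim: "(\<lambda>n. G (s n)) \<longlonglongrightarrow> T x" if "\<And>n::nat. s n \<in> Kb" "s \<longlonglongrightarrow> x" "x \<in> Ksp" for s x
  proof -
    have "continuous_on (closure Kb) T" using T(1) by (rule uniformly_continuous_imp_continuous)
    then have "(\<lambda>n. T (s n)) \<longlonglongrightarrow> T x"
      by (rule continuous_on_tendsto_compose[OF _ that(2) cl[OF that(3)]])
        (use that(1) closure_subset[of Kb] in \<open>simp add: subset_iff\<close>)
    then show ?thesis by (simp only: T(2)[OF that(1)])
  qed
  have "bop T"
    unfolding bop_def
  proof (intro conjI ballI allI exI[of _ "\<bar>M\<bar>"])
    fix x assume x: "x \<in> Ksp"
    obtain s where s: "\<And>n::nat. s n \<in> Kb" "s \<longlonglongrightarrow> x" using Kb_dense[OF x] by metis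
    note l = lim[OF s x]
    show "T x \<in> Ksp" by (rule Ksp_closed[OF _ l]) (rule K[OF s(1)])
    show "norm (T x) \<le> \<bar>M\<bar> * norm x"
    proof (rule LIMSEQ_le)
      show "(\<lambda>n. norm (G (s n))) \<longlonglongrightarrow> norm (T x)" by (intro tendsto_norm l)
      show "(\<lambda>n. \<bar>M\<bar> * norm (s n)) \<longlonglongrightarrow> \<bar>M\<bar> * norm x" by (intro tendsto_intros s)
    qed (use M s in auto)
    show "T (c *\<^sub>C x) = c *\<^sub>C T x" for c
    proof (rule LIMSEQ_unique)
      show "(\<lambda>n. G (c *\<^sub>C s n)) \<longlonglongrightarrow> T (c *\<^sub>C x)"
        using s x by (intro lim tendsto_scaleC tendsto_const) auto
      show "(\<lambda>n. G (c *\<^sub>C s n)) \<longlonglongrightarrow> c *\<^sub>C T x"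
        using s by (simp add: scale tendsto_scaleC l)
    qed
    show "T (x + y) = T x + T y" if y: "y \<in> Ksp" for y
    proof -
      obtain t where t: "\<And>n::nat. t n \<in> Kb" "t \<longlonglongrightarrow> y" using Kb_dense[OF y] by metis
      show ?thesis
      proof (rule LIMSEQ_unique)
        show "(\<lambda>n. G (s n + t n)) \<longlonglongrightarrow> T (x + y)"
          using s t x y by (intro lim tendsto_add) auto
        show "(\<lambda>n. G (s n + t n)) \<longlonglongrightarrow> T x + T y"
          using s t by (simp add: add tendsto_add l lim[OF t y])
      qed
    qed
  qed
  then show ?thesis by (rule that) (rule T(2)[symmetric])
qed

lemma toep_extension:
  assumes "\<And>x. x \<in> Kb \<Longrightarrow> norm (Kproj (\<rho> \<odot> x)) \<le> M * norm x"
  obtains T where "toep \<rho> T"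
proof -
  have a: "\<rho> \<odot> (x + y) = \<rho> \<odot> x + \<rho> \<odot> y" if "x \<in> Kb" "y \<in> Kb" for x y
    using that by (simp add: mult_add_right_bd Kb_D)
  obtain T where T: "bop T" "\<And>x. x \<in> Kb \<Longrightarrow> T x = Kproj (\<rho> \<odot> x)"
  proof (rule bop_extension[of "\<lambda>x. Kproj (\<rho> \<odot> x)" M])
  qed (simp_all add: a Kproj_add mult_scale_right Kproj_scale assms)
  have "toep \<rho> T" using T by (simp add: toep_def cip_Kproj_K Kb_D)
  then show ?thesis by (rule that)
qed

lemma toep_Kb:
  assumes "toep \<rho> T" "x \<in> Kb"
  shows "T x = Kproj (\<rho> \<odot> x)"
proof (rule Kb_dense_eqI)
  show "T x \<in> Ksp" using toep_bop[OF assms(1)] Kb_D(1)[OF assms(2)] by (rule bop_in)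
  show "cip (T x) k = cip (Kproj (\<rho> \<odot> x)) k" if "k \<in> Kb" for k
    using assms that by (simp add: toep_def cip_Kproj_K Kb_D)
qed simp

lemma sym_eq_iff_Kproj: "\<rho> \<simeq> \<rho>' \<longleftrightarrow> (\<forall>x\<in>Kb. Kproj (\<rho> \<odot> x) = Kproj (\<rho>' \<odot> x))"
proof
  assume "\<rho> \<simeq> \<rho>'"
  then show "\<forall>x\<in>Kb. Kproj (\<rho> \<odot> x) = Kproj (\<rho>' \<odot> x)"
    by (intro ballI Kb_dense_eqI) (auto simp: sym_eq_def cip_Kproj_K Kb_D)
next
  assume *: "\<forall>x\<in>Kb. Kproj (\<rho> \<odot> x) = Kproj (\<rho>' \<odot> x)"
  show "\<rho> \<simeq> \<rho>'"
    unfolding sym_eq_def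
  proof (intro ballI)
    fix f g assume fg: "f \<in> Kb" "g \<in> Kb"
    have "cip (Kproj (\<rho> \<odot> f)) g = cip (Kproj (\<rho>' \<odot> f)) g" using * fg by simp
    then show "cip (\<rho> \<odot> f) g = cip (\<rho>' \<odot> f) g" using fg by (simp add: cip_Kproj_K Kb_D)
  qed
qed

end

section \<open>Real symmetric inner functions\<close>

locale sym_model_space = model_space +
  assumes fl_u [simp]: "fl u = cj u"
begin

definition hat :: "l2 \<Rightarrow> l2" where "hat x = cj (fl x)"

definition D :: "l2 \<Rightarrow> l2" where "D x = u \<odot> (zp (- 1) \<odot> fl x)"

lemma cj_hat: "cj (hat x) = fl x" and fl_hat: "fl (hat x) = cj x" and hat_hat [simp]: "hat (hat x) = x"
  by (simp_all add: hat_def cj_fl)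

lemma hat_add: "hat (x + y) = hat x + hat y"
  and hat_scale: "hat (c *\<^sub>C x) = cnj c *\<^sub>C hat x"
  and hat_mult: "hat (x \<odot> y) = hat x \<odot> hat y"
  and hat_zp [simp]: "hat (zp n) = zp n"
  and hat_u [simp]: "hat u = u"
  and bd_hat [simp]: "bd (hat x) \<longleftrightarrow> bd x"
  by (simp_all add: hat_def)

lemma cip_hat: "cip (hat x) (hat y) = cip y x"
  by (simp add: hat_def)

lemma cip_hat_left: "cip (hat x) y = cip (hat y) x"
  using cip_hat[of x "hat y"] by simp

lemma hat_Hardy [simp]: "x \<in> Hardy \<Longrightarrow> hat x \<in> Hardy"
  unfolding Hardy_def using cip_hat[of x "zp _"] cip_commute[of "zp _" x] by simp

lemma hat_Ksp [simp]:
  assumes "x \<in> Ksp" shows "hat x \<in> Ksp"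
  unfolding Ksp_def
proof (intro CollectI conjI ballI)
  show "hat x \<in> Hardy" using assms by (simp add: Ksp_Hardy)
  fix h assume "h \<in> Hardy"
  then show "cip (hat x) (u \<odot> h) = 0"
    using assms cip_hat_left[of x "u \<odot> h"] by (simp add: hat_mult Ksp_u)
qed

lemma hat_Kb [simp]: "x \<in> Kb \<Longrightarrow> hat x \<in> Kb"
  by (simp add: Kb_def)

lemma hat_conj_op: "hat (conj_op x) = conj_op (hat x)"
  by (simp add: conj_op_def hat_mult) (simp add: hat_def cj_fl)

lemma hat_Kproj: "hat (Kproj x) = Kproj (hat x)"
proof (rule Ksp_eqI)
  fix k assume k: "k \<in> Ksp"
  have "cip (hat (Kproj x)) k = cip (hat k) (Kproj x)" by (rule cip_hat_left)
  also have "\<dots> = cip (Kproj (hat k)) x" by (rule cip_Kproj[symmetric])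
  also have "\<dots> = cip (hat k) x" using k by simp
  also have "\<dots> = cip (hat x) k" by (rule cip_hat_left)
  finally show "cip (hat (Kproj x)) k = cip (Kproj (hat x)) k" using k by (simp add: cip_Kproj_K)
qed auto

lemma hat_W: "hat (W x) = W (hat x)"
  by (simp add: W_def shift_def hat_Kproj hat_mult hat_conj_op)

lemma D_eq: "D x = conj_op (hat x)"
  by (simp add: D_def conj_op_def cj_hat)

lemma D_in [simp]: "x \<in> Ksp \<Longrightarrow> D x \<in> Ksp"
  and D_Kb [simp]: "x \<in> Kb \<Longrightarrow> D x \<in> Kb"
  and D_D [simp]: "D (D x) = x"
  and D_add: "D (x + y) = D x + D y"
  and D_scale: "D (c *\<^sub>C x) = c *\<^sub>C D x"
  by (simp_all add: D_eq flip: hat_conj_op)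
    (simp_all add: hat_conj_op hat_add hat_scale conj_op_add conj_op_scale)

lemma cip_D_D: "cip (D x) (D y) = cip x y"
  by (simp add: D_eq cip_conj_op cip_hat)

lemma cip_D: "cip (D x) y = cip x (D y)"
  using cip_D_D[of x "D y"] by simp

lemma norm_D [simp]: "norm (D x) = norm x"
  by (simp add: norm_eq_cip cip_D_D)

lemma D_eq_iff: "D x = D y \<longleftrightarrow> x = y"
  by (metis D_D)

lemma Kproj_D: "Kproj (D x) = D (Kproj x)"
  by (rule Kproj_eqI) (auto simp: cip_D cip_Kproj_K)

lemma cip_mult_D:
  assumes "bd f" "bd g" shows "cip (\<rho> \<odot> D f) (D g) = cip (fl \<rho> \<odot> f) g"
proof -
  have v: "D x = fl x \<odot> (u \<odot> zp (- 1))" if "bd x" for x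
    using that unfolding D_def by (metis bd_u bd_zp bd_fl mult_assoc mult_commute)
  have "cip (\<rho> \<odot> D f) (D g) = cip ((\<rho> \<odot> fl f) \<odot> (u \<odot> zp (- 1))) (u \<odot> (zp (- 1) \<odot> fl g))"
    using assms by (simp add: v[of f] mult_assoc) (simp add: D_def)
  also have "(\<rho> \<odot> fl f) \<odot> (u \<odot> zp (- 1)) = u \<odot> (zp (- 1) \<odot> (\<rho> \<odot> fl f))"
    by (metis bd_mult bd_u bd_zp mult_assoc mult_commute)
  also have "cip \<dots> (u \<odot> (zp (- 1) \<odot> fl g)) = cip (\<rho> \<odot> fl f) (fl g)" by simp
  also have "\<dots> = cip (fl (\<rho> \<odot> fl f)) g" by (rule cip_fl_left[symmetric])
  finally show ?thesis by simp
qed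

lemma sym_eq_fl_imp: "\<rho> \<simeq> \<rho>' \<Longrightarrow> fl \<rho> \<simeq> fl \<rho>'"
  unfolding sym_eq_def by (metis D_Kb Kb_D(2) cip_mult_D)

lemma sym_eq_fl: "fl \<rho> \<simeq> \<rho>' \<longleftrightarrow> \<rho> \<simeq> fl \<rho>'"
  using sym_eq_fl_imp[of "fl \<rho>" \<rho>'] sym_eq_fl_imp[of \<rho> "fl \<rho>'"] by auto

lemma toep_D:
  assumes "toep \<rho> T" shows "toep (fl \<rho>) (\<lambda>x. D (T (D x)))"
proof -
  have b: "bop T" using assms by (rule toep_bop)
  obtain M where M: "\<And>x. x \<in> Ksp \<Longrightarrow> norm (T x) \<le> M * norm x" using bop_bound[OF b] by blast
  have "bop (\<lambda>x. D (T (D x)))"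
    unfolding bop_def
  proof (intro conjI ballI allI exI[of _ M])
    fix x assume x: "x \<in> Ksp"
    show "D (T (D x)) \<in> Ksp" using x by (intro D_in bop_in[OF b])
    show "norm (D (T (D x))) \<le> M * norm x" using M[of "D x"] x by simp
    show "D (T (D (c *\<^sub>C x))) = c *\<^sub>C D (T (D x))" for c
      using x by (simp add: D_scale bop_scale[OF b])
    show "D (T (D (x + y))) = D (T (D x)) + D (T (D y))" if "y \<in> Ksp" for y
      using x that by (simp add: D_add bop_add[OF b])
  qed
  moreover have "cip (D (T (D f))) g = cip (fl \<rho> \<odot> f) g" if "f \<in> Kb" "g \<in> Kb" for f g
  proof -
    have "cip (D (T (D f))) g = cip (T (D f)) (D g)" by (rule cip_D)
    also have "\<dots> = cip (\<rho> \<odot> D f) (D g)" using assms that by (simp add: toep_def)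
    finally show ?thesis using that by (simp add: cip_mult_D Kb_D)
  qed
  ultimately show ?thesis by (simp add: toep_def)
qed

lemma hankel_eq:
  assumes "bd x"
  shows "Kproj (zp (- 1) \<odot> fl (\<phi> \<odot> x - Hproj (\<phi> \<odot> x))) = D (Kproj (u \<odot> \<phi> \<odot> x))"
proof -
  let ?y = "\<phi> \<odot> x"
  have D: "D (u \<odot> y) = zp (- 1) \<odot> fl y" for y
    by (simp add: D_def zp_mult_commute)
  have "Kproj (zp (- 1) \<odot> fl (Hproj ?y)) = 0"
  proof (rule Kproj_eqI)
    fix k assume k: "k \<in> Ksp"
    have "cip (zp (- 1) \<odot> fl (Hproj ?y)) (zp n) = 0" if "n \<ge> 0" for n
      using that by (simp add: cip_zp_mult_left cip_fl_left cip_Hproj_zp)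
    then show "cip (zp (- 1) \<odot> fl (Hproj ?y)) k = cip 0 k"
      using Hardy_perp(2)[OF Ksp_Hardy[OF k]] by simp
  qed simp
  then have "Kproj (zp (- 1) \<odot> fl (?y - Hproj ?y)) = Kproj (zp (- 1) \<odot> fl ?y)"
    by (simp add: mult_diff_right Kproj_diff)
  also have "\<dots> = D (Kproj (u \<odot> ?y))" unfolding D[symmetric] by (rule Kproj_D)
  also have "u \<odot> ?y = u \<odot> \<phi> \<odot> x" using assms by (metis bd_u mult_assoc mult_commute)
  finally show ?thesis .
qed

end

section \<open>Boundary functions and their classes\<close>

lemma abs_l2_diff: "f \<in> L2 \<Longrightarrow> g \<in> L2 \<Longrightarrow> abs_l2 f - abs_l2 g = abs_l2 (\<lambda>z. f z - g z)"
  by (simp add: minus_l2.abs_eq)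

lemma abs_l2_cj: "f \<in> L2 \<Longrightarrow> cj (abs_l2 f) = abs_l2 (\<lambda>z. cnj (f z))"
  by (simp add: cj.abs_eq)

lemma abs_l2_fl: "f \<in> L2 \<Longrightarrow> fl (abs_l2 f) = abs_l2 (\<lambda>z. f (cnj z))"
  by (simp add: fl.abs_eq)

lemma zp_1_abs: "zp 1 = abs_l2 (\<lambda>z. z)" and L2_id: "(\<lambda>z. z) \<in> L2"
  using L2_powi[of 1] by (simp_all add: zp_eq_abs_l2)

lemma zp_minus_1_abs: "zp (- 1) = abs_l2 (\<lambda>z. cnj z)"
  using abs_l2_cj[OF L2_id] by (simp flip: zp_1_abs)

lemma mult_bounded_abs:
  assumes "f \<in> L2" "b \<in> L2" "bd (abs_l2 b)"
  shows "(\<lambda>z. f z * b z) \<in> L2" "(\<lambda>z. b z * f z) \<in> L2"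
    "abs_l2 (\<lambda>z. f z * b z) = abs_l2 f \<odot> abs_l2 b" "abs_l2 (\<lambda>z. b z * f z) = abs_l2 b \<odot> abs_l2 f"
proof -
  show L: "(\<lambda>z. f z * b z) \<in> L2" "(\<lambda>z. b z * f z) \<in> L2"
    using assms bd_transfer_L2[of f b] by (auto simp: bd.abs_eq)
  show "abs_l2 (\<lambda>z. f z * b z) = abs_l2 f \<odot> abs_l2 b" "abs_l2 (\<lambda>z. b z * f z) = abs_l2 b \<odot> abs_l2 f"
    using L assms by (simp_all add: mult_abs)
qed

lemma L2_inner_abs: "f \<in> L2 \<Longrightarrow> g \<in> L2 \<Longrightarrow> L2_inner f g = cip (abs_l2 f) (abs_l2 g)"
  by (simp add: cip.abs_eq)

lemma H2_iff: "f \<in> H2 \<longleftrightarrow> f \<in> L2 \<and> abs_l2 f \<in> Hardy"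
  by (auto simp: H2_def Hardy_def fourier_coeff_def L2_inner_abs L2_powi zp_eq_abs_l2)

lemma L2_norm_diff: "f \<in> L2 \<Longrightarrow> g \<in> L2 \<Longrightarrow> L2_norm (\<lambda>z. f z - g z) = norm (abs_l2 f - abs_l2 g)"
  by (simp add: abs_l2_diff norm_abs_l2 L2_diff)

lemma orth_proj_abs:
  assumes M: "\<And>g. g \<in> M \<longleftrightarrow> g \<in> L2 \<and> abs_l2 g \<in> S" and f: "f \<in> L2"
    and S: "\<And>x y. x \<in> S \<Longrightarrow> y \<in> S \<Longrightarrow> x - y \<in> S"
    and p: "p \<in> S" "\<And>k. k \<in> S \<Longrightarrow> cip (abs_l2 f - p) k = 0"
  shows "orth_proj M f \<in> M" "abs_l2 (orth_proj M f) = p"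
proof -
  let ?P = "\<lambda>g. g \<in> M \<and> (\<forall>h\<in>M. L2_inner (\<lambda>z. f z - g z) h = 0)"
  have i: "L2_inner (\<lambda>z. f z - g z) h = cip (abs_l2 f - abs_l2 g) (abs_l2 h)" if "g \<in> M" "h \<in> M" for g h
    using that f M by (simp add: L2_inner_abs L2_diff abs_l2_diff)
  have "?P (rep_l2 p)"
  proof (intro conjI ballI)
    show r: "rep_l2 p \<in> M" using M p by simp
    fix h assume "h \<in> M"
    then show "L2_inner (\<lambda>z. f z - rep_l2 p z) h = 0" using r M p by (simp add: i)
  qed
  then have P: "?P (orth_proj M f)" unfolding orth_proj_def by (rule someI[where P = ?P])
  then show "orth_proj M f \<in> M" by blast
  let ?g = "abs_l2 (orth_proj M f)"
  have g: "?g \<in> S" using P M by blast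
  have "cip (abs_l2 f - ?g) k = 0" if "k \<in> S" for k
    using P i[of "orth_proj M f" "rep_l2 k"] M[of "rep_l2 k"] that by simp
  then have "cip (p - ?g) k = 0" if "k \<in> S" for k
    using p(2)[OF that] that by (simp add: cip_diff_left)
  then have "cip (p - ?g) (p - ?g) = 0" using S[OF p(1) g] by blast
  then show "?g = p" by simp
qed

lemma orth_proj_H2:
  assumes "f \<in> L2"
  shows "orth_proj H2 f \<in> H2" "abs_l2 (orth_proj H2 f) = Hproj (abs_l2 f)"
proof -
  have "cip (abs_l2 f - Hproj (abs_l2 f)) k = 0" if "k \<in> Hardy" for k
    using that by (simp add: cip_diff_left cip_Hproj Hproj_Hardy)
  from orth_proj_abs[OF H2_iff assms Hardy_diff Hproj_in_Hardy this]
  show "orth_proj H2 f \<in> H2" "abs_l2 (orth_proj H2 f) = Hproj (abs_l2 f)" by blast+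
qed

locale real_sym_inner =
  fixes v :: "complex \<Rightarrow> complex"
  assumes inner: "inner_function v" and nonconst: "nonconstant v" and sym: "real_symmetric v"
begin

lemma v_H2: "v \<in> H2" and v_L2: "v \<in> L2" and v_norm: "AE z in circle. norm (v z) = 1"
  using inner by (auto simp: inner_function_def H2_iff)

sublocale sym_model_space "abs_l2 v"
proof
  show "abs_l2 v \<in> Hardy" using v_H2 by (simp add: H2_iff)
  show bd: "bd (abs_l2 v)"
    using v_norm by (auto simp: bd.abs_eq v_L2 intro!: exI[of _ 1] elim!: eventually_mono)
  have c: "(\<lambda>z. v z * cnj (v z)) \<in> L2" "abs_l2 v \<odot> cj (abs_l2 v) = abs_l2 (\<lambda>z. v z * cnj (v z))"
    using mult_bounded_abs[OF v_L2 L2_cnj[OF v_L2]] bd by (simp_all add: v_L2 flip: abs_l2_cj)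
  have "AE z in circle. v z * cnj (v z) = 1"
    using v_norm
  proof eventually_elim
    case (elim z)
    then show ?case using complex_norm_square[of "v z"] by simp
  qed
  then have "abs_l2 (\<lambda>z. v z * cnj (v z)) = abs_l2 (\<lambda>z. z powi 0)"
    using c(1) by (subst abs_l2_eq_iff) (auto simp: L2_const ae_eq_def)
  then show "abs_l2 v \<odot> cj (abs_l2 v) = zp 0" by (simp only: c(2) zp_eq_abs_l2)
  show "abs_l2 v \<noteq> c *\<^sub>C zp 0" for c
  proof
    assume "abs_l2 v = c *\<^sub>C zp 0"
    then have "abs_l2 v = abs_l2 (\<lambda>z. c)" by (simp add: zp_eq_abs_l2 abs_l2_scale L2_const)
    then have "v =\<^sub>T (\<lambda>z. c)" using abs_l2_eq_iff[OF v_L2 L2_const] by blast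
    then show False using nonconst by (auto simp: nonconstant_def)
  qed
  have h: "hat_op v \<in> L2" "abs_l2 (hat_op v) = cj (fl (abs_l2 v))"
    by (simp_all add: hat_op_def abs_l2_fl abs_l2_cj v_L2 L2_flip L2_cnj)
  have "abs_l2 v = abs_l2 (hat_op v)"
    using sym abs_l2_eq_iff[OF v_L2 h(1)] by (simp add: real_symmetric_def)
  then have "cj (abs_l2 v) = cj (cj (fl (abs_l2 v)))" by (simp add: h(2))
  then show "fl (abs_l2 v) = cj (abs_l2 v)" by simp
qed

notation sym_eq (infix "\<simeq>" 50)

abbreviation "V \<equiv> abs_l2 v"

lemma K_iff: "f \<in> K v \<longleftrightarrow> f \<in> L2 \<and> abs_l2 f \<in> Ksp"
proof -
  have i: "L2_inner f (\<lambda>z. v z * h z) = cip (abs_l2 f) (V \<odot> abs_l2 h)" if "f \<in> L2" "h \<in> L2" for f h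
    using that mult_bounded_abs[OF that(2) v_L2] by (simp add: L2_inner_abs)
  show ?thesis
  proof
    assume f: "f \<in> K v"
    then have fL: "f \<in> L2" "abs_l2 f \<in> Hardy" by (auto simp: K_def H2_iff)
    moreover have "cip (abs_l2 f) (V \<odot> h) = 0" if "h \<in> Hardy" for h
      using f i[OF fL(1), of "rep_l2 h"] that by (simp add: K_def H2_iff)
    ultimately show "f \<in> L2 \<and> abs_l2 f \<in> Ksp" by (simp add: Ksp_def)
  next
    assume "f \<in> L2 \<and> abs_l2 f \<in> Ksp"
    then show "f \<in> K v" by (simp add: K_def H2_iff i Ksp_def)
  qed
qed

lemma K_bdd_iff: "f \<in> K_bdd v \<longleftrightarrow> f \<in> L2 \<and> abs_l2 f \<in> Kb"
  by (simp add: K_bdd_def K_iff Kb_def bd.abs_eq cong: conj_cong)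

lemma orth_proj_K:
  assumes "f \<in> L2"
  shows "orth_proj (K v) f \<in> K v" "abs_l2 (orth_proj (K v) f) = Kproj (abs_l2 f)"
  using orth_proj_abs[OF K_iff assms, of "Kproj (abs_l2 f)"]
  by (simp_all add: cip_diff_left cip_Kproj)

lemma hat_op_abs: "f \<in> L2 \<Longrightarrow> hat_op f \<in> L2" "f \<in> L2 \<Longrightarrow> abs_l2 (hat_op f) = hat (abs_l2 f)"
  by (simp_all add: hat_op_def hat_def abs_l2_fl abs_l2_cj L2_flip L2_cnj)

lemma C_op_abs:
  assumes "f \<in> L2"
  shows "C_op v f \<in> L2" "abs_l2 (C_op v f) = conj_op (abs_l2 f)"
proof -
  have 1: "(\<lambda>z. z * f z) \<in> L2" "abs_l2 (\<lambda>z. z * f z) = zp 1 \<odot> abs_l2 f"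
    using mult_bounded_abs[OF assms L2_id] by (simp_all flip: zp_1_abs)
  have 2: "(\<lambda>z. cnj (z * f z)) \<in> L2" "abs_l2 (\<lambda>z. cnj (z * f z)) = zp (- 1) \<odot> cj (abs_l2 f)"
    using L2_cnj[OF 1(1)] abs_l2_cj[OF 1(1)] unfolding 1(2) by simp_all
  show "C_op v f \<in> L2" "abs_l2 (C_op v f) = conj_op (abs_l2 f)"
    unfolding C_op_def conj_op_def using mult_bounded_abs[OF 2(1) v_L2] unfolding 2(2) by simp_all
qed

lemma D_op_abs:
  assumes "f \<in> L2" shows "D_op v f \<in> L2" "abs_l2 (D_op v f) = D (abs_l2 f)"
  using C_op_abs[OF hat_op_abs(1)[OF assms]] by (simp_all add: D_op_def D_eq hat_op_abs assms)

lemma S_op_abs: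
  assumes "f \<in> L2" shows "S_op v f \<in> L2" "abs_l2 (S_op v f) = shift (abs_l2 f)"
proof -
  have 1: "(\<lambda>z. z * f z) \<in> L2" "abs_l2 (\<lambda>z. z * f z) = zp 1 \<odot> abs_l2 f"
    using mult_bounded_abs[OF assms L2_id] by (simp_all flip: zp_1_abs)
  show "S_op v f \<in> L2" "abs_l2 (S_op v f) = shift (abs_l2 f)"
    using orth_proj_K[OF 1(1)] by (simp_all add: S_op_def shift_def 1(2) K_iff)
qed

lemma J_op_abs:
  assumes "f \<in> L2" shows "J_op f \<in> L2" "abs_l2 (J_op f) = zp (- 1) \<odot> fl (abs_l2 f)"
  using mult_bounded_abs[OF L2_flip[OF assms] L2_cnj[OF L2_id]]
  by (simp_all add: J_op_def abs_l2_fl assms flip: zp_minus_1_abs)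

lemma A_op_abs:
  assumes "\<phi> \<in> L2" "f \<in> K_bdd v"
  shows "A_op v \<phi> f \<in> K v" "abs_l2 (A_op v \<phi> f) = Kproj (abs_l2 \<phi> \<odot> abs_l2 f)"
proof -
  have f: "f \<in> L2" "bd (abs_l2 f)" using assms by (auto simp: K_bdd_iff Kb_D)
  note m = mult_bounded_abs[OF assms(1) f]
  show "A_op v \<phi> f \<in> K v" "abs_l2 (A_op v \<phi> f) = Kproj (abs_l2 \<phi> \<odot> abs_l2 f)"
    unfolding A_op_def using orth_proj_K[OF m(1)] by (simp_all add: m(3))
qed

lemma B_op_abs:
  assumes "\<phi> \<in> L2" "f \<in> K_bdd v"
  shows "B_op v \<phi> f \<in> K v" "abs_l2 (B_op v \<phi> f) = D (Kproj (V \<odot> abs_l2 \<phi> \<odot> abs_l2 f))"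
proof -
  have f: "f \<in> L2" "bd (abs_l2 f)" using assms by (auto simp: K_bdd_iff Kb_D)
  note m = mult_bounded_abs[OF assms(1) f]
  have p: "orth_proj H2 (\<lambda>w. \<phi> w * f w) \<in> L2"
    using orth_proj_H2(1)[OF m(1)] by (simp add: H2_iff)
  have d: "(\<lambda>z. \<phi> z * f z - orth_proj H2 (\<lambda>w. \<phi> w * f w) z) \<in> L2" (is "?d \<in> _")
    using m(1) p by (rule L2_diff)
  have da: "abs_l2 ?d = abs_l2 \<phi> \<odot> abs_l2 f - Hproj (abs_l2 \<phi> \<odot> abs_l2 f)"
    using orth_proj_H2(2)[OF m(1)] by (simp add: m(1,3) p flip: abs_l2_diff)
  show "B_op v \<phi> f \<in> K v" "abs_l2 (B_op v \<phi> f) = D (Kproj (V \<odot> abs_l2 \<phi> \<odot> abs_l2 f))"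
    unfolding B_op_def using orth_proj_K[OF J_op_abs(1)[OF d]]
    by (simp_all only: J_op_abs(2)[OF d] da hankel_eq[OF f(2)])
qed

lemma tendsto_norm_diff_iff: "((\<lambda>n. norm (s n - x)) \<longlongrightarrow> 0) F \<longleftrightarrow> (s \<longlongrightarrow> x) F" for x :: l2
  unfolding tendsto_dist_iff[of s x] dist_norm ..

lemma bounded_ext_abs:
  assumes Q: "\<And>f. f \<in> K_bdd v \<Longrightarrow> Q f \<in> L2 \<and> abs_l2 (Q f) = T (abs_l2 f)"
    and T: "bop T" and f: "f \<in> K v"
  shows "bounded_ext v Q f \<in> K v" "abs_l2 (bounded_ext v Q f) = T (abs_l2 f)"
proof -
  let ?P = "\<lambda>g. g \<in> K v \<and> (\<forall>s. (\<forall>n. s n \<in> K_bdd v) \<longrightarrow> (\<lambda>n. L2_norm (\<lambda>z. s n z - f z)) \<longlonglongrightarrow> 0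
        \<longrightarrow> (\<lambda>n. L2_norm (\<lambda>z. Q (s n) z - g z)) \<longlonglongrightarrow> 0)"
  have fK: "f \<in> L2" "abs_l2 f \<in> Ksp" using f by (auto simp: K_iff)
  have n: "L2_norm (\<lambda>z. Q s z - g z) = norm (T (abs_l2 s) - abs_l2 g)" if "s \<in> K_bdd v" "g \<in> K v" for s g
    using Q[OF that(1)] that(2) by (simp add: L2_norm_diff K_iff)
  have "?P (rep_l2 (T (abs_l2 f)))"
  proof (intro conjI allI impI)
    show r: "rep_l2 (T (abs_l2 f)) \<in> K v" using bop_in[OF T fK(2)] by (simp add: K_iff)
    fix s :: "nat \<Rightarrow> complex \<Rightarrow> complex"
    assume s: "\<forall>n. s n \<in> K_bdd v" "(\<lambda>n. L2_norm (\<lambda>z. s n z - f z)) \<longlonglongrightarrow> 0"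
    have sK: "s n \<in> L2" "abs_l2 (s n) \<in> Ksp" for n using s(1) by (auto simp: K_bdd_iff Kb_D)
    have "(\<lambda>n. norm (abs_l2 (s n) - abs_l2 f)) \<longlonglongrightarrow> 0"
      using s(2) sK fK by (simp add: L2_norm_diff)
    then have "(\<lambda>n. abs_l2 (s n)) \<longlonglongrightarrow> abs_l2 f"
      by (simp only: tendsto_norm_diff_iff)
    then have "(\<lambda>n. T (abs_l2 (s n))) \<longlonglongrightarrow> T (abs_l2 f)"
      using bop_tendsto[OF T, of "\<lambda>n. abs_l2 (s n)" "abs_l2 f"] sK fK by blast
    then have "(\<lambda>n. norm (T (abs_l2 (s n)) - T (abs_l2 f))) \<longlonglongrightarrow> 0"
      by (simp only: tendsto_norm_diff_iff)
    then show "(\<lambda>n. L2_norm (\<lambda>z. Q (s n) z - rep_l2 (T (abs_l2 f)) z)) \<longlonglongrightarrow> 0"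
      using s(1) n r by simp
  qed
  then have P: "?P (bounded_ext v Q f)" unfolding bounded_ext_def by (rule someI[where P = ?P])
  then show g: "bounded_ext v Q f \<in> K v" by blast
  obtain t where t: "\<And>n::nat. t n \<in> Kb" "t \<longlonglongrightarrow> abs_l2 f" using Kb_dense[OF fK(2)] by metis
  let ?s = "\<lambda>n. rep_l2 (t n)"
  have s: "\<forall>n. ?s n \<in> K_bdd v" using t by (simp add: K_bdd_iff)
  have lim: "(\<lambda>n. L2_norm (\<lambda>z. ?s n z - f z)) \<longlonglongrightarrow> 0"
    using t fK by (simp add: L2_norm_diff tendsto_norm_diff_iff)
  have "(\<lambda>n. L2_norm (\<lambda>z. Q (?s n) z - bounded_ext v Q f z)) \<longlonglongrightarrow> 0"
    by (rule P[THEN conjunct2, THEN spec, THEN mp, THEN mp, OF s lim])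
  then have "(\<lambda>n. T (t n)) \<longlonglongrightarrow> abs_l2 (bounded_ext v Q f)"
    using s g by (simp add: n tendsto_norm_diff_iff)
  moreover have "(\<lambda>n. T (t n)) \<longlonglongrightarrow> T (abs_l2 f)"
    by (rule bop_tendsto[OF T _ fK(2) t(2)]) (rule Kb_D(1)[OF t(1)])
  ultimately show "abs_l2 (bounded_ext v Q f) = T (abs_l2 f)" by (rule LIMSEQ_unique)
qed

lemma A_op_toep:
  assumes "\<phi> \<in> L2" "bounded_op v (A_op v \<phi>)"
  obtains T where "toep (abs_l2 \<phi>) T"
proof -
  obtain M where M: "\<And>f. f \<in> K_bdd v \<Longrightarrow> L2_norm (A_op v \<phi> f) \<le> M * L2_norm f"
    using assms(2) by (auto simp: bounded_op_def)
  have "norm (Kproj (abs_l2 \<phi> \<odot> x)) \<le> M * norm x" if "x \<in> Kb" for x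
  proof -
    have f: "rep_l2 x \<in> K_bdd v" using that by (simp add: K_bdd_iff)
    have "A_op v \<phi> (rep_l2 x) \<in> L2" using A_op_abs(1)[OF assms(1) f] by (simp add: K_iff)
    then show ?thesis
      using M[OF f] A_op_abs(2)[OF assms(1) f] by (simp flip: norm_abs_l2)
  qed
  then show ?thesis using toep_extension that by blast
qed

lemma bounded_ext_A_op:
  assumes "\<phi> \<in> L2" "toep (abs_l2 \<phi>) T" "f \<in> K v"
  shows "bounded_ext v (A_op v \<phi>) f \<in> K v" "abs_l2 (bounded_ext v (A_op v \<phi>) f) = T (abs_l2 f)"
proof -
  have q: "A_op v \<phi> g \<in> L2 \<and> abs_l2 (A_op v \<phi> g) = T (abs_l2 g)" if "g \<in> K_bdd v" for g
    using A_op_abs[OF assms(1) that] toep_Kb[OF assms(2)] that by (simp add: K_iff K_bdd_iff)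
  show "bounded_ext v (A_op v \<phi>) f \<in> K v"
    by (rule bounded_ext_abs(1)[OF _ toep_bop[OF assms(2)] assms(3)]) (rule q)
  show "abs_l2 (bounded_ext v (A_op v \<phi>) f) = T (abs_l2 f)"
    by (rule bounded_ext_abs(2)[OF _ toep_bop[OF assms(2)] assms(3)]) (rule q)
qed

lemma toep_bounded_op:
  assumes "\<phi> \<in> L2" "toep (abs_l2 \<phi>) T"
  shows "bounded_op v (A_op v \<phi>)"
proof -
  obtain M where M: "\<And>x. x \<in> Ksp \<Longrightarrow> norm (T x) \<le> M * norm x"
    using bop_bound[OF toep_bop[OF assms(2)]] by blast
  have "L2_norm (A_op v \<phi> f) \<le> M * L2_norm f" if "f \<in> K_bdd v" for f
  proof -
    have "A_op v \<phi> f \<in> L2" "f \<in> L2" "abs_l2 f \<in> Kb"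
      using A_op_abs(1)[OF assms(1) that] that by (auto simp: K_iff K_bdd_iff)
    then show ?thesis
      using M[of "abs_l2 f"] toep_Kb[OF assms(2), of "abs_l2 f"] A_op_abs(2)[OF assms(1) that]
      by (simp add: Kb_D flip: norm_abs_l2)
  qed
  then show ?thesis by (auto simp: bounded_op_def)
qed

lemma B_op_toep:
  assumes "\<phi> \<in> L2" "bounded_op v (B_op v \<phi>)"
  obtains T where "toep (V \<odot> abs_l2 \<phi>) T"
    "\<And>f. f \<in> K v \<Longrightarrow> bounded_ext v (B_op v \<phi>) f \<in> K v"
    "\<And>f. f \<in> K v \<Longrightarrow> abs_l2 (bounded_ext v (B_op v \<phi>) f) = D (T (abs_l2 f))"
proof -
  obtain M where M: "\<And>f. f \<in> K_bdd v \<Longrightarrow> L2_norm (B_op v \<phi> f) \<le> M * L2_norm f"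
    using assms(2) by (auto simp: bounded_op_def)
  have "norm (Kproj (V \<odot> abs_l2 \<phi> \<odot> x)) \<le> M * norm x" if "x \<in> Kb" for x
  proof -
    have f: "rep_l2 x \<in> K_bdd v" using that by (simp add: K_bdd_iff)
    have "B_op v \<phi> (rep_l2 x) \<in> L2" using B_op_abs(1)[OF assms(1) f] by (simp add: K_iff)
    then show ?thesis
      using M[OF f] B_op_abs(2)[OF assms(1) f] by (simp flip: norm_abs_l2)
  qed
  then obtain T where T: "toep (V \<odot> abs_l2 \<phi>) T" using toep_extension by blast
  have "bop D" unfolding bop_def by (auto simp: D_add D_scale intro!: exI[of _ 1])
  then have DT: "bop (D \<circ> T)" using toep_bop[OF T] by (rule bop_compose)
  have q: "B_op v \<phi> g \<in> L2 \<and> abs_l2 (B_op v \<phi> g) = (D \<circ> T) (abs_l2 g)" if "g \<in> K_bdd v" for g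
    using B_op_abs[OF assms(1) that] toep_Kb[OF T] that by (simp add: K_iff K_bdd_iff)
  have "bounded_ext v (B_op v \<phi>) f \<in> K v" if "f \<in> K v" for f
    by (rule bounded_ext_abs(1)[OF _ DT that]) (rule q)
  moreover have "abs_l2 (bounded_ext v (B_op v \<phi>) f) = D (T (abs_l2 f))" if "f \<in> K v" for f
    using bounded_ext_abs(2)[OF _ DT that, OF q] by simp
  ultimately show ?thesis by (rule that[OF T])
qed

lemma truncated_Toeplitz_iff:
  assumes S: "bop S" and T: "\<And>f. f \<in> K v \<Longrightarrow> T f \<in> K v" "\<And>f. f \<in> K v \<Longrightarrow> abs_l2 (T f) = S (abs_l2 f)"
  shows "T \<in> truncated_Toeplitz v \<longleftrightarrow> (\<exists>\<rho>. toep \<rho> S)"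
proof
  assume "T \<in> truncated_Toeplitz v"
  then obtain \<phi> where \<phi>: "\<phi> \<in> L2" "bounded_op v (A_op v \<phi>)"
    and eq: "\<And>f. f \<in> K v \<Longrightarrow> T f =\<^sub>T bounded_ext v (A_op v \<phi>) f"
    by (auto simp: truncated_Toeplitz_def)
  obtain A where A: "toep (abs_l2 \<phi>) A" using A_op_toep[OF \<phi>] .
  have "S x = A x" if "x \<in> Ksp" for x
  proof -
    have f: "rep_l2 x \<in> K v" using that by (simp add: K_iff)
    note b = bounded_ext_A_op[OF \<phi>(1) A f]
    have "abs_l2 (T (rep_l2 x)) = abs_l2 (bounded_ext v (A_op v \<phi>) (rep_l2 x))"
      using eq[OF f] T(1)[OF f] b(1) by (subst abs_l2_eq_iff) (auto simp: K_iff)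
    then show ?thesis using T(2)[OF f] b(2) by simp
  qed
  then have "toep (abs_l2 \<phi>) S" using A S by (simp add: toep_def Kb_D)
  then show "\<exists>\<rho>. toep \<rho> S" ..
next
  assume "\<exists>\<rho>. toep \<rho> S"
  then obtain \<rho> where "toep \<rho> S" ..
  then have \<rho>: "toep (abs_l2 (rep_l2 \<rho>)) S" by simp
  have "T f =\<^sub>T bounded_ext v (A_op v (rep_l2 \<rho>)) f" if "f \<in> K v" for f
  proof -
    note b = bounded_ext_A_op[OF rep_l2_L2 \<rho> that]
    have "T f \<in> L2" "bounded_ext v (A_op v (rep_l2 \<rho>)) f \<in> L2"
      using T(1)[OF that] b(1) by (auto simp: K_iff)
    from abs_l2_eq_iff[OF this] show ?thesis using T(2)[OF that] b(2) by simp
  qed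
  then show "T \<in> truncated_Toeplitz v"
    using T(1) toep_bounded_op[OF rep_l2_L2 \<rho>] rep_l2_L2[of \<rho>] unfolding truncated_Toeplitz_def by blast
qed

lemma multiple_of_D_iff:
  assumes "\<And>f. f \<in> K v \<Longrightarrow> Q f \<in> K v" "\<And>f. f \<in> K v \<Longrightarrow> abs_l2 (Q f) = D (T (abs_l2 f))"
  shows "multiple_of_D v Q \<longleftrightarrow> (\<exists>c. \<forall>x\<in>Ksp. T x = c *\<^sub>C x)"
proof -
  have *: "Q f =\<^sub>T (\<lambda>z. c * D_op v f z) \<longleftrightarrow> T (abs_l2 f) = c *\<^sub>C abs_l2 f" if f: "f \<in> K v" for f c
  proof -
    have fL: "f \<in> L2" using f by (simp add: K_iff)
    have "Q f =\<^sub>T (\<lambda>z. c * D_op v f z) \<longleftrightarrow> abs_l2 (Q f) = abs_l2 (\<lambda>z. c * D_op v f z)"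
      using assms(1)[OF f] by (intro abs_l2_eq_iff[symmetric] L2_scale D_op_abs fL) (simp add: K_iff)
    also have "abs_l2 (\<lambda>z. c * D_op v f z) = D (c *\<^sub>C abs_l2 f)"
      by (simp add: D_op_abs fL D_scale flip: abs_l2_scale)
    finally show ?thesis using assms(2)[OF f] by (simp add: D_eq_iff)
  qed
  show ?thesis
    unfolding multiple_of_D_def
  proof (intro iff_exI iffI ballI)
    fix c x assume H: "\<forall>f\<in>K v. Q f =\<^sub>T (\<lambda>z. c * D_op v f z)" and x: "x \<in> Ksp"
    then show "T x = c *\<^sub>C x" using *[of "rep_l2 x" c] by (simp add: K_iff)
  next
    fix c f assume "\<forall>x\<in>Ksp. T x = c *\<^sub>C x" and f: "f \<in> K v"
    then show "Q f =\<^sub>T (\<lambda>z. c * D_op v f z)" using *[OF f] by (simp add: K_iff)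
  qed
qed

lemma B_equiv_iff:
  assumes "\<phi> \<in> L2" "\<psi> \<in> L2"
  shows "B_equiv v \<phi> \<psi> \<longleftrightarrow> V \<odot> abs_l2 \<phi> \<simeq> V \<odot> abs_l2 \<psi>"
proof -
  have *: "B_op v \<phi> f =\<^sub>T B_op v \<psi> f \<longleftrightarrow>
      Kproj (V \<odot> abs_l2 \<phi> \<odot> abs_l2 f) = Kproj (V \<odot> abs_l2 \<psi> \<odot> abs_l2 f)" if f: "f \<in> K_bdd v" for f
    using B_op_abs[OF assms(1) f] B_op_abs[OF assms(2) f]
      abs_l2_eq_iff[of "B_op v \<phi> f" "B_op v \<psi> f"] by (auto simp: K_iff D_eq_iff)
  show ?thesis
    unfolding B_equiv_def sym_eq_iff_Kproj
  proof (intro iffI ballI)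
    fix x assume H: "\<forall>f\<in>K_bdd v. B_op v \<phi> f =\<^sub>T B_op v \<psi> f" and x: "x \<in> Kb"
    then show "Kproj (V \<odot> abs_l2 \<phi> \<odot> x) = Kproj (V \<odot> abs_l2 \<psi> \<odot> x)"
      using *[of "rep_l2 x"] by (simp add: K_bdd_iff)
  next
    fix f assume "\<forall>x\<in>Kb. Kproj (V \<odot> abs_l2 \<phi> \<odot> x) = Kproj (V \<odot> abs_l2 \<psi> \<odot> x)" "f \<in> K_bdd v"
    then show "B_op v \<phi> f =\<^sub>T B_op v \<psi> f" using * by (simp add: K_bdd_iff)
  qed
qed

lemma cnj_v_mult:
  assumes "f \<in> L2"
  shows "(\<lambda>z. cnj (v z) * f z) \<in> L2" "abs_l2 (\<lambda>z. cnj (v z) * f z) = cj V \<odot> abs_l2 f"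
  using mult_bounded_abs[OF assms L2_cnj[OF v_L2]] by (simp_all add: v_L2 flip: abs_l2_cj)

lemma symbol_combination:
  assumes "f \<in> L2" "g \<in> L2"
  shows "(\<lambda>z. cnj (v z) * f z + a * cnj (v z) * g z + cnj (v z) * c) \<in> L2"
    "V \<odot> abs_l2 (\<lambda>z. cnj (v z) * f z + a * cnj (v z) * g z + cnj (v z) * c)
      = abs_l2 f + a *\<^sub>C abs_l2 g + c *\<^sub>C zp 0"
proof -
  have L: "(\<lambda>z. f z + a * g z + c) \<in> L2"
    using assms by (intro L2_add L2_scale L2_const)
  have eq: "(\<lambda>z. cnj (v z) * f z + a * cnj (v z) * g z + cnj (v z) * c) = (\<lambda>z. cnj (v z) * (f z + a * g z + c))"
    by (simp add: algebra_simps)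
  have c: "abs_l2 (\<lambda>z. c) = c *\<^sub>C zp 0" by (simp add: zp_eq_abs_l2 abs_l2_scale L2_const)
  have "abs_l2 f + a *\<^sub>C abs_l2 g + c *\<^sub>C zp 0 = abs_l2 (\<lambda>z. f z + a * g z + c)"
    unfolding c[symmetric] using assms by (simp add: abs_l2_scale abs_l2_add L2_add L2_scale L2_const)
  then show "(\<lambda>z. cnj (v z) * f z + a * cnj (v z) * g z + cnj (v z) * c) \<in> L2"
    "V \<odot> abs_l2 (\<lambda>z. cnj (v z) * f z + a * cnj (v z) * g z + cnj (v z) * c)
      = abs_l2 f + a *\<^sub>C abs_l2 g + c *\<^sub>C zp 0"
    unfolding eq using cnj_v_mult[OF L] by simp_all
qed

lemma B_equiv_Finite_left:
  assumes "\<phi> \<in> L2" "\<psi> \<in> K v"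
  shows "B_equiv v \<phi> (\<lambda>z. cnj (v z) * cnj (hat_op \<psi> z)
            + a * cnj (v z) * S_op v (C_op v (hat_op \<psi>)) z + cnj (v z) * c)
    \<longleftrightarrow> fl (V \<odot> abs_l2 \<phi>) \<simeq> abs_l2 \<psi> + a *\<^sub>C cj (W (abs_l2 \<psi>)) + c *\<^sub>C zp 0"
proof -
  let ?x = "abs_l2 \<psi>"
  have \<psi>: "\<psi> \<in> L2" using assms by (simp add: K_iff)
  note h = hat_op_abs[OF \<psi>]
  have 1: "(\<lambda>z. cnj (hat_op \<psi> z)) \<in> L2" "abs_l2 (\<lambda>z. cnj (hat_op \<psi> z)) = fl ?x"
    using L2_cnj[OF h(1)] abs_l2_cj[OF h(1)] by (simp_all add: h(2) cj_hat)
  have 2: "S_op v (C_op v (hat_op \<psi>)) \<in> L2" "abs_l2 (S_op v (C_op v (hat_op \<psi>))) = W (hat ?x)"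
    using S_op_abs[OF C_op_abs(1)[OF h(1)]] C_op_abs(2)[OF h(1)] by (simp_all add: h(2) W_def)
  have "fl ?x + a *\<^sub>C W (hat ?x) + c *\<^sub>C zp 0 = fl (?x + a *\<^sub>C cj (W ?x) + c *\<^sub>C zp 0)"
    by (simp flip: hat_W) (simp add: hat_def cj_fl)
  then show ?thesis
    unfolding B_equiv_iff[OF assms(1) symbol_combination(1)[OF 1(1) 2(1)]]
      symbol_combination(2)[OF 1(1) 2(1)] 1(2) 2(2) sym_eq_fl by simp
qed

lemma B_equiv_Finite_right:
  assumes "\<phi> \<in> L2" "\<psi> \<in> K v"
  shows "B_equiv v \<phi> (\<lambda>z. cnj (v z) * \<psi> z
            + a * cnj (v z) * cnj (S_op v (C_op v \<psi>) z) + cnj (v z) * c)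
    \<longleftrightarrow> V \<odot> abs_l2 \<phi> \<simeq> abs_l2 \<psi> + a *\<^sub>C cj (W (abs_l2 \<psi>)) + c *\<^sub>C zp 0"
proof -
  have \<psi>: "\<psi> \<in> L2" using assms by (simp add: K_iff)
  have 2: "S_op v (C_op v \<psi>) \<in> L2" "abs_l2 (S_op v (C_op v \<psi>)) = W (abs_l2 \<psi>)"
    using S_op_abs[OF C_op_abs(1)[OF \<psi>]] C_op_abs(2)[OF \<psi>] by (simp_all add: W_def)
  show ?thesis
    unfolding B_equiv_iff[OF assms(1) symbol_combination(1)[OF \<psi> L2_cnj[OF 2(1)]]]
      symbol_combination(2)[OF \<psi> L2_cnj[OF 2(1)]] using abs_l2_cj[OF 2(1)] 2(2) by simp
qed

lemma B_equiv_Infinity_left: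
  assumes "\<phi> \<in> L2" "\<psi> \<in> K v"
  shows "B_equiv v \<phi> (\<lambda>z. cnj (v z) * hat_op \<psi> z) \<longleftrightarrow> fl (V \<odot> abs_l2 \<phi>) \<simeq> cj (abs_l2 \<psi>)"
proof -
  have h: "hat_op \<psi> \<in> L2" "abs_l2 (hat_op \<psi>) = hat (abs_l2 \<psi>)"
    using assms by (simp_all add: K_iff hat_op_abs)
  show ?thesis
    unfolding B_equiv_iff[OF assms(1) cnj_v_mult(1)[OF h(1)]] cnj_v_mult(2)[OF h(1)] h(2) sym_eq_fl
    by (simp add: hat_def cj_fl)
qed

lemma B_equiv_Infinity_right:
  assumes "\<phi> \<in> L2" "\<psi> \<in> K v"
  shows "B_equiv v \<phi> (\<lambda>z. cnj (v z) * cnj (\<psi> z)) \<longleftrightarrow> V \<odot> abs_l2 \<phi> \<simeq> cj (abs_l2 \<psi>)"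
proof -
  have \<psi>: "\<psi> \<in> L2" using assms by (simp add: K_iff)
  show ?thesis
    unfolding B_equiv_iff[OF assms(1) cnj_v_mult(1)[OF L2_cnj[OF \<psi>]]] cnj_v_mult(2)[OF L2_cnj[OF \<psi>]]
    using abs_l2_cj[OF \<psi>] by simp
qed

lemma K_abs_ex: "(\<exists>f\<in>K v. P (abs_l2 f)) \<longleftrightarrow> (\<exists>x\<in>Ksp. P x)"
proof
  show "\<exists>f\<in>K v. P (abs_l2 f) \<Longrightarrow> \<exists>x\<in>Ksp. P x" by (auto simp: K_iff)
  assume "\<exists>x\<in>Ksp. P x"
  then obtain x where "x \<in> Ksp" "P x" by blast
  then show "\<exists>f\<in>K v. P (abs_l2 f)" by (intro bexI[of _ "rep_l2 x"]) (auto simp: K_iff)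
qed

lemma ex_extended_complex: "(\<exists>\<alpha>. P \<alpha>) \<longleftrightarrow> (\<exists>a. P (Finite a)) \<or> P Infinity"
proof
  assume "\<exists>\<alpha>. P \<alpha>"
  then obtain \<alpha> where "P \<alpha>" by blast
  then show "(\<exists>a. P (Finite a)) \<or> P Infinity" by (cases \<alpha>) auto
qed blast

end

theorem theorem5p3:
  fixes u \<phi>1 \<phi>2 :: "complex \<Rightarrow> complex"
  assumes "inner_function u" and "nonconstant u" and "real_symmetric u"
    and "\<phi>1 \<in> L2" and "\<phi>2 \<in> L2"
    and "bounded_op u (B_op u \<phi>1)" and "bounded_op u (B_op u \<phi>2)"
    and "\<not> multiple_of_D u (bounded_ext u (B_op u \<phi>1))"
    and "\<not> multiple_of_D u (bounded_ext u (B_op u \<phi>2))"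
  shows "bounded_ext u (B_op u \<phi>1) \<circ> bounded_ext u (B_op u \<phi>2) \<in> truncated_Toeplitz u \<longleftrightarrow>
    (\<exists>\<alpha> :: extended_complex. \<exists>\<psi>1\<in>K u. \<exists>\<psi>2\<in>K u. \<exists>c1 c2 :: complex.
      case \<alpha> of
        Finite a \<Rightarrow>
          B_equiv u \<phi>1 (\<lambda>z. cnj (u z) * cnj (hat_op \<psi>1 z)
            + a * cnj (u z) * S_op u (C_op u (hat_op \<psi>1)) z + cnj (u z) * c1) \<and>
          B_equiv u \<phi>2 (\<lambda>z. cnj (u z) * \<psi>2 z
            + a * cnj (u z) * cnj (S_op u (C_op u \<psi>2) z) + cnj (u z) * c2)
      | Infinity \<Rightarrow>
          B_equiv u \<phi>1 (\<lambda>z. cnj (u z) * hat_op \<psi>1 z) \<and>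
          B_equiv u \<phi>2 (\<lambda>z. cnj (u z) * cnj (\<psi>2 z)))" (is "?L \<longleftrightarrow> (\<exists>\<alpha>. ?R \<alpha>)")
proof -
  interpret real_sym_inner u
    using assms(1-3) by unfold_locales
  note \<phi> = assms(4,5) and b = assms(6,7) and nD = assms(8,9)
  obtain A1 where A1: "toep (V \<odot> abs_l2 \<phi>1) A1"
    "\<And>f. f \<in> K u \<Longrightarrow> bounded_ext u (B_op u \<phi>1) f \<in> K u"
    "\<And>f. f \<in> K u \<Longrightarrow> abs_l2 (bounded_ext u (B_op u \<phi>1) f) = D (A1 (abs_l2 f))"
    using B_op_toep[OF \<phi>(1) b(1)] by blast
  obtain A2 where A2: "toep (V \<odot> abs_l2 \<phi>2) A2"
    "\<And>f. f \<in> K u \<Longrightarrow> bounded_ext u (B_op u \<phi>2) f \<in> K u"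
    "\<And>f. f \<in> K u \<Longrightarrow> abs_l2 (bounded_ext u (B_op u \<phi>2) f) = D (A2 (abs_l2 f))"
    using B_op_toep[OF \<phi>(2) b(2)] by blast
  define A where "A = (\<lambda>x. D (A1 (D x)))"
  have A: "toep (fl (V \<odot> abs_l2 \<phi>1)) A" unfolding A_def using A1(1) by (rule toep_D)
  have n2: "\<not> (\<exists>c. \<forall>x\<in>Ksp. A2 x = c *\<^sub>C x)"
    using nD(2) multiple_of_D_iff[of "bounded_ext u (B_op u \<phi>2)" A2, OF A2(2,3)] by blast
  have n1: "\<not> (\<exists>c. \<forall>x\<in>Ksp. A x = c *\<^sub>C x)"
  proof
    assume "\<exists>c. \<forall>x\<in>Ksp. A x = c *\<^sub>C x"
    then obtain c where c: "\<And>x. x \<in> Ksp \<Longrightarrow> A x = c *\<^sub>C x" by blast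
    have "A1 x = c *\<^sub>C x" if "x \<in> Ksp" for x
    proof -
      have "D (A (D x)) = D (c *\<^sub>C D x)" using c[of "D x"] that by simp
      then show ?thesis by (simp add: A_def D_scale)
    qed
    then show False using nD(1) multiple_of_D_iff[of "bounded_ext u (B_op u \<phi>1)" A1, OF A1(2,3)] by blast
  qed
  have "?L \<longleftrightarrow> (\<exists>\<rho>. toep \<rho> (A \<circ> A2))"
  proof (rule truncated_Toeplitz_iff)
    show "bop (A \<circ> A2)" using A A2(1) by (intro bop_compose toep_bop)
    fix f assume f: "f \<in> K u"
    show "(bounded_ext u (B_op u \<phi>1) \<circ> bounded_ext u (B_op u \<phi>2)) f \<in> K u"
      using A1(2) A2(2) f by simp
    show "abs_l2 ((bounded_ext u (B_op u \<phi>1) \<circ> bounded_ext u (B_op u \<phi>2)) f) = (A \<circ> A2) (abs_l2 f)"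
      using A1(3)[OF A2(2)[OF f]] A2(3)[OF f] by (simp add: A_def)
  qed
  also have "\<dots> \<longleftrightarrow> (\<exists>a. ?R (Finite a)) \<or> ?R Infinity"
  proof -
    have F: "?R (Finite a) \<longleftrightarrow> (\<exists>x\<in>Ksp. \<exists>y\<in>Ksp. \<exists>c1 c2.
        fl (V \<odot> abs_l2 \<phi>1) \<simeq> x + a *\<^sub>C cj (W x) + c1 *\<^sub>C zp 0 \<and>
        V \<odot> abs_l2 \<phi>2 \<simeq> y + a *\<^sub>C cj (W y) + c2 *\<^sub>C zp 0)" for a
      unfolding K_abs_ex[symmetric] extended_complex.case
      by (intro bex_cong refl arg_cong[where f = Ex] ext arg_cong2[where f = "(\<and>)"]
        B_equiv_Finite_left[OF \<phi>(1)] B_equiv_Finite_right[OF \<phi>(2)])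
    have I: "?R Infinity \<longleftrightarrow> (\<exists>x\<in>Ksp. \<exists>y\<in>Ksp.
        fl (V \<odot> abs_l2 \<phi>1) \<simeq> cj x \<and> V \<odot> abs_l2 \<phi>2 \<simeq> cj y)"
      unfolding K_abs_ex[symmetric] extended_complex.case simp_thms
      by (intro bex_cong refl arg_cong2[where f = "(\<and>)"]
        B_equiv_Infinity_left[OF \<phi>(1)] B_equiv_Infinity_right[OF \<phi>(2)])
    show ?thesis unfolding F I by (rule toep_product[OF A A2(1) n1 n2])
  qed
  also have "\<dots> \<longleftrightarrow> (\<exists>\<alpha>. ?R \<alpha>)"
    by (rule ex_extended_complex[of ?R, symmetric])
  finally show ?thesis .
qed

end
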